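(* Let $p\in\partial X$ have active index set $I$, i.e. $p\in F_I^\circ$ with $I\neq\varnothing$. Then the following are equivalent: (1) $p$ is accessible for $g_\Pi$; (2) $p$ is finite-length approachable for $g_\Pi$; (3) $A_I<2$.
   Context: Let $X$ be a compact smooth $n$-dimensional manifold with corners (locally modelled on $[0,\infty)^k\times\mathbb R^{n-k}$, $0\le k\le n$) whose boundary hypersurfaces $H_1,\dots,H_N$ are globally embedded, and let $X^\circ=X\setminus\partial X$. For each $i$ let $\rho_i:X\to[0,\infty)$ be a smooth boundary-defining function of $H_i$: $H_i=\rho_i^{-1}(0)$, $d\rho_i\neq0$ on $H_i$, and $\rho_i>0$ on $X\setminus H_i$. Let $g_0$ be a smooth Riemannian metric on $X$ (up to the boundary), and let $\alpha_1,\dots,\alpha_N\ge 0$. The product metric on $X^\circ$ is $g_\Pi=\bigl(\prod_{i=1}^N\rho_i^{-\alpha_i}\bigr)g_0$. For a Riemannian metric $g$ on $X^\circ$, $d_g$ is the Riemannian distance (infimum of $g$-lengths of absolutely continuous curves in $X^\circ$) and $L_g$ is the $g$-length. The background topology is the topology of $X$. For $p\in X$, $I(p)=\{i: p\in H_i\}$ is the active index set; for $I\subseteq\{1,\dots,N\}$, $F_I^\circ=\{p\in X: I(p)=I\}$ is the corresponding open face; and $A_I=\sum_{i\in I}\alpha_i$. A point $p\in\partial X$ is accessible with respect to $g$ if there is a $d_g$-Cauchy sequence $\{p_n\}\subset X^\circ$ with $p_n\to p$ in the background topology. It is finite-length approachable with respect to $g$ if there is an absolutely continuous curve $\gamma:[0,1)\to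 X^\circ$ with $\gamma(t)\to p$ in the background topology as $t\uparrow1$ and $L_g(\gamma)<\infty$. *)

theory Defs
  imports "HOL-Analysis.Analysis"
begin

section \<open>Smooth maps on subsets of Euclidean space\<close>

text \<open>\<open>V\<close> is meant to be open.\<close>

primrec Ck_on ::
  "nat \<Rightarrow> 'a::euclidean_space set \<Rightarrow> ('a \<Rightarrow> 'b::real_normed_vector) \<Rightarrow> bool" where
  "Ck_on 0 V f \<longleftrightarrow> continuous_on V f"
| "Ck_on (Suc k) V f \<longleftrightarrow>
     f differentiable_on V \<and> (\<forall>v. Ck_on k V (\<lambda>x. frechet_derivative f (at x) v))"

text \<open>Smoothness on a not necessarily open set (``up to the boundary''): near every point of
  \<open>S\<close> the map is the restriction of a smooth map on an open set.\<close>

definition smooth_on :: "'a::euclidean_space set \<Rightarrow> ('a \<Rightarrow> 'b::real_normed_vector) \<Rightarrow> bool" where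
  "smooth_on S f \<longleftrightarrow>
     (\<forall>x\<in>S. \<exists>V h. open V \<and> x \<in> V \<and> (\<forall>k. Ck_on k V h) \<and> (\<forall>y\<in>S \<inter> V. h y = f y))"


section \<open>Manifolds with corners\<close>

text \<open>The model space $[0,\infty)^k \times \mathbb{R}^{n-k}$, with \<open>K\<close> the set of the
  \<open>k = card K\<close> constrained coordinates and \<open>n = CARD('n)\<close>.\<close>

definition corner_model :: "'n set \<Rightarrow> (real^'n) set" where
  "corner_model K = {x. \<forall>j\<in>K. 0 \<le> x $ j}"

text \<open>A chart: its domain, its coordinate map (relevant only on the domain), and the set of
  constrained coordinates of its model space.\<close>

datatype ('a, 'n::finite) corner_chart =
  Corner_Chart (cdom: "'a set") (cmap: "'a \<Rightarrow> real^'n") (cfaces: "'n set")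

definition is_corner_chart :: "'a topology \<Rightarrow> ('a, 'n::finite) corner_chart \<Rightarrow> bool" where
  "is_corner_chart X c \<longleftrightarrow>
     openin X (cdom c) \<and>
     openin (top_of_set (corner_model (cfaces c))) (cmap c ` cdom c) \<and>
     homeomorphic_map (subtopology X (cdom c)) (top_of_set (cmap c ` cdom c)) (cmap c)"

definition in_chart :: "('a, 'n::finite) corner_chart \<Rightarrow> ('a \<Rightarrow> 'b) \<Rightarrow> real^'n \<Rightarrow> 'b" where
  "in_chart c f = f \<circ> inv_into (cdom c) (cmap c)"

definition smooth_atlas :: "'a topology \<Rightarrow> ('a, 'n::finite) corner_chart set \<Rightarrow> bool" where
  "smooth_atlas X A \<longleftrightarrow>
     (\<forall>c\<in>A. is_corner_chart X c) \<and> (\<Union>c\<in>A. cdom c) = topspace X \<and>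
     (\<forall>c\<in>A. \<forall>c'\<in>A. smooth_on (cmap c ` (cdom c \<inter> cdom c')) (in_chart c (cmap c')))"

definition compact_manifold_with_corners ::
  "'a topology \<Rightarrow> ('a, 'n::finite) corner_chart set \<Rightarrow> bool" where
  "compact_manifold_with_corners X A \<longleftrightarrow>
     Hausdorff_space X \<and> second_countable X \<and> compact_space X \<and> smooth_atlas X A"

text \<open>The points of codimension (depth) \<open>k\<close>; the depth does not depend on the chart.\<close>

definition depth_stratum ::
  "('a, 'n::finite) corner_chart set \<Rightarrow> nat \<Rightarrow> 'a set" where
  "depth_stratum A k =
     {p. \<exists>c\<in>A. p \<in> cdom c \<and> card {j \<in> cfaces c. cmap c p $ j = 0} = k}"

definition mboundary :: "('a, 'n::finite) corner_chart set \<Rightarrow> 'a set" where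
  "mboundary A = (\<Union>k\<in>{1..}. depth_stratum A k)"

definition minterior :: "'a topology \<Rightarrow> ('a, 'n::finite) corner_chart set \<Rightarrow> 'a set" where
  "minterior X A = topspace X - mboundary A"

definition boundary_hypersurfaces ::
  "'a topology \<Rightarrow> ('a, 'n::finite) corner_chart set \<Rightarrow> 'a set set" where
  "boundary_hypersurfaces X A =
     (\<lambda>C. X closure_of C) ` connected_components_of (subtopology X (depth_stratum A 1))"

text \<open>An embedded hypersurface of the boundary is, near each of its points, a single coordinate
  face: different local faces at a corner never belong to the same hypersurface.\<close>

definition embedded_hypersurface ::
  "'a topology \<Rightarrow> ('a, 'n::finite) corner_chart set \<Rightarrow> 'a set \<Rightarrow> bool" where
  "embedded_hypersurface X A H \<longleftrightarrow>
     (\<forall>p\<in>H. \<exists>c\<in>A. \<exists>W. \<exists>j\<in>cfaces c. openin X W \<and> p \<in> W \<and> W \<subseteq> cdom c \<and>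
        H \<inter> W = {q \<in> W. cmap c q $ j = 0})"

text \<open>\<open>H 1, \<dots>, H N\<close> is an enumeration of all the boundary hypersurfaces, each of them embedded.\<close>

definition embedded_boundary_hypersurfaces ::
  "'a topology \<Rightarrow> ('a, 'n::finite) corner_chart set \<Rightarrow> nat \<Rightarrow> (nat \<Rightarrow> 'a set) \<Rightarrow> bool" where
  "embedded_boundary_hypersurfaces X A N H \<longleftrightarrow>
     bij_betw H {1..N} (boundary_hypersurfaces X A) \<and>
     (\<forall>i\<in>{1..N}. embedded_hypersurface X A (H i))"


section \<open>Smooth functions, boundary-defining functions, Riemannian metrics\<close>

definition smooth_function :: "('a, 'n::finite) corner_chart set \<Rightarrow> ('a \<Rightarrow> real) \<Rightarrow> bool" where
  "smooth_function A f \<longleftrightarrow> (\<forall>c\<in>A. smooth_on (cmap c ` cdom c) (in_chart c f))"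

text \<open>The differential at \<open>p\<close>, in the coordinates of \<open>c\<close>, of a map defined on an open subset \<open>U\<close>
  of \<open>cdom c\<close>. Derivatives within a relatively open subset of the model space are unique, also at
  boundary points.\<close>

definition differential_in ::
  "('a, 'n::finite) corner_chart \<Rightarrow> 'a set \<Rightarrow> ('a \<Rightarrow> 'b::real_normed_vector) \<Rightarrow> 'a \<Rightarrow> real^'n \<Rightarrow> 'b" where
  "differential_in c U f p = frechet_derivative (in_chart c f) (at (cmap c p) within cmap c ` U)"

definition boundary_defining ::
  "'a topology \<Rightarrow> ('a, 'n::finite) corner_chart set \<Rightarrow> 'a set \<Rightarrow> ('a \<Rightarrow> real) \<Rightarrow> bool" where
  "boundary_defining X A H \<rho> \<longleftrightarrow>
     smooth_function A \<rho> \<and>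
     (\<forall>p\<in>topspace X. 0 \<le> \<rho> p) \<and>
     H = {p \<in> topspace X. \<rho> p = 0} \<and>
     (\<forall>p\<in>H. \<forall>c\<in>A. p \<in> cdom c \<longrightarrow> differential_in c (cdom c) \<rho> p \<noteq> (\<lambda>v. 0)) \<and>
     (\<forall>p\<in>topspace X - H. 0 < \<rho> p)"

text \<open>Covariant 2-tensors are given by their local representatives: \<open>g c p v w\<close> is the value of
  the tensor at \<open>p\<close> on the tangent vectors with components \<open>v\<close>, \<open>w\<close> in the chart \<open>c\<close>, where
  \<open>p \<in> cdom c\<close>.\<close>

type_synonym ('a, 'n) two_tensor =
  "('a, 'n) corner_chart \<Rightarrow> 'a \<Rightarrow> real^'n \<Rightarrow> real^'n \<Rightarrow> real"

definition riemannian_metric ::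
  "('a, 'n::finite) corner_chart set \<Rightarrow> ('a, 'n) two_tensor \<Rightarrow> bool" where
  "riemannian_metric A g \<longleftrightarrow>
     (\<forall>c\<in>A. \<forall>p\<in>cdom c. bilinear (g c p) \<and> (\<forall>v w. g c p v w = g c p w v) \<and>
        (\<forall>v. v \<noteq> 0 \<longrightarrow> 0 < g c p v v)) \<and>
     (\<forall>c\<in>A. \<forall>v w. smooth_on (cmap c ` cdom c) (in_chart c (\<lambda>p. g c p v w))) \<and>
     (\<forall>c\<in>A. \<forall>c'\<in>A. \<forall>p\<in>cdom c \<inter> cdom c'. \<forall>v w.
        g c p v w = g c' p (differential_in c (cdom c \<inter> cdom c') (cmap c') p v)
                           (differential_in c (cdom c \<inter> cdom c') (cmap c') p w))"


section \<open>Absolutely continuous curves, length, distance\<close>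

definition abs_continuous_on :: "real set \<Rightarrow> (real \<Rightarrow> 'b::real_normed_vector) \<Rightarrow> bool" where
  "abs_continuous_on T f \<longleftrightarrow>
     (\<forall>\<epsilon>>0. \<exists>\<delta>>0. \<forall>D. finite D \<longrightarrow>
        (\<forall>(s, t)\<in>D. s \<le> t \<and> {s..t} \<subseteq> T) \<longrightarrow>
        pairwise (\<lambda>(s, t) (s', t'). {s<..<t} \<inter> {s'<..<t'} = {}) D \<longrightarrow>
        (\<Sum>(s, t)\<in>D. t - s) < \<delta> \<longrightarrow>
        (\<Sum>(s, t)\<in>D. norm (f t - f s)) < \<epsilon>)"

text \<open>Curves on an interval \<open>T\<close> with values in the interior of \<open>X\<close>. On a non-compact interval this
  is the usual local notion: absolute continuity on compact subintervals.\<close>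

definition ac_curve ::
  "'a topology \<Rightarrow> ('a, 'n::finite) corner_chart set \<Rightarrow> real set \<Rightarrow> (real \<Rightarrow> 'a) \<Rightarrow> bool" where
  "ac_curve X A T \<gamma> \<longleftrightarrow>
     \<gamma> ` T \<subseteq> minterior X A \<and>
     continuous_map (top_of_set T) X \<gamma> \<and>
     (\<forall>c\<in>A. \<forall>s t. s \<le> t \<longrightarrow> {s..t} \<subseteq> T \<longrightarrow> \<gamma> ` {s..t} \<subseteq> cdom c \<longrightarrow>
        abs_continuous_on {s..t} (cmap c \<circ> \<gamma>))"

text \<open>The \<open>g\<close>-norm of the velocity, evaluated in some chart around the point; by the
  transformation law of \<open>g\<close> the value does not depend on the chart. An absolutely continuous
  curve has a velocity at almost every parameter, which is all the length depends on.\<close>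

definition speed ::
  "('a, 'n::finite) corner_chart set \<Rightarrow> ('a, 'n) two_tensor \<Rightarrow> real set \<Rightarrow> (real \<Rightarrow> 'a) \<Rightarrow> real \<Rightarrow> real" where
  "speed A g T \<gamma> t =
     (let c = (SOME c. c \<in> A \<and> \<gamma> t \<in> cdom c);
          v = vector_derivative (cmap c \<circ> \<gamma>) (at t within T)
      in sqrt (g c (\<gamma> t) v v))"

definition curve_length ::
  "('a, 'n::finite) corner_chart set \<Rightarrow> ('a, 'n) two_tensor \<Rightarrow> real set \<Rightarrow> (real \<Rightarrow> 'a) \<Rightarrow> ennreal" where
  "curve_length A g T \<gamma> = (\<integral>\<^sup>+ t\<in>T. ennreal (speed A g T \<gamma> t) \<partial>lborel)"

text \<open>The value is infinite for points in different components of the interior.\<close>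

definition riemannian_dist ::
  "'a topology \<Rightarrow> ('a, 'n::finite) corner_chart set \<Rightarrow> ('a, 'n) two_tensor \<Rightarrow> 'a \<Rightarrow> 'a \<Rightarrow> ennreal" where
  "riemannian_dist X A g p q =
     (INF \<gamma> \<in> {\<gamma>. ac_curve X A {0..1} \<gamma> \<and> \<gamma> 0 = p \<and> \<gamma> 1 = q}. curve_length A g {0..1} \<gamma>)"

definition accessible ::
  "'a topology \<Rightarrow> ('a, 'n::finite) corner_chart set \<Rightarrow> ('a, 'n) two_tensor \<Rightarrow> 'a \<Rightarrow> bool" where
  "accessible X A g p \<longleftrightarrow>
     p \<in> mboundary A \<and>
     (\<exists>P :: nat \<Rightarrow> 'a. range P \<subseteq> minterior X A \<and>
        (\<forall>\<epsilon>>0. \<exists>M. \<forall>m\<ge>M. \<forall>n\<ge>M. riemannian_dist X A g (P m) (P n) < ennreal \<epsilon>) \<and>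
        limitin X P p sequentially)"

definition finite_length_approachable ::
  "'a topology \<Rightarrow> ('a, 'n::finite) corner_chart set \<Rightarrow> ('a, 'n) two_tensor \<Rightarrow> 'a \<Rightarrow> bool" where
  "finite_length_approachable X A g p \<longleftrightarrow>
     p \<in> mboundary A \<and>
     (\<exists>\<gamma>. ac_curve X A {0..<1} \<gamma> \<and> limitin X \<gamma> p (at_left 1) \<and>
        curve_length A g {0..<1} \<gamma> < \<infinity>)"


section \<open>Product metrics and faces\<close>

text \<open>Meaningful on the interior of \<open>X\<close>, where all the \<open>\<rho> i\<close> are positive.\<close>

definition product_metric ::
  "nat \<Rightarrow> (nat \<Rightarrow> 'a \<Rightarrow> real) \<Rightarrow> (nat \<Rightarrow> real) \<Rightarrow> ('a, 'n::finite) two_tensor \<Rightarrow> ('a, 'n) two_tensor" where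
  "product_metric N \<rho> \<alpha> g\<^sub>0 =
     (\<lambda>c p v w. (\<Prod>i=1..N. \<rho> i p powr (- \<alpha> i)) * g\<^sub>0 c p v w)"

definition active_set :: "nat \<Rightarrow> (nat \<Rightarrow> 'a set) \<Rightarrow> 'a \<Rightarrow> nat set" where
  "active_set N H p = {i \<in> {1..N}. p \<in> H i}"

definition open_face :: "'a topology \<Rightarrow> nat \<Rightarrow> (nat \<Rightarrow> 'a set) \<Rightarrow> nat set \<Rightarrow> 'a set" where
  "open_face X N H I = {p \<in> topspace X. active_set N H p = I}"

end

theory Submission
  imports Defs
begin

text \<open>
  In a chart \<open>c\<close> around \<open>p\<close>, write \<open>r = (\<Sum>i\<in>I. \<rho> i)\<close> and \<open>a = (\<Sum>i\<in>I. \<alpha> i)\<close>.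
  Along the straight segment from \<open>p\<close> in a direction pointing into all the active faces every active
  \<open>\<rho> i\<close> grows at least linearly, so the speed at parameter \<open>s\<close> is at most a constant times
  \<open>s powr (- a / 2)\<close>; for \<open>a < 2\<close> this is integrable, and the segment has finite length and its
  points form a Cauchy sequence.
  For \<open>a \<ge> 2\<close>, near \<open>p\<close> the product metric dominates a constant times the coordinate metric divided
  by \<open>r\<^sup>2\<close>, and \<open>r\<close> is Lipschitz; hence the length of a curve near \<open>p\<close> bounds the oscillation
  of \<open>ln r\<close>, which tends to \<open>-\<infinity>\<close> at \<open>p\<close>. The same estimate bounds the coordinate displacement,
  so short curves starting near \<open>p\<close> cannot leave the chart, which turns the statement about curves
  ending at \<open>p\<close> into one about Cauchy sequences.

  These lower bounds need that an absolutely continuous curve is differentiable almost everywhere and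
  is controlled by the integral of its derivative.
\<close>

section \<open>Absolutely continuous functions\<close>

text \<open>Velocities exist only almost everywhere, and \<open>speed\<close> picks a chart
  separately at each parameter, so its measurability is not evident. Lower bounds on length
  therefore place below the speed the norm of the derivative of an auxiliary function, which is
  measurable, and integrate that. Differentiability almost everywhere rests on Vitali coverings: two
  different limiting slopes on a set of positive measure would force a fixed gain of the function
  over gaps of arbitrarily small total length.

  The threshold is 2 because the conformal factor enters the speed under a square root, so that near
  \<open>p\<close> the question is whether \<open>s powr (- a / 2)\<close> is integrable. At
  \<open>a = 2\<close> the integral diverges only logarithmically, which makes \<open>ln r\<close>
  the natural test function. Since \<open>r < 1\<close> near \<open>p\<close>, every larger exponent
  reduces to this critical one. The lower bound on the metric is taken in all directions at once, as
  nothing is known about the direction from which a curve approaches the corner.\<close>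

definition nonoverlapping :: "real set \<Rightarrow> (real \<times> real) set \<Rightarrow> bool" where
  "nonoverlapping T D \<longleftrightarrow> finite D \<and> (\<forall>(s, t)\<in>D. s \<le> t \<and> {s..t} \<subseteq> T) \<and>
     pairwise (\<lambda>(s, t) (s', t'). {s<..<t} \<inter> {s'<..<t'} = {}) D"

lemma abs_continuous_on_iff:
  "abs_continuous_on T f \<longleftrightarrow>
     (\<forall>\<epsilon>>0. \<exists>\<delta>>0. \<forall>D. nonoverlapping T D \<longrightarrow> (\<Sum>(s, t)\<in>D. t - s) < \<delta> \<longrightarrow>
        (\<Sum>(s, t)\<in>D. norm (f t - f s)) < \<epsilon>)"
  by (simp add: abs_continuous_on_def nonoverlapping_def imp_conjL)

lemma abs_continuous_onE:
  assumes "abs_continuous_on T f" "0 < \<epsilon>"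
  obtains \<delta> where "0 < \<delta>"
    "\<And>D. nonoverlapping T D \<Longrightarrow> (\<Sum>(s, t)\<in>D. t - s) < \<delta> \<Longrightarrow> (\<Sum>(s, t)\<in>D. norm (f t - f s)) < \<epsilon>"
  using assms unfolding abs_continuous_on_iff by meson

lemma nonoverlapping_mono: "nonoverlapping S D \<Longrightarrow> S \<subseteq> T \<Longrightarrow> nonoverlapping T D"
  unfolding nonoverlapping_def by fast

lemma nonoverlapping_endpoints:
  "nonoverlapping T D \<Longrightarrow> (s, t) \<in> D \<Longrightarrow> s \<in> T \<and> t \<in> T \<and> s \<le> t"
  unfolding nonoverlapping_def by fastforce

text \<open>The hypothesis compares increments of \<open>g\<close> with increments of
  \<open>f\<close>, not values of a Lipschitz map. It thus applies to coordinates, to multiples, to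
  \<open>r\<close> along a curve, and to \<open>ln\<close>, which is Lipschitz only on the range
  actually visited.\<close>

lemma abs_continuous_on_compose_lipschitz:
  assumes f: "abs_continuous_on T f"
    and L: "\<And>s t. s \<in> T \<Longrightarrow> t \<in> T \<Longrightarrow> norm (g t - g s) \<le> L * norm (f t - f s)"
  shows "abs_continuous_on T g"
  unfolding abs_continuous_on_iff
proof (intro allI impI)
  fix \<epsilon> :: real assume "0 < \<epsilon>"
  then have "0 < \<epsilon> / (\<bar>L\<bar> + 1)" by simp
  with f obtain \<delta> where \<delta>: "0 < \<delta>" "\<And>D. nonoverlapping T D \<Longrightarrow> (\<Sum>(s, t)\<in>D. t - s) < \<delta> \<Longrightarrow>
      (\<Sum>(s, t)\<in>D. norm (f t - f s)) < \<epsilon> / (\<bar>L\<bar> + 1)"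
    by (rule abs_continuous_onE) blast
  have "(\<Sum>(s, t)\<in>D. norm (g t - g s)) < \<epsilon>"
    if D: "nonoverlapping T D" "(\<Sum>(s, t)\<in>D. t - s) < \<delta>" for D
  proof -
    have "(\<Sum>(s, t)\<in>D. norm (g t - g s)) \<le> (\<Sum>(s, t)\<in>D. (\<bar>L\<bar> + 1) * norm (f t - f s))"
    proof (intro sum_mono, clarify)
      fix s t assume "(s, t) \<in> D"
      then have "norm (g t - g s) \<le> L * norm (f t - f s)"
        using L nonoverlapping_endpoints[OF D(1)] by blast
      also have "\<dots> \<le> (\<bar>L\<bar> + 1) * norm (f t - f s)"
        by (intro mult_right_mono) auto
      finally show "norm (g t - g s) \<le> (\<bar>L\<bar> + 1) * norm (f t - f s)" .
    qed
    also have "\<dots> = (\<bar>L\<bar> + 1) * (\<Sum>(s, t)\<in>D. norm (f t - f s))"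
      by (simp add: sum_distrib_left case_prod_unfold)
    also have "\<dots> < (\<bar>L\<bar> + 1) * (\<epsilon> / (\<bar>L\<bar> + 1))"
      by (intro mult_strict_left_mono \<delta>(2) D) auto
    finally show ?thesis by simp
  qed
  with \<delta>(1) show "\<exists>\<delta>>0. \<forall>D. nonoverlapping T D \<longrightarrow> (\<Sum>(s, t)\<in>D. t - s) < \<delta> \<longrightarrow>
        (\<Sum>(s, t)\<in>D. norm (g t - g s)) < \<epsilon>" by blast
qed

lemma lipschitz_imp_abs_continuous_on:
  assumes "\<And>s t. s \<in> T \<Longrightarrow> t \<in> T \<Longrightarrow> norm (g t - g s) \<le> L * \<bar>t - s\<bar>"
  shows "abs_continuous_on T g"
proof -
  have "abs_continuous_on T (\<lambda>t. t :: real)"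
    unfolding abs_continuous_on_iff
  proof (intro allI impI)
    fix \<epsilon> :: real assume "0 < \<epsilon>"
    moreover have "(\<Sum>(s, t)\<in>D. norm (t - s)) = (\<Sum>(s, t)\<in>D. t - s)" if "nonoverlapping T D" for D
      using nonoverlapping_endpoints[OF that] by (intro sum.cong) auto
    ultimately show "\<exists>\<delta>>0. \<forall>D. nonoverlapping T D \<longrightarrow> (\<Sum>(s, t)\<in>D. t - s) < \<delta> \<longrightarrow>
        (\<Sum>(s, t)\<in>D. norm (t - s)) < \<epsilon>" by (intro exI[of _ \<epsilon>]) simp
  qed
  then show ?thesis
    by (rule abs_continuous_on_compose_lipschitz) (use assms in auto)
qed

lemma abs_continuous_on_add:
  assumes f: "abs_continuous_on T f" and g: "abs_continuous_on T g"
  shows "abs_continuous_on T (\<lambda>t. f t + g t)"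
  unfolding abs_continuous_on_iff
proof (intro allI impI)
  fix \<epsilon> :: real assume "0 < \<epsilon>"
  then have e2: "0 < \<epsilon> / 2" by simp
  obtain d1 where d1: "0 < d1" "\<And>D. nonoverlapping T D \<Longrightarrow> (\<Sum>(s, t)\<in>D. t - s) < d1 \<Longrightarrow>
      (\<Sum>(s, t)\<in>D. norm (f t - f s)) < \<epsilon> / 2"
    using abs_continuous_onE[OF f e2] by blast
  obtain d2 where d2: "0 < d2" "\<And>D. nonoverlapping T D \<Longrightarrow> (\<Sum>(s, t)\<in>D. t - s) < d2 \<Longrightarrow>
      (\<Sum>(s, t)\<in>D. norm (g t - g s)) < \<epsilon> / 2"
    using abs_continuous_onE[OF g e2] by blast
  have "(\<Sum>(s, t)\<in>D. norm (f t + g t - (f s + g s))) < \<epsilon>"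
    if D: "nonoverlapping T D" "(\<Sum>(s, t)\<in>D. t - s) < min d1 d2" for D
  proof -
    have "(\<Sum>(s, t)\<in>D. norm (f t + g t - (f s + g s))) \<le>
          (\<Sum>(s, t)\<in>D. norm (f t - f s) + norm (g t - g s))"
      by (intro sum_mono) (auto, metis add_diff_add norm_triangle_ineq)
    also have "\<dots> = (\<Sum>(s, t)\<in>D. norm (f t - f s)) + (\<Sum>(s, t)\<in>D. norm (g t - g s))"
      by (simp add: case_prod_unfold sum.distrib)
    also have "\<dots> < \<epsilon>" using d1(2)[OF D(1)] d2(2)[OF D(1)] D(2) by simp
    finally show ?thesis .
  qed
  moreover have "0 < min d1 d2" using d1 d2 by simp
  ultimately show "\<exists>\<delta>>0. \<forall>D. nonoverlapping T D \<longrightarrow> (\<Sum>(s, t)\<in>D. t - s) < \<delta> \<longrightarrow>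
        (\<Sum>(s, t)\<in>D. norm (f t + g t - (f s + g s))) < \<epsilon>" by blast
qed

lemma abs_continuous_on_imp_continuous_on:
  assumes f: "abs_continuous_on {a..b} f"
  shows "continuous_on {a..b} f"
  unfolding continuous_on_iff
proof (intro ballI allI impI)
  fix x \<epsilon> :: real assume x: "x \<in> {a..b}" and e: "0 < \<epsilon>"
  obtain \<delta> where \<delta>: "0 < \<delta>" "\<And>D. nonoverlapping {a..b} D \<Longrightarrow> (\<Sum>(s, t)\<in>D. t - s) < \<delta> \<Longrightarrow>
      (\<Sum>(s, t)\<in>D. norm (f t - f s)) < \<epsilon>"
    using abs_continuous_onE[OF f e] by blast
  have "dist (f y) (f x) < \<epsilon>" if y: "y \<in> {a..b}" "dist y x < \<delta>" for y
    using \<delta>(2)[of "{(min x y, max x y)}"] x y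
    by (cases "x \<le> y") (auto simp: nonoverlapping_def dist_norm norm_minus_commute min_def max_def)
  with \<delta>(1) show "\<exists>d>0. \<forall>x'\<in>{a..b}. dist x' x < d \<longrightarrow> dist (f x') (f x) < \<epsilon>" by blast
qed

section \<open>Divisions of an interval and Vitali coverings\<close>

lemma division_of_real_intervalD:
  assumes "q division_of S" "K \<in> q"
  obtains u v :: real where "K = {u..v}" "u \<le> v"
proof -
  obtain u v where K: "K = cbox u v" using division_ofD(4)[OF assms] by blast
  moreover have "K \<noteq> {}" by (rule division_ofD(3)[OF assms])
  ultimately show thesis using that by auto
qed

text \<open>Divisions are sets of intervals, whereas absolute continuity speaks of pairs of
  endpoints; \<open>Inf\<close> and \<open>Sup\<close> translate between the two, and injectivity
  lets sums be reindexed.\<close>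

lemma nonoverlapping_division:
  assumes q: "q division_of S" and "p \<subseteq> q" "S \<subseteq> T"
  shows "nonoverlapping T ((\<lambda>K. (Inf K, Sup K)) ` p)" "inj_on (\<lambda>K. (Inf K, Sup K)) p"
proof -
  have K: "\<exists>u v. K = {u..v} \<and> u \<le> v" if "K \<in> p" for K
    using division_of_real_intervalD[OF q, of K] assms(2) that by (metis subsetD)
  show "inj_on (\<lambda>K. (Inf K, Sup K)) p"
  proof (rule inj_onI)
    fix K L assume "K \<in> p" "L \<in> p" and eq: "(Inf K, Sup K) = (Inf L, Sup L)"
    then obtain u v u' v' where "K = {u..v}" "u \<le> v" "L = {u'..v'}" "u' \<le> v'" using K by meson
    with eq show "K = L" by simp
  qed
  have "finite p" by (rule finite_subset[OF assms(2) division_ofD(1)[OF q]])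
  moreover have "{Inf K<..<Sup K} \<inter> {Inf L<..<Sup L} = {}"
    if KL: "K \<in> p" "L \<in> p" "K \<noteq> L" for K L
  proof -
    have "interior K \<inter> interior L = {}"
      using division_ofD(5)[OF q] KL assms(2) by blast
    moreover obtain u v u' v' where "K = {u..v}" "u \<le> v" "L = {u'..v'}" "u' \<le> v'"
      using K KL by meson
    ultimately show ?thesis by simp
  qed
  moreover have "{Inf K..Sup K} \<subseteq> T \<and> Inf K \<le> Sup K" if Kp: "K \<in> p" for K
  proof -
    have "K \<subseteq> T" using Kp assms division_ofD(2)[OF q, of K] by blast
    moreover obtain u v where "K = {u..v}" "u \<le> v" using K Kp by meson
    ultimately show ?thesis by simp
  qed
  ultimately show "nonoverlapping T ((\<lambda>K. (Inf K, Sup K)) ` p)"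
    unfolding nonoverlapping_def by (auto simp: pairwise_def )
qed

lemma sum_division_increments:
  fixes f :: "real \<Rightarrow> 'a::real_normed_vector"
  assumes "a \<le> b" and "q division_of {a..b}"
  shows "(\<Sum>K\<in>q. f (Sup K) - f (Inf K)) = f b - f a"
proof -
  \<comment> \<open>Tagging each interval by its left endpoint makes the division a tagged one, for
    which telescoping is known.\<close>
  define p where "p = (\<lambda>K. (Inf K, K)) ` q"
  have "Inf K \<in> K" if "K \<in> q" for K
    using division_of_real_intervalD[OF assms(2) that] by (metis atLeastAtMost_iff cInf_atLeastAtMost order_refl)
  note Inf_in = this
  have p: "p tagged_division_of {a..b}"
  proof (rule tagged_division_ofI)
    show "finite p" unfolding p_def using division_ofD(1)[OF assms(2)] by simp
    have "{K. \<exists>x. (x, K) \<in> p} = q" unfolding p_def by auto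
    then show "\<Union>{K. \<exists>x. (x, K) \<in> p} = {a..b}" using division_ofD(6)[OF assms(2)] by simp
    fix x K assume "(x, K) \<in> p"
    then have K: "K \<in> q" "x = Inf K" unfolding p_def by auto
    show "x \<in> K" "K \<subseteq> {a..b}" "\<exists>a b. K = cbox a b"
      using Inf_in K division_ofD(2,4)[OF assms(2) K(1)] by blast+
    fix x' K' assume "(x', K') \<in> p" "(x, K) \<noteq> (x', K')"
    then have "K' \<in> q" "K \<noteq> K'" unfolding p_def using K by auto
    then show "interior K \<inter> interior K' = {}" using division_ofD(5)[OF assms(2) K(1)] by blast
  qed
  from additive_tagged_division_1[OF assms(1) p, of f]
  show ?thesis unfolding p_def by (subst (asm) sum.reindex) (auto simp: inj_on_def)
qed

text \<open>An interval is the closed ball around its midpoint, so Vitali's theorem for balls gives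
  a countable disjoint subfamily covering almost all of \<open>S\<close>. Since everything lies in
  \<open>{a..b}\<close>, the measures of finite subunions are bounded, and a finite subfamily loses
  less than \<open>e\<close>.\<close>

lemma Vitali_covering_intervals:
  fixes S :: "real set" and K :: "(real \<times> real) set"
  assumes S: "S \<in> lmeasurable"
    and K: "\<And>u v. (u, v) \<in> K \<Longrightarrow> u < v \<and> {u..v} \<subseteq> {a..b}"
    and cover: "\<And>x d. x \<in> S \<Longrightarrow> 0 < d \<Longrightarrow> \<exists>u v. (u, v) \<in> K \<and> x \<in> {u..v} \<and> v - u < d"
    and "0 < e"
  obtains C where "finite C" "C \<subseteq> K" "pairwise (\<lambda>(u, v) (u', v'). {u..v} \<inter> {u'..v'} = {}) C"
    "measure lebesgue S - e < (\<Sum>(u, v)\<in>C. v - u)"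
proof -
  define c r :: "real \<times> real \<Rightarrow> real" where "c = (\<lambda>(u, v). (u + v) / 2)" and "r = (\<lambda>(u, v). (v - u) / 2)"
  have ball: "cball (c (u, v)) (r (u, v)) = {u..v}" for u v :: real
    by (auto simp: c_def r_def cball_eq_atLeastAtMost field_simps)
  have "\<exists>i. i \<in> K \<and> x \<in> cball (c i) (r i) \<and> r i < d" if x: "x \<in> S" "0 < d" for x d
  proof -
    obtain u v where "(u, v) \<in> K" "x \<in> {u..v}" "v - u < d" using cover[OF x] by blast
    then show ?thesis using K[of u v] unfolding ball[symmetric]
      by (intro exI[of _ "(u, v)"]) (auto simp: r_def)
  qed
  note covers = this
  have pos: "0 < r i" if "i \<in> K" for i using K that by (cases i) (auto simp: r_def)
  obtain C0 where C0: "countable C0" "C0 \<subseteq> K"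
     "pairwise (\<lambda>i j. disjnt (cball (c i) (r i)) (cball (c j) (r j))) C0"
     "negligible (S - (\<Union>i \<in> C0. cball (c i) (r i)))"
    by (rule Vitali_covering_theorem_cballs[of K r S c, OF pos covers])
  let ?B = "\<lambda>i. cball (c i) (r i)"
  have sub: "?B i \<subseteq> {a..b}" if "i \<in> C0" for i
  proof -
    obtain u v where i: "i = (u, v)" by (cases i)
    then show ?thesis using that C0(2) K[of u v] ball[of u v] by auto
  qed
  have "measure lebesgue (\<Union>D') \<le> measure lebesgue {a..b}" if "D' \<subseteq> ?B ` C0" "finite D'" for D'
    using that sub by (intro measure_mono_fmeasurable sets.finite_Union) (fastforce simp: fmeasurableD)+
  then obtain D' where D': "D' \<subseteq> ?B ` C0" "finite D'"
      "measure lebesgue (\<Union>(?B ` C0)) - e < measure lebesgue (\<Union>D')"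
    using C0(1) \<open>0 < e\<close>
    by - (rule measure_countable_Union_approachable[of "?B ` C0" e "measure lebesgue {a..b}"], auto)
  obtain C where C: "C \<subseteq> C0" "finite C" "D' = ?B ` C"
    using finite_subset_image[OF D'(2,1)] by blast
  have U: "(\<Union>(?B ` C0)) \<in> lmeasurable"
    by (rule fmeasurableI2[of "{a..b}"]) (use sub C0(1) in auto)
  have "measure lebesgue S \<le> measure lebesgue (\<Union>(?B ` C0) \<union> (S - \<Union>(?B ` C0)))"
    by (rule measure_mono_fmeasurable) (use S U in \<open>auto simp: fmeasurableD\<close>)
  also have "\<dots> = measure lebesgue (\<Union>(?B ` C0))"
    by (rule measure_negligible_symdiff[OF U]) (rule negligible_subset[OF C0(4)], blast)
  finally have 1: "measure lebesgue S - e < measure lebesgue (\<Union>(?B ` C))" using D'(3) unfolding C(3)[symmetric] by linarith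
  have disj: "disjnt (?B i) (?B j)" if "i \<in> C" "j \<in> C" "i \<noteq> j" for i j
    using C0(3) C(1) that unfolding pairwise_def by blast
  have "measure lebesgue (\<Union>(?B ` C)) = (\<Sum>i\<in>C. measure lebesgue (?B i))"
    by (rule measure_UNION'[OF C(2)]) (use disj in \<open>auto simp: pairwise_def\<close>)
  also have "\<dots> = (\<Sum>(u, v)\<in>C. v - u)"
  proof (rule sum.cong[OF refl], clarify)
    fix u v assume "(u, v) \<in> C"
    then have "u < v" using C(1) C0(2) K by blast
    then show "measure lebesgue (?B (u, v)) = v - u" unfolding ball by simp
  qed
  finally have 2: "measure lebesgue S - e < (\<Sum>(u, v)\<in>C. v - u)" using 1 by simp
  have 3: "pairwise (\<lambda>(u, v) (u', v'). {u..v} \<inter> {u'..v'} = {}) C"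
  proof (rule pairwiseI)
    fix i j assume "i \<in> C" "j \<in> C" "i \<noteq> j"
    from disj[OF this] show "(case i of (u, v) \<Rightarrow> \<lambda>(u', v'). {u..v} \<inter> {u'..v'} = {}) j"
      by (cases i; cases j) (simp only: ball disjnt_def case_prod_conv)
  qed
  have "C \<subseteq> K" using C(1) C0(2) by (rule subset_trans)
  from that[OF C(2) this 3 2] show ?thesis .
qed

lemma nonoverlapping_sum_lengths_le:
  assumes D: "nonoverlapping T D" and T: "T \<in> lmeasurable"
  shows "(\<Sum>(s, t)\<in>D. t - s) \<le> measure lebesgue T"
proof -
  have "finite D" using D unfolding nonoverlapping_def by blast
  let ?I = "\<lambda>(s, t). {s<..<t :: real}"
  have "(\<Sum>(s, t)\<in>D. t - s) = (\<Sum>i\<in>D. measure lebesgue (?I i))"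
    using nonoverlapping_endpoints[OF D] by (intro sum.cong) auto
  also have "\<dots> = measure lebesgue (\<Union>i\<in>D. ?I i)"
  proof (intro measure_UNION'[symmetric] \<open>finite D\<close> pairwiseI)
    fix i j assume "i \<in> D" "j \<in> D" "i \<noteq> j"
    moreover have "pairwise (\<lambda>(s, t) (s', t'). {s<..<t} \<inter> {s'<..<t'} = {}) D"
      using D unfolding nonoverlapping_def by blast
    ultimately show "disjnt (?I i) (?I j)"
      by (cases i; cases j) (fastforce simp only: disjnt_def case_prod_conv dest: pairwiseD)
  qed auto
  also have "\<dots> \<le> measure lebesgue T"
  proof (rule measure_mono_fmeasurable[OF _ _ T])
    show "(\<Union>i\<in>D. ?I i) \<in> sets lebesgue" using \<open>finite D\<close> by (intro sets.finite_UN) auto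
    have "{s<..<t} \<subseteq> T" if "(s, t) \<in> D" for s t
    proof -
      have "{s<..<t} \<subseteq> {s..t}" by auto
      also have "\<dots> \<subseteq> T" using D that unfolding nonoverlapping_def by blast
      finally show ?thesis .
    qed
    then show "(\<Union>i\<in>D. ?I i) \<subseteq> T" by blast
  qed
  finally show ?thesis .
qed

text \<open>Vitali intervals on which \<open>g\<close> decreases cover almost all of \<open>B\<close>, so \<open>g\<close> can only increase on
  the complementary gaps.\<close>

lemma increment_le_gaps:
  fixes g :: "real \<Rightarrow> real"
  assumes uv: "u \<le> v" and B: "B \<in> sets lebesgue"
    and desc: "\<And>x d. x \<in> B \<Longrightarrow> u < x \<Longrightarrow> x < v \<Longrightarrow> 0 < d \<Longrightarrow>
      \<exists>s t. u \<le> s \<and> s < t \<and> t \<le> v \<and> s \<le> x \<and> x \<le> t \<and> t - s < d \<and> g t \<le> g s"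
    and "0 < e"
  obtains D where "nonoverlapping {u..v} D"
    "(\<Sum>(s, t)\<in>D. t - s) < measure lebesgue ({u..v} - B) + e"
    "g v - g u \<le> (\<Sum>(s, t)\<in>D. norm (g t - g s))"
proof -
  define S where "S = B \<inter> {u<..<v}"
  define K where "K = {(s, t). u \<le> s \<and> s < t \<and> t \<le> v \<and> g t \<le> g s}"
  have S: "S \<in> lmeasurable" unfolding S_def
    by (rule fmeasurableI2[of "{u..v}"]) (use B in auto)
  have "\<exists>s t. (s, t) \<in> K \<and> x \<in> {s..t} \<and> t - s < d" if "x \<in> S" "0 < d" for x d
    using desc[of x d] that unfolding S_def K_def by auto
  note cover = this
  obtain C where C: "finite C" "C \<subseteq> K"
    "pairwise (\<lambda>(s, t) (s', t'). {s..t} \<inter> {s'..t'} = {}) C"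
    "measure lebesgue S - e < (\<Sum>(s, t)\<in>C. t - s)"
    by (rule Vitali_covering_intervals[OF S _ cover \<open>0 < e\<close>, of u v]) (auto simp: K_def)
  have CK: "u \<le> s \<and> s < t \<and> t \<le> v \<and> g t \<le> g s" if "(s, t) \<in> C" for s t
    using C(2) that unfolding K_def by auto
  define p where "p = (\<lambda>(s, t). {s..t}) ` C"
  have inj: "inj_on (\<lambda>(s, t). {s..t}) C"
  proof (rule inj_onI, clarify)
    fix s t s' t' assume "(s, t) \<in> C" "(s', t') \<in> C" "{s..t} = {s'..t'}"
    then show "s = s' \<and> t = t'" using CK[of s t] CK[of s' t'] by (simp add: Icc_eq_Icc)
  qed
  have "p division_of \<Union>p"
  proof (rule division_ofI)
    show "finite p" unfolding p_def using C(1) by simp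
    fix L assume "L \<in> p"
    then obtain s t where L: "L = {s..t}" "(s, t) \<in> C" unfolding p_def by auto
    show "L \<noteq> {}" "\<exists>a b. L = cbox a b" using L CK[of s t] by auto
    show "L \<subseteq> \<Union>p" using \<open>L \<in> p\<close> by blast
    fix L' assume "L' \<in> p" "L \<noteq> L'"
    then obtain s' t' where L': "L' = {s'..t'}" "(s', t') \<in> C" unfolding p_def by auto
    have "(s, t) \<noteq> (s', t')" using L L' \<open>L \<noteq> L'\<close> by auto
    from pairwiseD[OF C(3) L(2) L'(2) this] have "L \<inter> L' = {}" using L L' by simp
    then show "interior L \<inter> interior L' = {}"
      using interior_subset by blast
  qed auto
  moreover have "\<Union>p \<subseteq> cbox u v" unfolding p_def using CK by fastforce
  ultimately obtain q where q: "p \<subseteq> q" "q division_of cbox u v"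
    by (rule partial_division_extend_interval)
  then have q': "q division_of {u..v}" by simp
  \<comment> \<open>The Vitali intervals are completed to a division of \<open>{u..v}\<close>; the
    added pieces are the gaps.\<close>
  define D where "D = (\<lambda>L. (Inf L, Sup L)) ` (q - p)"
  have D: "nonoverlapping {u..v} D" and injD: "inj_on (\<lambda>L. (Inf L, Sup L)) (q - p)"
    unfolding D_def using nonoverlapping_division[OF q', of "q - p" "{u..v}"] by auto
  \<comment> \<open>Used twice: with \<open>h = g\<close> it bounds the increment by the gaps, and
    with the identity it computes the total length of the gaps.\<close>
  have split: "(\<Sum>L\<in>q. h (Sup L) - h (Inf L)) =
      (\<Sum>(s, t)\<in>C. h t - h s) + (\<Sum>(s, t)\<in>D. h t - h s)" for h :: "real \<Rightarrow> real"
  proof -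
    have "(\<Sum>L\<in>q. h (Sup L) - h (Inf L)) =
        (\<Sum>L\<in>q - p. h (Sup L) - h (Inf L)) + (\<Sum>L\<in>p. h (Sup L) - h (Inf L))"
      using q q' by (intro sum.subset_diff) auto
    moreover have "(\<Sum>(s, t)\<in>D. h t - h s) = (\<Sum>L\<in>q - p. h (Sup L) - h (Inf L))"
      unfolding D_def by (subst sum.reindex[OF injD]) simp
    moreover have "(\<Sum>L\<in>p. h (Sup L) - h (Inf L)) = (\<Sum>(s, t)\<in>C. h t - h s)"
      unfolding p_def using CK by (subst sum.reindex[OF inj]) (force intro!: sum.cong)
    ultimately show ?thesis by simp
  qed
  have tot: "(\<Sum>(s, t)\<in>C. h t - h s) + (\<Sum>(s, t)\<in>D. h t - h s) = h v - h u" for h :: "real \<Rightarrow> real"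
    using sum_division_increments[OF uv q', of h] split[of h] by simp
  have "(\<Sum>(s, t)\<in>C. g t - g s) \<le> 0"
    using CK by (intro sum_nonpos) auto
  moreover have "(\<Sum>(s, t)\<in>D. g t - g s) \<le> (\<Sum>(s, t)\<in>D. norm (g t - g s))"
    by (intro sum_mono) auto
  ultimately have "g v - g u \<le> (\<Sum>(s, t)\<in>D. norm (g t - g s))"
    using tot[of g] by simp
  moreover have "(\<Sum>(s, t)\<in>D. t - s) < measure lebesgue ({u..v} - B) + e"
  proof -
    have "measure lebesgue ({u..v} - B) = measure lebesgue ({u..v} - S)"
    proof (rule measure_negligible_symdiff)
      show "{u..v} - S \<in> lmeasurable"
        by (rule fmeasurableI2[of "{u..v}"]) (use S in \<open>auto simp: fmeasurableD\<close>)
      show "negligible ({u..v} - S - ({u..v} - B) \<union> ({u..v} - B - ({u..v} - S)))"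
        by (rule negligible_subset[of "{u, v}"]) (auto simp: S_def)
    qed
    also have "\<dots> = (v - u) - measure lebesgue S"
      using S uv by (subst measurable_measure_Diff) (auto simp: S_def fmeasurableD)
    finally show ?thesis using C(4) tot[of "\<lambda>x. x"] by simp
  qed
  ultimately show ?thesis using that D by blast
qed

text \<open>Merges the gap families found in separate disjoint intervals into one family, so that
  absolute continuity is invoked once, with a single \<delta> for all of them.\<close>

lemma nonoverlapping_UN:
  assumes C: "finite C" and D: "\<And>i. i \<in> C \<Longrightarrow> nonoverlapping (S i) (D i)"
    and S: "\<And>i. i \<in> C \<Longrightarrow> S i \<subseteq> T" "\<And>i j. i \<in> C \<Longrightarrow> j \<in> C \<Longrightarrow> i \<noteq> j \<Longrightarrow> S i \<inter> S j = {}"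
  shows "nonoverlapping T (\<Union>i\<in>C. D i)"
    "sum (h :: _ \<Rightarrow> real) (\<Union>i\<in>C. D i) = (\<Sum>i\<in>C. sum h (D i))"
proof -
  have Di: "finite (D i)" "\<And>s t. (s, t) \<in> D i \<Longrightarrow> s \<le> t \<and> {s..t} \<subseteq> S i"
    "\<And>s t s' t'. (s, t) \<in> D i \<Longrightarrow> (s', t') \<in> D i \<Longrightarrow> (s, t) \<noteq> (s', t') \<Longrightarrow> {s<..<t} \<inter> {s'<..<t'} = {}"
    if "i \<in> C" for i
    using D[OF that] unfolding nonoverlapping_def pairwise_def by blast+
  have disj: "D i \<inter> D j = {}" if ij: "i \<in> C" "j \<in> C" "i \<noteq> j" for i j
  proof -
    have False if x: "(s, t) \<in> D i" "(s, t) \<in> D j" for s t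
    proof -
      have "s \<in> {s..t}" using Di(2)[OF ij(1) x(1)] by simp
      then have "s \<in> S i \<inter> S j" using Di(2)[OF ij(1) x(1)] Di(2)[OF ij(2) x(2)] by blast
      then show False using S(2)[OF ij] by blast
    qed
    then show ?thesis by auto
  qed
  show "sum h (\<Union>i\<in>C. D i) = (\<Sum>i\<in>C. sum h (D i))"
    using C Di(1) disj by (intro sum.UNION_disjoint) auto
  have "{s<..<t} \<inter> {s'<..<t'} = {}"
    if i: "i \<in> C" "(s, t) \<in> D i" and j: "j \<in> C" "(s', t') \<in> D j" and ne: "(s, t) \<noteq> (s', t')"
    for s t s' t' i j
  proof (cases "i = j")
    case True
    then show ?thesis using Di(3)[OF i(1,2)] j ne by blast
  next
    case False
    have "{s<..<t} \<subseteq> {s..t}" "{s'<..<t'} \<subseteq> {s'..t'}" by auto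
    then have "{s<..<t} \<subseteq> S i" "{s'<..<t'} \<subseteq> S j" using Di(2)[OF i] Di(2)[OF j] by blast+
    then show ?thesis using S(2)[OF i(1) j(1) False] by blast
  qed
  note disj_intervals = this
  show "nonoverlapping T (\<Union>i\<in>C. D i)"
    unfolding nonoverlapping_def
  proof (intro conjI pairwiseI)
    show "finite (\<Union>i\<in>C. D i)" using C Di(1) by blast
    show "\<forall>(s, t)\<in>\<Union>i\<in>C. D i. s \<le> t \<and> {s..t} \<subseteq> T" using Di(2) S(1) by fast
    fix x y assume "x \<in> (\<Union>i\<in>C. D i)" "y \<in> (\<Union>i\<in>C. D i)" "x \<noteq> y"
    then obtain i j s t s' t' where "i \<in> C" "x = (s, t)" "(s, t) \<in> D i" "j \<in> C" "y = (s', t')" "(s', t') \<in> D j"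
      by (metis UN_E surj_pair)
    with disj_intervals[of i s t j s' t'] \<open>x \<noteq> y\<close>
    show "(case x of (s, t) \<Rightarrow> \<lambda>(s', t'). {s<..<t} \<inter> {s'<..<t'} = {}) y" by simp
  qed
qed

section \<open>Steep points and differentiability almost everywhere\<close>

definition steep :: "(real \<Rightarrow> real) \<Rightarrow> real \<Rightarrow> real set" where
  "steep f r = {x. \<forall>d>0. \<exists>u v. u < x \<and> x < v \<and> v - u < d \<and> r * (v - u) < f v - f u}"

text \<open>This is why \<open>steep\<close> uses intervals having \<open>x\<close> strictly inside,
  not one-sided quotients: for each bound on the length, the admissible open intervals have an open
  union, so the set is a G-delta for every \<open>f\<close> whatsoever.\<close>

lemma steep_borel: "steep f r \<in> sets borel"
proof -
  define W where "W n = (\<Union>(u, v)\<in>{(u, v). v - u < 1 / real (Suc n) \<and> r * (v - u) < f v - f u}. {u<..<v})"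
    for n :: nat
  have "open (W n)" for n unfolding W_def by auto
  then have "(\<Inter>n. W n) \<in> sets borel" by auto
  moreover have "steep f r = (\<Inter>n. W n)"
  proof
    show "steep f r \<subseteq> (\<Inter>n. W n)"
    proof (rule subsetI, rule INT_I)
      fix x n assume "x \<in> steep f r"
      then have "\<exists>u v. u < x \<and> x < v \<and> v - u < 1 / real (Suc n) \<and> r * (v - u) < f v - f u"
        unfolding steep_def by simp
      then show "x \<in> W n" unfolding W_def by auto
    qed
    show "(\<Inter>n. W n) \<subseteq> steep f r"
    proof
      fix x assume x: "x \<in> (\<Inter>n. W n)"
      have "\<exists>u v. u < x \<and> x < v \<and> v - u < d \<and> r * (v - u) < f v - f u" if "0 < d" for d
      proof -
        obtain n where n: "1 / real (Suc n) < d" using nat_approx_posE[OF \<open>0 < d\<close>] by metis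
        have "x \<in> W n" using x by blast
        then obtain u v where "v - u < 1 / real (Suc n)" "r * (v - u) < f v - f u" "x \<in> {u<..<v}"
          unfolding W_def by blast
        then show ?thesis using n by (intro exI[of _ u] exI[of _ v]) auto
      qed
      then show "x \<in> steep f r" unfolding steep_def by blast
    qed
  qed
  ultimately show ?thesis by simp
qed

lemma Icc_subset_Ioo_iff: "s \<le> t \<Longrightarrow> {s..t} \<subseteq> {u<..<v} \<longleftrightarrow> u < s \<and> t < v" for s t u v :: real
  by (auto simp: subset_iff)

lemma steepD:
  assumes "x \<in> steep f r" "open U" "x \<in> U" "0 < d"
  obtains u v where "u < x" "x < v" "v - u < d" "r * (v - u) < f v - f u" "{u..v} \<subseteq> U"
proof -
  obtain e where e: "0 < e" "ball x e \<subseteq> U" using assms openE by blast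
  then have "0 < min d e" using assms by simp
  then obtain u v where uv: "u < x" "x < v" "v - u < min d e" "r * (v - u) < f v - f u"
    using assms(1) unfolding steep_def by blast
  moreover have "{u..v} \<subseteq> ball x e" using uv by (auto simp: dist_real_def)
  ultimately show thesis using that[of u v] e by auto
qed

text \<open>Cover the exceptional set by intervals on which \<open>g\<close> climbs with slope at least \<open>c\<close>. Inside each of
  them the climb must take place on gaps of small total length, which absolute continuity forbids.\<close>

lemma negligible_steep_descending:
  fixes g :: "real \<Rightarrow> real"
  assumes g: "abs_continuous_on {a..b} g" and c: "0 < c"
  shows "negligible ({a<..<b} \<inter> steep g c \<inter> steep (\<lambda>x. - g x) 0)" (is "negligible ?B")
proof (rule ccontr)
  define B where "B = ?B"
  have "B \<in> sets borel" unfolding B_def using steep_borel by (intro sets.Int) auto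
  then have Bm: "B \<in> lmeasurable"
    by (intro fmeasurableI2[of "{a..b}" lebesgue B]) (auto simp: B_def)
  assume "\<not> negligible ?B"
  then have m: "0 < measure lebesgue B"
    using Bm unfolding B_def by (metis measure_nonneg negligible_iff_measure order_le_less)
  \<comment> \<open>The climb over the chosen intervals exceeds
    \<open>c * (measure lebesgue B - \<epsilon>)\<close> and is at most the variation over the gaps,
    which is below \<epsilon>. This value of \<epsilon> makes the two incompatible.\<close>
  define \<epsilon> where "\<epsilon> = c * measure lebesgue B / (2 * (1 + c))"
  have \<epsilon>: "0 < \<epsilon>" "\<epsilon> * (1 + c) = c * measure lebesgue B / 2"
    using m c unfolding \<epsilon>_def by (auto simp: field_simps)
  obtain \<delta> where \<delta>: "0 < \<delta>" "\<And>D. nonoverlapping {a..b} D \<Longrightarrow> (\<Sum>(s, t)\<in>D. t - s) < \<delta> \<Longrightarrow>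
      (\<Sum>(s, t)\<in>D. norm (g t - g s)) < \<epsilon>"
    using abs_continuous_onE[OF g \<epsilon>(1)] by blast
  have "0 < \<delta> / 2" using \<delta>(1) by simp
  \<comment> \<open>The climbing intervals will be taken inside \<open>U\<close>, so their parts
    outside \<open>B\<close> have total measure below \<open>\<delta> / 2\<close>.\<close>
  then obtain U where U: "open U" "B \<subseteq> U" "U - B \<in> lmeasurable" "emeasure lebesgue (U - B) < ennreal (\<delta> / 2)"
    using sets_lebesgue_outer_open[of B "\<delta> / 2"] Bm by (metis fmeasurableD)
  then have U': "measure lebesgue (U - B) < \<delta> / 2"
    by (simp add: emeasure_eq_measure2 ennreal_less_iff)
  define K where "K = {(u, v). u < v \<and> {u..v} \<subseteq> U \<inter> {a<..<b} \<and> c * (v - u) < g v - g u}"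
  have "\<exists>u v. (u, v) \<in> K \<and> x \<in> {u..v} \<and> v - u < d" if x: "x \<in> B" and d: "0 < d" for x d
  proof -
    have "x \<in> steep g c" "open (U \<inter> {a<..<b})" "x \<in> U \<inter> {a<..<b}" using x U B_def by auto
    then obtain u v where "u < x" "x < v" "v - u < d" "c * (v - u) < g v - g u" "{u..v} \<subseteq> U \<inter> {a<..<b}"
      using d by (rule steepD)
    then show ?thesis unfolding K_def by (intro exI[of _ u] exI[of _ v]) auto
  qed
  note cover = this
  have Ksub: "u < v \<and> {u..v} \<subseteq> {a..b}" if "(u, v) \<in> K" for u v
    using that unfolding K_def by (auto simp: Icc_subset_Ioo_iff)
  obtain C where C: "finite C" "C \<subseteq> K" "pairwise (\<lambda>(u, v) (u', v'). {u..v} \<inter> {u'..v'} = {}) C"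
    "measure lebesgue B - \<epsilon> < (\<Sum>(u, v)\<in>C. v - u)"
    by (rule Vitali_covering_intervals[OF Bm Ksub cover \<epsilon>(1)])
  \<comment> \<open>Each interval of \<open>C\<close> may add an error \<open>e\<close> to the
    length of its gaps; all the errors together stay below the other \<open>\<delta> / 2\<close>.
    The \<open>+ 1\<close> covers an empty \<open>C\<close>.\<close>
  define e where "e = \<delta> / (2 * (real (card C) + 1))"
  have e: "0 < e" "real (card C) * e < \<delta> / 2" using \<delta>(1) unfolding e_def by (auto simp: field_simps)
  have "\<exists>D. nonoverlapping {fst i..snd i} D \<and>
      (\<Sum>(s, t)\<in>D. t - s) < measure lebesgue ({fst i..snd i} - B) + e \<and>
      g (snd i) - g (fst i) \<le> (\<Sum>(s, t)\<in>D. norm (g t - g s))" if "i \<in> C" for i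
  proof -
    obtain u v where i: "i = (u, v)" by (cases i)
    then have uv: "(u, v) \<in> K" using that C(2) by blast
    then have "u \<le> v" unfolding K_def by auto
    moreover have "B \<in> sets lebesgue" using Bm by (rule fmeasurableD)
    moreover have "\<exists>s t. u \<le> s \<and> s < t \<and> t \<le> v \<and> s \<le> x \<and> x \<le> t \<and> t - s < d \<and> g t \<le> g s"
      if "x \<in> B" "u < x" "x < v" "0 < d" for x d
    proof -
      have "x \<in> steep (\<lambda>x. - g x) 0" "x \<in> {u<..<v}" using that B_def by auto
      then obtain s t where "s < x" "x < t" "t - s < d" "0 * (t - s) < - g t - - g s" "{s..t} \<subseteq> {u<..<v}"
        using steepD[OF _ open_greaterThanLessThan _ \<open>0 < d\<close>] by metis
      then show ?thesis by (intro exI[of _ s] exI[of _ t]) (auto simp: Icc_subset_Ioo_iff)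
    qed
    ultimately obtain D where "nonoverlapping {u..v} D"
        "(\<Sum>(s, t)\<in>D. t - s) < measure lebesgue ({u..v} - B) + e"
        "g v - g u \<le> (\<Sum>(s, t)\<in>D. norm (g t - g s))"
      using e(1) by (rule increment_le_gaps)
    then show ?thesis unfolding i by auto
  qed
  then obtain D where D: "\<And>i. i \<in> C \<Longrightarrow> nonoverlapping {fst i..snd i} (D i)"
      "\<And>i. i \<in> C \<Longrightarrow> (\<Sum>(s, t)\<in>D i. t - s) < measure lebesgue ({fst i..snd i} - B) + e"
      "\<And>i. i \<in> C \<Longrightarrow> g (snd i) - g (fst i) \<le> (\<Sum>(s, t)\<in>D i. norm (g t - g s))"
    by metis
  have Csub: "fst i < snd i" "{fst i..snd i} \<subseteq> U" "{fst i..snd i} \<subseteq> {a..b}"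
      "c * (snd i - fst i) < g (snd i) - g (fst i)" if "i \<in> C" for i
  proof -
    have i: "(fst i, snd i) \<in> K" using that C(2) by auto
    show "{fst i..snd i} \<subseteq> {a..b}" using Ksub[OF i] by (rule conjunct2)
    show "fst i < snd i" "{fst i..snd i} \<subseteq> U" "c * (snd i - fst i) < g (snd i) - g (fst i)"
      using i unfolding K_def by blast+
  qed
  have Cdisj: "{fst i..snd i} \<inter> {fst j..snd j} = {}" if "i \<in> C" "j \<in> C" "i \<noteq> j" for i j
    using pairwiseD[OF C(3) that] by (simp add: case_prod_unfold)
  note UN = nonoverlapping_UN[OF C(1) D(1) Csub(3) Cdisj]
  have "(\<Sum>i\<in>C. measure lebesgue ({fst i..snd i} - B)) =
        measure lebesgue (\<Union>i\<in>C. {fst i..snd i} - B)"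
  proof (rule measure_UNION'[symmetric, OF C(1)])
    show "{fst i..snd i} - B \<in> lmeasurable" for i
      by (rule fmeasurableI2[of "{fst i..snd i}"]) (use Bm in \<open>auto simp: fmeasurableD\<close>)
    show "pairwise (\<lambda>i j. disjnt ({fst i..snd i} - B) ({fst j..snd j} - B)) C"
      unfolding pairwise_def disjnt_def using Cdisj by blast
  qed
  also have "\<dots> \<le> measure lebesgue (U - B)"
  proof (rule measure_mono_fmeasurable[OF _ _ U(3)])
    show "(\<Union>i\<in>C. {fst i..snd i} - B) \<subseteq> U - B" using Csub(2) by blast
    show "(\<Union>i\<in>C. {fst i..snd i} - B) \<in> sets lebesgue"
      using C(1) Bm by (intro sets.finite_UN sets.Diff) (auto simp: fmeasurableD)
  qed
  finally have sum_meas: "(\<Sum>i\<in>C. measure lebesgue ({fst i..snd i} - B)) \<le> measure lebesgue (U - B)" .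
  have "(\<Sum>(s, t)\<in>(\<Union>i\<in>C. D i). t - s) = (\<Sum>i\<in>C. \<Sum>(s, t)\<in>D i. t - s)"
    by (rule UN(2))
  also have "\<dots> \<le> (\<Sum>i\<in>C. measure lebesgue ({fst i..snd i} - B) + e)"
    using D(2) by (intro sum_mono) (simp add: less_imp_le)
  also have "\<dots> \<le> measure lebesgue (U - B) + real (card C) * e"
    using sum_meas by (simp add: sum.distrib)
  also have "\<dots> < \<delta>" using U' e(2) by simp
  finally have "(\<Sum>(s, t)\<in>(\<Union>i\<in>C. D i). norm (g t - g s)) < \<epsilon>"
    by (intro \<delta>(2) UN(1))
  moreover have "(\<Sum>(s, t)\<in>(\<Union>i\<in>C. D i). norm (g t - g s)) = (\<Sum>i\<in>C. \<Sum>(s, t)\<in>D i. norm (g t - g s))"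
    by (rule UN(2))
  moreover have "(\<Sum>i\<in>C. c * (snd i - fst i)) \<le> (\<Sum>i\<in>C. \<Sum>(s, t)\<in>D i. norm (g t - g s))"
    using Csub(4) D(3) by (intro sum_mono) (meson less_imp_le order_trans)
  moreover have "(\<Sum>i\<in>C. c * (snd i - fst i)) = c * (\<Sum>(u, v)\<in>C. v - u)"
    by (simp add: sum_distrib_left case_prod_unfold)
  ultimately have "c * (\<Sum>(u, v)\<in>C. v - u) < \<epsilon>" by simp
  moreover have "c * (measure lebesgue B - \<epsilon>) \<le> c * (\<Sum>(u, v)\<in>C. v - u)"
    using C(4) c by (intro mult_left_mono) auto
  ultimately have "c * measure lebesgue B < \<epsilon> * (1 + c)" by (simp add: algebra_simps)
  then show False unfolding \<epsilon>(2) using c m by simp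
qed

lemma steep_antimono: "q \<le> r \<Longrightarrow> steep f r \<subseteq> steep f q"
proof
  fix x assume qr: "q \<le> r" and x: "x \<in> steep f r"
  have "\<exists>u v. u < x \<and> x < v \<and> v - u < d \<and> q * (v - u) < f v - f u" if d: "0 < d" for d
  proof -
    obtain u v where uv: "u < x" "x < v" "v - u < d" "r * (v - u) < f v - f u"
      using x d unfolding steep_def by blast
    moreover have "q * (v - u) \<le> r * (v - u)" using qr uv by (intro mult_right_mono) auto
    ultimately have "q * (v - u) < f v - f u" by linarith
    with uv show ?thesis by blast
  qed
  then show "x \<in> steep f q" unfolding steep_def by blast
qed

text \<open>If the set had positive measure near some point, disjoint intervals of slope above
  \<open>n\<close> would cover more than half of it and force a variation above 1 for large
  \<open>n\<close>. Working inside a ball of radius \<open>\<delta> / 3\<close> keeps the total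
  length below \<delta>, where the variation is less than 1.\<close>

lemma negligible_infinitely_steep:
  fixes f :: "real \<Rightarrow> real"
  assumes f: "abs_continuous_on {a..b} f"
  shows "negligible ({a<..<b} \<inter> (\<Inter>n. steep f (real n)))" (is "negligible ?S")
proof -
  obtain \<delta> where \<delta>: "0 < \<delta>" "\<And>D. nonoverlapping {a..b} D \<Longrightarrow> (\<Sum>(s, t)\<in>D. t - s) < \<delta> \<Longrightarrow>
      (\<Sum>(s, t)\<in>D. norm (f t - f s)) < 1"
    using abs_continuous_onE[OF f zero_less_one] by blast
  have "negligible (?S \<inter> ball x (\<delta> / 3))" for x
  proof (rule ccontr)
    define J where "J = {a<..<b} \<inter> ball x (\<delta> / 3)"
    define B where "B = ?S \<inter> ball x (\<delta> / 3)"
    have "B \<in> sets borel" unfolding B_def using steep_borel by (intro sets.Int sets.countable_INT) auto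
    then have Bm: "B \<in> lmeasurable"
      by (intro fmeasurableI2[of "ball x (\<delta> / 3)" lebesgue B]) (auto simp: B_def)
    assume "\<not> negligible (?S \<inter> ball x (\<delta> / 3))"
    then have m: "0 < measure lebesgue B"
      using Bm unfolding B_def by (metis measure_nonneg negligible_iff_measure order_le_less)
    obtain n where n: "2 / measure lebesgue B < real n" using reals_Archimedean2 by blast
    define K where "K = {(u, v). u < v \<and> {u..v} \<subseteq> J \<and> real n * (v - u) < f v - f u}"
    have "\<exists>u v. (u, v) \<in> K \<and> y \<in> {u..v} \<and> v - u < d" if y: "y \<in> B" and d: "0 < d" for y d
    proof -
      have "y \<in> steep f (real n)" "open J" "y \<in> J" using y unfolding B_def J_def by auto
      then obtain u v where "u < y" "y < v" "v - u < d" "real n * (v - u) < f v - f u" "{u..v} \<subseteq> J"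
        using d by (rule steepD)
      then show ?thesis unfolding K_def by (intro exI[of _ u] exI[of _ v]) auto
    qed
    note cover = this
    have J: "J \<subseteq> {a..b}" "J \<subseteq> ball x (\<delta> / 3)" unfolding J_def by auto
    have Ksub: "u < v \<and> {u..v} \<subseteq> {a..b}" if "(u, v) \<in> K" for u v
      using that J(1) unfolding K_def by blast
    have half: "0 < measure lebesgue B / 2" using m by simp
    obtain C where C: "finite C" "C \<subseteq> K" "pairwise (\<lambda>(u, v) (u', v'). {u..v} \<inter> {u'..v'} = {}) C"
      "measure lebesgue B - measure lebesgue B / 2 < (\<Sum>(u, v)\<in>C. v - u)"
      by (rule Vitali_covering_intervals[OF Bm Ksub cover half])
    have CK: "u < v \<and> {u..v} \<subseteq> {a..b} \<and> {u..v} \<subseteq> ball x (\<delta> / 3) \<and> real n * (v - u) < f v - f u"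
      if "(u, v) \<in> C" for u v
      using that C(2) J unfolding K_def by blast
    have D: "nonoverlapping ({a..b} \<inter> ball x (\<delta> / 3)) C"
      unfolding nonoverlapping_def
    proof (intro conjI pairwiseI C(1))
      show "\<forall>(s, t)\<in>C. s \<le> t \<and> {s..t} \<subseteq> {a..b} \<inter> ball x (\<delta> / 3)"
        using CK by (fast intro: less_imp_le)
      fix i j assume ij: "i \<in> C" "j \<in> C" "i \<noteq> j"
      obtain u v u' v' where e: "i = (u, v)" "j = (u', v')" by (cases i; cases j)
      have "{u..v} \<inter> {u'..v'} = {}" using pairwiseD[OF C(3) ij] unfolding e by simp
      moreover have "{u<..<v} \<subseteq> {u..v}" "{u'<..<v'} \<subseteq> {u'..v'}" by auto
      ultimately have "{u<..<v} \<inter> {u'<..<v'} = {}" by blast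
      then show "(case i of (s, t) \<Rightarrow> \<lambda>(s', t'). {s<..<t} \<inter> {s'<..<t'} = {}) j"
        unfolding e by simp
    qed
    have "(\<Sum>(u, v)\<in>C. v - u) \<le> measure lebesgue (ball x (\<delta> / 3))"
      by (rule nonoverlapping_sum_lengths_le[OF nonoverlapping_mono[OF D Int_lower2]]) simp
    also have "\<dots> < \<delta>" using \<delta>(1) by (simp add: ball_eq_greaterThanLessThan)
    finally have "(\<Sum>(s, t)\<in>C. norm (f t - f s)) < 1" by (rule \<delta>(2)[OF nonoverlapping_mono[OF D Int_lower1]])
    moreover have "(\<Sum>(u, v)\<in>C. real n * (v - u)) \<le> (\<Sum>(s, t)\<in>C. norm (f t - f s))"
      using CK by (intro sum_mono) fastforce
    moreover have "(\<Sum>(u, v)\<in>C. real n * (v - u)) = real n * (\<Sum>(u, v)\<in>C. v - u)"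
      by (simp add: sum_distrib_left case_prod_unfold)
    moreover have "real n * (measure lebesgue B / 2) \<le> real n * (\<Sum>(u, v)\<in>C. v - u)"
      using C(4) by (intro mult_left_mono) auto
    moreover have "1 < real n * (measure lebesgue B / 2)"
      using n m by (simp add: field_simps)
    ultimately show False by linarith
  qed
  note neg = this
  show ?thesis
  proof (rule iffD2[OF locally_negligible_alt], rule ballI)
    fix x assume x: "x \<in> ?S"
    have "openin (top_of_set ?S) (?S \<inter> ball x (\<delta> / 3))"
      by (rule openin_open_Int) (rule open_ball)
    moreover have "x \<in> ball x (\<delta> / 3)" using \<delta>(1) by simp
    with x have "x \<in> ?S \<inter> ball x (\<delta> / 3)" by (rule IntI)
    ultimately show "\<exists>U. openin (top_of_set ?S) U \<and> x \<in> U \<and> negligible U"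
      using neg[of x] by blast
  qed
qed

text \<open>\<open>steep\<close> only sees intervals with \<open>x\<close> strictly inside.
  Continuity carries the slope bound over to intervals with \<open>x\<close> as an endpoint, which
  are the ones that occur in difference quotients.\<close>

lemma not_steepD:
  fixes f :: "real \<Rightarrow> real"
  assumes cont: "isCont f x" and x: "x \<notin> steep f q"
  obtains d where "0 < d" "\<And>u v. u \<le> x \<Longrightarrow> x \<le> v \<Longrightarrow> v - u < d \<Longrightarrow> f v - f u \<le> q * (v - u)"
proof -
  obtain d where d: "0 < d" "\<nexists>u v. u < x \<and> x < v \<and> v - u < d \<and> q * (v - u) < f v - f u"
    using x unfolding steep_def by blast
  then have d: "0 < d" "\<And>u v. u < x \<Longrightarrow> x < v \<Longrightarrow> v - u < d \<Longrightarrow> f v - f u \<le> q * (v - u)"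
    by (auto simp: not_less[symmetric])
  have fl: "(f \<longlongrightarrow> f x) (at_left x)" and fr: "(f \<longlongrightarrow> f x) (at_right x)"
    using cont unfolding isCont_def filterlim_at_split by auto
  have "f v - f u \<le> q * (v - u)" if uv: "u \<le> x" "x \<le> v" "v - u < d" for u v
  proof -
    consider "u < x" "x < v" | "u = x" "x < v" | "u < x" "v = x" | "u = x" "v = x"
      using uv by linarith
    then show ?thesis
    proof cases
      case 1
      then show ?thesis using d(2) uv by blast
    next
      case 2
      have "((\<lambda>y. f v - f y - q * (v - y)) \<longlongrightarrow> f v - f x - q * (v - x)) (at_left x)"
        by (intro tendsto_intros fl)
      moreover have "\<forall>\<^sub>F y in at_left x. f v - f y - q * (v - y) \<le> 0"
        unfolding eventually_at_left_field using 2 uv d(2)[of _ v]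
        by (intro exI[of _ "v - d"]) auto
      ultimately have "f v - f x - q * (v - x) \<le> 0"
        by (rule tendsto_upperbound) simp
      then show ?thesis using 2 by simp
    next
      case 3
      have "((\<lambda>y. f y - f u - q * (y - u)) \<longlongrightarrow> f x - f u - q * (x - u)) (at_right x)"
        by (intro tendsto_intros fr)
      moreover have "\<forall>\<^sub>F y in at_right x. f y - f u - q * (y - u) \<le> 0"
        unfolding eventually_at_right_field using 3 uv d(2)[of u]
        by (intro exI[of _ "u + d"]) auto
      ultimately have "f x - f u - q * (x - u) \<le> 0"
        by (rule tendsto_upperbound) simp
      then show ?thesis using 3 by simp
    qed simp
  qed
  with d(1) show thesis by (rule that)
qed

text \<open>The derivative is the supremum of all \<open>q\<close> with
  \<open>x \<in> steep f q\<close>. \<open>top\<close> bounds this set above and \<open>bot\<close>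
  makes it nonempty; \<open>gap\<close> forces the slopes of short intervals to stay above any
  number smaller than the supremum, so upper and lower limiting slopes agree.\<close>

lemma differentiable_if_not_steep:
  fixes f :: "real \<Rightarrow> real"
  assumes cont: "isCont f x"
    and top: "x \<notin> steep f n" and bot: "x \<notin> steep (\<lambda>x. - f x) m"
    and gap: "\<And>p q. p < q \<Longrightarrow> x \<in> steep f q \<Longrightarrow> x \<notin> steep (\<lambda>x. - f x) (- p)"
  shows "f differentiable (at x)"
proof -
  define Q where "Q = {q. x \<in> steep f q}"
  define L where "L = Sup Q"
  have cont': "isCont (\<lambda>x. - f x) x" using cont by simp
  have above: "bdd_above Q"
    using top steep_antimono unfolding Q_def bdd_above_def by (metis (full_types) linear mem_Collect_eq subsetD)
  \<comment> \<open>By \<open>bot\<close>, short intervals around \<open>x\<close> have slope at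
    least \<open>- m\<close>, hence strictly above \<open>- m - 1\<close>.\<close>
  have "- m - 1 \<in> Q"
  proof (rule ccontr)
    assume "- m - 1 \<notin> Q"
    then obtain d where d: "0 < d" "\<And>u v. u \<le> x \<Longrightarrow> x \<le> v \<Longrightarrow> v - u < d \<Longrightarrow> f v - f u \<le> (- m - 1) * (v - u)"
      using not_steepD[OF cont, of "- m - 1"] unfolding Q_def by blast
    obtain d' where d': "0 < d'" "\<And>u v. u \<le> x \<Longrightarrow> x \<le> v \<Longrightarrow> v - u < d' \<Longrightarrow> - f v - - f u \<le> m * (v - u)"
      using not_steepD[OF cont' bot] by blast
    define h where "h = min d d' / 2"
    have h: "0 < h" "h < d" "h < d'" using d d' unfolding h_def by auto
    from d(2)[of x "x + h"] d'(2)[of x "x + h"] h show False by (simp add: algebra_simps)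
  qed
  then have ne: "Q \<noteq> {}" by blast
  have "(f has_real_derivative L) (at x)"
    unfolding has_field_derivative_def has_derivative_at_alt
  proof (intro conjI allI impI)
    show "bounded_linear ((*) L)" by (rule bounded_linear_mult_right)
    fix e :: real assume e: "0 < e"
    have "L + e \<notin> Q" using cSup_upper[OF _ above, of "L + e"] e unfolding L_def by auto
    then obtain d where d: "0 < d" "\<And>u v. u \<le> x \<Longrightarrow> x \<le> v \<Longrightarrow> v - u < d \<Longrightarrow> f v - f u \<le> (L + e) * (v - u)"
      using not_steepD[OF cont, of "L + e"] unfolding Q_def by blast
    obtain q where q: "q \<in> Q" "L - e < q"
      using less_cSup_iff[OF ne above, of "L - e"] e unfolding L_def by auto
    then have "x \<notin> steep (\<lambda>x. - f x) (- (L - e))" using gap unfolding Q_def by blast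
    then obtain d' where d': "0 < d'"
      "\<And>u v. u \<le> x \<Longrightarrow> x \<le> v \<Longrightarrow> v - u < d' \<Longrightarrow> - f v - - f u \<le> - (L - e) * (v - u)"
      using not_steepD[OF cont'] by blast
    have "norm (f y - f x - L * (y - x)) \<le> e * norm (y - x)" if y: "norm (y - x) < min d d'" for y
    proof (cases "x \<le> y")
      case True
      then show ?thesis using d(2)[of x y] d'(2)[of x y] y by (auto simp: algebra_simps abs_if)
    next
      case False
      then show ?thesis using d(2)[of y x] d'(2)[of y x] y by (auto simp: algebra_simps abs_if)
    qed
    moreover have "0 < min d d'" using d d' by simp
    ultimately show "\<exists>d>0. \<forall>y. norm (y - x) < d \<longrightarrow> norm (f y - f x - L * (y - x)) \<le> e * norm (y - x)"
      by blast
  qed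
  then show ?thesis by (auto simp: real_differentiable_def)
qed

text \<open>At a point without derivative either slopes are unbounded in one direction or rationals
  \<open>p < q\<close> separate the lower from the upper limiting slope. This writes the exceptional
  set as a countable union of null sets.\<close>

lemma abs_continuous_on_real_ae_differentiable:
  fixes f :: "real \<Rightarrow> real"
  assumes f: "abs_continuous_on {a..b} f"
  shows "negligible {x \<in> {a<..<b}. \<not> f differentiable (at x)}"
proof -
  have f': "abs_continuous_on {a..b} (\<lambda>x. - f x)"
    by (rule abs_continuous_on_compose_lipschitz[OF f, of _ 1]) (simp add: norm_minus_commute)
  define G where "G p q = {a<..<b} \<inter> steep f q \<inter> steep (\<lambda>x. - f x) (- p)" for p q
  have "negligible (G p q)" if "p < q" for p q
  proof -
    \<comment> \<open>Subtracting a line of slope \<open>p\<close> turns slopes below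
      \<open>p\<close> into descents and slopes above \<open>q\<close> into slopes above
      \<open>q - p\<close>.\<close>
    define g where "g = (\<lambda>t. f t + - p * t)"
    have "abs_continuous_on {a..b} g" unfolding g_def
      by (intro abs_continuous_on_add f lipschitz_imp_abs_continuous_on[of _ _ "\<bar>p\<bar>"])
        (simp flip: abs_mult add: algebra_simps)
    then have "negligible ({a<..<b} \<inter> steep g (q - p) \<inter> steep (\<lambda>x. - g x) 0)"
      using that by (intro negligible_steep_descending) auto
    moreover have "steep g (q - p) = steep f q" "steep (\<lambda>x. - g x) 0 = steep (\<lambda>x. - f x) (- p)"
      unfolding steep_def g_def by (simp_all add: algebra_simps)
    ultimately show ?thesis unfolding G_def by simp
  qed
  then have "negligible (\<Union>(p, q)\<in>{(p, q). p \<in> \<rat> \<and> q \<in> \<rat> \<and> p < q}. G p q)"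
    by (intro negligible_countable_Union countable_image countable_subset[OF _ countable_SIGMA[OF countable_rat countable_rat]])
      auto
  then have N: "negligible ((\<Union>(p, q)\<in>{(p, q). p \<in> \<rat> \<and> q \<in> \<rat> \<and> p < q}. G p q) \<union>
      ({a<..<b} \<inter> (\<Inter>n. steep f (real n))) \<union> ({a<..<b} \<inter> (\<Inter>n. steep (\<lambda>x. - f x) (real n))))"
    (is "negligible ?N")
    using negligible_infinitely_steep[OF f] negligible_infinitely_steep[OF f'] by (intro negligible_Un)
  show ?thesis
  proof (rule negligible_subset[OF N], rule subsetI, rule ccontr)
    fix x assume "x \<in> {x \<in> {a<..<b}. \<not> f differentiable (at x)}" and xN: "x \<notin> ?N"
    then have x: "x \<in> {a<..<b}" "\<not> f differentiable (at x)" by auto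
    have "continuous_on {a<..<b} f"
      using abs_continuous_on_imp_continuous_on[OF f] by (rule continuous_on_subset) auto
    then have "isCont f x" using x by (simp add: continuous_on_eq_continuous_at)
    moreover obtain n m where "x \<notin> steep f (real n)" "x \<notin> steep (\<lambda>x. - f x) (real m)"
      using xN x by blast
    moreover have "x \<notin> steep (\<lambda>x. - f x) (- p)" if pq: "p < q" "x \<in> steep f q" for p q
    proof
      assume xp: "x \<in> steep (\<lambda>x. - f x) (- p)"
      \<comment> \<open>Only rational pairs are available in the countable union, so a rational pair
        is squeezed between the given real slopes.\<close>
      obtain p' where p': "p' \<in> \<rat>" "p < p'" "p' < q" using Rats_dense_in_real[OF pq(1)] by blast
      obtain q' where q': "q' \<in> \<rat>" "p' < q'" "q' < q" using Rats_dense_in_real[OF p'(3)] by blast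
      have "x \<in> steep f q'" using steep_antimono[of q' q f] q' pq by auto
      moreover have "x \<in> steep (\<lambda>x. - f x) (- p')"
        using steep_antimono[of "- p'" "- p" "\<lambda>x. - f x"] p' xp by auto
      ultimately have "x \<in> G p' q'" using x unfolding G_def by blast
      then show False using xN p' q' by blast
    qed
    ultimately have "f differentiable (at x)" by (rule differentiable_if_not_steep)
    with x show False by blast
  qed
qed

lemma abs_continuous_on_ae_differentiable:
  fixes f :: "real \<Rightarrow> 'b::euclidean_space"
  assumes f: "abs_continuous_on {a..b} f"
  shows "negligible {x \<in> {a<..<b}. \<not> f differentiable (at x)}"
proof -
  have "abs_continuous_on {a..b} (\<lambda>x. f x \<bullet> i)" if "i \<in> Basis" for i
    by (rule abs_continuous_on_compose_lipschitz[OF f, of _ 1])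
      (metis Basis_le_norm inner_diff_left mult_1 real_norm_def that)
  note neg = abs_continuous_on_real_ae_differentiable[OF this]
  have "negligible (\<Union>i\<in>Basis. {x \<in> {a<..<b}. \<not> (\<lambda>x. f x \<bullet> i) differentiable (at x)})"
    by (intro negligible_Union finite_imageI finite_Basis) (use neg in blast)
  then show ?thesis
    by (rule negligible_subset) (auto simp: differentiable_componentwise_within[of f])
qed

section \<open>The fundamental theorem of calculus for absolutely continuous functions\<close>

lemma has_vector_derivative_straddle:
  assumes "(f has_vector_derivative f') (at x)" "0 < e"
  obtains d where "0 < d" "\<And>u v. u \<le> x \<Longrightarrow> x \<le> v \<Longrightarrow> {u..v} \<subseteq> ball x d \<Longrightarrow>
    norm (f v - f u - (v - u) *\<^sub>R f') \<le> e * (v - u)"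
proof -
  obtain d where d: "0 < d" "\<And>y. norm (y - x) < d \<Longrightarrow> norm (f y - f x - (y - x) *\<^sub>R f') \<le> e * norm (y - x)"
    using assms unfolding has_vector_derivative_def has_derivative_at_alt by blast
  have "norm (f v - f u - (v - u) *\<^sub>R f') \<le> e * (v - u)"
    if uv: "u \<le> x" "x \<le> v" "{u..v} \<subseteq> ball x d" for u v
  proof -
    have "u \<in> {u..v}" "v \<in> {u..v}" using uv by auto
    then have "u \<in> ball x d" "v \<in> ball x d" using uv(3) by blast+
    then have "norm (f v - f x - (v - x) *\<^sub>R f') \<le> e * (v - x)"
      "norm (f u - f x - (u - x) *\<^sub>R f') \<le> e * (x - u)"
      using d(2)[of v] d(2)[of u] uv by (auto simp: dist_real_def abs_minus_commute)
    moreover have "f v - f u - (v - u) *\<^sub>R f' = (f v - f x - (v - x) *\<^sub>R f') - (f u - f x - (u - x) *\<^sub>R f')"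
      by (simp add: algebra_simps)
    then have "norm (f v - f u - (v - u) *\<^sub>R f') \<le>
        norm (f v - f x - (v - x) *\<^sub>R f') + norm (f u - f x - (u - x) *\<^sub>R f')"
      by (metis norm_triangle_ineq4)
    ultimately have "norm (f v - f u - (v - u) *\<^sub>R f') \<le> e * (v - x) + e * (x - u)" by linarith
    then show ?thesis by (simp add: algebra_simps)
  qed
  with d(1) show thesis by (rule that)
qed

text \<open>Forgets the tags, so that part of a Riemann sum can be estimated by absolute continuity.
  The same \<open>D\<close> serves every \<open>f\<close>.\<close>

lemma nonoverlapping_tagged_division:
  fixes p :: "(real \<times> real set) set"
  assumes p: "p tagged_division_of {a..b}" and sub: "\<And>x K. (x, K) \<in> p' \<Longrightarrow> K \<subseteq> T"
    and p': "p' \<subseteq> p"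
  obtains D where "nonoverlapping T D"
    "\<And>f :: real \<Rightarrow> 'b::real_normed_vector.
       (\<Sum>(x, K)\<in>p'. norm (f (Sup K) - f (Inf K))) = (\<Sum>(s, t)\<in>D. norm (f t - f s))"
proof -
  \<comment> \<open>Degenerate intervals contribute nothing to the sum. Once they are removed,
    disjointness of interiors forces distinct members to have distinct endpoints.\<close>
  define p'' where "p'' = {(x, K) \<in> p'. Inf K < Sup K}"
  have fin: "finite p'" "finite p''"
    using p p' finite_subset[of p' p] finite_subset[of p'' p'] by (auto simp: p''_def)
  have K: "\<exists>u v. K = {u..v} \<and> u \<le> v" if "(x, K) \<in> p" for x K
    using tagged_division_ofD(2,4)[OF p that] by fastforce
  have disj: "{Inf K<..<Sup K} \<inter> {Inf L<..<Sup L} = {}"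
    if KL: "(x, K) \<in> p" "(y, L) \<in> p" "(x, K) \<noteq> (y, L)" for x K y L
  proof -
    have "interior K \<inter> interior L = {}" using tagged_division_ofD(5)[OF p] KL by blast
    moreover obtain u v u' v' where "K = {u..v}" "u \<le> v" "L = {u'..v'}" "u' \<le> v'"
      using K[OF KL(1)] K[OF KL(2)] by blast
    ultimately show ?thesis by simp
  qed
  define D where "D = (\<lambda>(x, K). (Inf K, Sup K)) ` p''"
  have inj: "inj_on (\<lambda>(x, K). (Inf K, Sup K)) p''"
  proof (rule inj_onI, clarify, rule ccontr)
    fix x K y L assume in_p: "(x, K) \<in> p''" "(y, L) \<in> p''" and eq: "Inf K = Inf L" "Sup K = Sup L"
      and "\<not> (x = y \<and> K = L)"
    then have "{Inf K<..<Sup K} \<inter> {Inf K<..<Sup K} = {}"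
      using disj[of x K y L] p' unfolding p''_def by auto
    then show False using in_p unfolding p''_def by auto
  qed
  have "nonoverlapping T D"
    unfolding nonoverlapping_def
  proof (intro conjI pairwiseI)
    show "finite D" unfolding D_def using fin by simp
    have "Inf K \<le> Sup K \<and> {Inf K..Sup K} \<subseteq> T" if xK: "(x, K) \<in> p''" for x K
    proof -
      have "(x, K) \<in> p" "K \<subseteq> T" using xK p' sub unfolding p''_def by auto
      moreover from this(1) obtain u v where "K = {u..v}" "u \<le> v" using K by blast
      ultimately show ?thesis by simp
    qed
    then show "\<forall>(s, t)\<in>D. s \<le> t \<and> {s..t} \<subseteq> T" unfolding D_def by auto
    fix i j assume "i \<in> D" "j \<in> D" "i \<noteq> j"
    then obtain x K y L where xK: "(x, K) \<in> p''" "i = (Inf K, Sup K)" and yL: "(y, L) \<in> p''" "j = (Inf L, Sup L)"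
      unfolding D_def by auto
    with \<open>i \<noteq> j\<close> have "(x, K) \<noteq> (y, L)" by auto
    then have "{Inf K<..<Sup K} \<inter> {Inf L<..<Sup L} = {}"
      using disj xK(1) yL(1) p' unfolding p''_def by blast
    then show "(case i of (s, t) \<Rightarrow> \<lambda>(s', t'). {s<..<t} \<inter> {s'<..<t'} = {}) j"
      unfolding xK yL by simp
  qed
  moreover have "(\<Sum>(x, K)\<in>p'. norm (f (Sup K) - f (Inf K))) = (\<Sum>(s, t)\<in>D. norm (f t - f s))"
    for f :: "real \<Rightarrow> 'b"
  proof -
    have "(\<Sum>(s, t)\<in>D. norm (f t - f s)) = (\<Sum>(x, K)\<in>p''. norm (f (Sup K) - f (Inf K)))"
      unfolding D_def by (subst sum.reindex[OF inj]) (simp add: case_prod_unfold)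
    also have "\<dots> = (\<Sum>(x, K)\<in>p'. norm (f (Sup K) - f (Inf K)))"
    proof (rule sum.mono_neutral_left[OF fin(1)])
      show "p'' \<subseteq> p'" unfolding p''_def by auto
      have "Inf K = Sup K" if xK: "(x, K) \<in> p' - p''" for x K
      proof -
        obtain u v where "K = {u..v}" "u \<le> v" using K xK p' by blast
        then show ?thesis using xK unfolding p''_def by auto
      qed
      then show "\<forall>i\<in>p' - p''. (case i of (x, K) \<Rightarrow> norm (f (Sup K) - f (Inf K))) = 0" by auto
    qed
    finally show ?thesis by simp
  qed
  ultimately show thesis by (rule that)
qed

text \<open>The gauge keeps intervals tagged in the exceptional null set inside an open set of small measure,
  where absolute continuity makes the increments negligible.\<close>

lemma fundamental_theorem_of_calculus_abs_continuous:
  fixes f :: "real \<Rightarrow> 'b::euclidean_space"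
  assumes ab: "a \<le> b" and f: "abs_continuous_on {a..b} f" and N: "negligible N"
    and deriv: "\<And>x. x \<in> {a<..<b} - N \<Longrightarrow> (f has_vector_derivative f' x) (at x)"
  shows "(f' has_integral (f b - f a)) {a..b}"
proof -
  \<comment> \<open>The endpoints join the exceptional set because derivatives are given only in the
    open interval.\<close>
  define M where "M = N \<union> {a, b}"
  have M: "negligible M" unfolding M_def using N by (simp add: negligible_Un)
  \<comment> \<open>With value 0 on \<open>M\<close>, the Riemann terms with exceptional tags vanish
    and only the increments of \<open>f\<close> remain to be estimated there.\<close>
  define g where "g x = (if x \<in> M then 0 else f' x)" for x
  have g: "(f has_vector_derivative g x) (at x)" if "x \<in> {a..b} - M" for x
    using deriv[of x] that unfolding g_def M_def by auto
  have "(g has_integral (f b - f a)) {a..b}"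
    unfolding has_integral_factor_content_real
  \<comment> \<open>For \<open>a = b\<close> the permitted error \<open>e * (b - a)\<close> is 0 and
    cannot serve as a tolerance.\<close>
  proof (cases "a = b")
    case True
    show "\<forall>e>0. \<exists>\<gamma>. gauge \<gamma> \<and> (\<forall>p. p tagged_division_of {a..b} \<and> \<gamma> fine p \<longrightarrow>
          norm ((\<Sum>(x, K)\<in>p. measure lborel K *\<^sub>R g x) - (f b - f a)) \<le> e * measure lborel {a..b})"
      using has_integral_refl(2)[of g a] True unfolding has_integral_factor_content_real[symmetric] by simp
  next
    case False
    show "\<forall>e>0. \<exists>\<gamma>. gauge \<gamma> \<and> (\<forall>p. p tagged_division_of {a..b} \<and> \<gamma> fine p \<longrightarrow>
          norm ((\<Sum>(x, K)\<in>p. measure lborel K *\<^sub>R g x) - (f b - f a)) \<le> e * measure lborel {a..b})"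
    proof (intro allI impI)
      fix e :: real assume "0 < e"
      then have e: "0 < e / 2" "0 < e / 2 * (b - a)" using ab False by auto
      obtain \<delta> where \<delta>: "0 < \<delta>" "\<And>D. nonoverlapping {a..b} D \<Longrightarrow> (\<Sum>(s, t)\<in>D. t - s) < \<delta> \<Longrightarrow>
          (\<Sum>(s, t)\<in>D. norm (f t - f s)) < e / 2 * (b - a)"
        using abs_continuous_onE[OF f e(2)] by blast
      obtain U where U: "open U" "M \<subseteq> U" "U - M \<in> lmeasurable" "emeasure lebesgue (U - M) < ennreal \<delta>"
        using sets_lebesgue_outer_open[of M \<delta>] M \<delta>(1) negligible_imp_sets by blast
      have "U = (U - M) \<union> M" using U(2) by blast
      then have Um: "U \<in> lmeasurable" using U(3) M by (metis fmeasurable.Un negligible_imp_measurable)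
      have "measure lebesgue U = measure lebesgue (U - M)"
        by (rule measure_negligible_symdiff[OF U(3)]) (rule negligible_subset[OF M], blast)
      also have "\<dots> < \<delta>" using U(3,4) \<delta>(1) by (simp add: emeasure_eq_measure2 ennreal_less_iff)
      finally have U': "measure lebesgue U < \<delta>" .
      have "\<exists>d>0. \<forall>u v. u \<le> x \<longrightarrow> x \<le> v \<longrightarrow> {u..v} \<subseteq> ball x d \<longrightarrow>
          norm (f v - f u - (v - u) *\<^sub>R g x) \<le> e / 2 * (v - u)" if "x \<in> {a..b} - M" for x
        using has_vector_derivative_straddle[OF g[OF that] e(1)] by metis
      then obtain d where d: "\<And>x. x \<in> {a..b} - M \<Longrightarrow> 0 < d x"
          "\<And>x u v. x \<in> {a..b} - M \<Longrightarrow> u \<le> x \<Longrightarrow> x \<le> v \<Longrightarrow> {u..v} \<subseteq> ball x (d x) \<Longrightarrow>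
          norm (f v - f u - (v - u) *\<^sub>R g x) \<le> e / 2 * (v - u)"
        by metis
      define \<gamma> where "\<gamma> x = (if x \<in> M then U else if x \<in> {a..b} then ball x (d x) else UNIV)" for x
      have gauge: "gauge \<gamma>" unfolding gauge_def \<gamma>_def using U(1,2) d(1) by auto
      have fine_sum: "norm ((\<Sum>(x, K)\<in>p. measure lborel K *\<^sub>R g x) - (f b - f a)) \<le> e * measure lborel {a..b}"
        if p: "p tagged_division_of {a..b}" and fine: "\<gamma> fine p" for p
      proof -
        have fin: "finite p" using p by (rule tagged_division_of_finite)
        have pK: "\<exists>u v. K = {u..v} \<and> u \<le> x \<and> x \<le> v \<and> x \<in> {a..b} \<and> K \<subseteq> \<gamma> x" if "(x, K) \<in> p" for x K
          using tagged_division_ofD(2,3,4)[OF p that] fine that unfolding fine_def by fastforce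
        define p1 where "p1 = {(x, K) \<in> p. x \<in> M}"
        have p1: "p1 \<subseteq> p" unfolding p1_def by auto
        have p1K: "K \<subseteq> U \<inter> {a..b}" if "(x, K) \<in> p1" for x K
          using that pK[of x K] tagged_division_ofD(3)[OF p, of x K] unfolding p1_def \<gamma>_def by auto
        obtain D where D: "nonoverlapping (U \<inter> {a..b}) D"
          "\<And>f :: real \<Rightarrow> 'b. (\<Sum>(x, K)\<in>p1. norm (f (Sup K) - f (Inf K))) = (\<Sum>(s, t)\<in>D. norm (f t - f s))"
          by (rule nonoverlapping_tagged_division[OF p _ p1, of "U \<inter> {a..b}", where 'b = 'b])
            (use p1K in blast)+
        have "(\<Sum>(s, t)\<in>D. t - s) < \<delta>"
          using nonoverlapping_sum_lengths_le[OF nonoverlapping_mono[OF D(1) Int_lower1] Um] U' by simp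
        then have bad: "(\<Sum>(x, K)\<in>p1. norm (f (Sup K) - f (Inf K))) < e / 2 * (b - a)"
          unfolding D(2) by (intro \<delta>(2) nonoverlapping_mono[OF D(1) Int_lower2])
        have "f b - f a = (\<Sum>(x, K)\<in>p. f (Sup K) - f (Inf K))"
          using additive_tagged_division_1[OF ab p, of f] by simp
        then have "norm ((\<Sum>(x, K)\<in>p. measure lborel K *\<^sub>R g x) - (f b - f a)) =
            norm (\<Sum>(x, K)\<in>p. measure lborel K *\<^sub>R g x - (f (Sup K) - f (Inf K)))"
          by (simp add: sum_subtractf case_prod_unfold)
        also have "\<dots> \<le> (\<Sum>(x, K)\<in>p. norm (measure lborel K *\<^sub>R g x - (f (Sup K) - f (Inf K))))"
          by (rule order_trans[OF norm_sum]) (simp add: case_prod_unfold)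
        also have "\<dots> \<le> (\<Sum>(x, K)\<in>p. e / 2 * measure lborel K + (if x \<in> M then norm (f (Sup K) - f (Inf K)) else 0))"
        proof (intro sum_mono, clarify)
          fix x K assume xK: "(x, K) \<in> p"
          then obtain u v where K: "K = {u..v}" "u \<le> x" "x \<le> v" "x \<in> {a..b}" "K \<subseteq> \<gamma> x" using pK by blast
          show "norm (measure lborel K *\<^sub>R g x - (f (Sup K) - f (Inf K))) \<le>
              e / 2 * measure lborel K + (if x \<in> M then norm (f (Sup K) - f (Inf K)) else 0)"
          proof (cases "x \<in> M")
            case True
            then show ?thesis using e(1) by (simp add: g_def norm_minus_commute)
          next
            case False
            then have "norm (f v - f u - (v - u) *\<^sub>R g x) \<le> e / 2 * (v - u)"
              using K by (intro d(2)) (auto simp: \<gamma>_def)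
            then show ?thesis using K False by (simp add: norm_minus_commute)
          qed
        qed
        also have "\<dots> = e / 2 * (b - a) + (\<Sum>(x, K)\<in>p1. norm (f (Sup K) - f (Inf K)))"
        proof -
          have "(\<Sum>(x, K)\<in>p. e / 2 * measure lborel K) = e / 2 * (b - a)"
          proof -
            have "(\<Sum>(x, K)\<in>p. measure lborel K) = b - a"
              using additive_content_tagged_division[of p a b] p ab by simp
            moreover have "(\<Sum>(x, K)\<in>p. e / 2 * measure lborel K) = e / 2 * (\<Sum>(x, K)\<in>p. measure lborel K)"
              by (simp only: sum_distrib_left case_prod_unfold)
            ultimately show ?thesis by simp
          qed
          moreover have "(\<Sum>(x, K)\<in>p. if x \<in> M then norm (f (Sup K) - f (Inf K)) else 0) =
              (\<Sum>(x, K)\<in>p1. norm (f (Sup K) - f (Inf K)))"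
            unfolding p1_def using fin
            by (simp add: sum.If_cases case_prod_unfold sum.inter_filter)
          ultimately show ?thesis by (simp add: sum.distrib case_prod_unfold)
        qed
        also have "\<dots> \<le> e * measure lborel {a..b}" using bad ab by (simp add: field_simps)
        finally show ?thesis .
      qed
      show "\<exists>\<gamma>. gauge \<gamma> \<and> (\<forall>p. p tagged_division_of {a..b} \<and> \<gamma> fine p \<longrightarrow>
          norm ((\<Sum>(x, K)\<in>p. measure lborel K *\<^sub>R g x) - (f b - f a)) \<le> e * measure lborel {a..b})"
        using gauge fine_sum by (intro exI[of _ \<gamma>] conjI allI impI) (assumption, elim conjE, assumption)
    qed
  qed
  then show ?thesis
    by (rule has_integral_spike[OF M, rotated]) (simp add: g_def)
qed

text \<open>\<open>h\<close> may be any function, measurable or not: its integral dominates that of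
  the norm of the derivative, which is measurable and lies below \<open>h\<close> almost everywhere.
  When the integral of \<open>h\<close> is finite, the derivative is absolutely integrable, and its
  gauge integral, the increment of \<open>f\<close>, is a Lebesgue integral whose norm can be
  bounded.\<close>

lemma abs_continuous_on_norm_diff_le_nn_integral:
  fixes f :: "real \<Rightarrow> 'b::euclidean_space"
  assumes ab: "a \<le> b" and f: "abs_continuous_on {a..b} f" and N: "negligible N"
    and bound: "\<And>x v. x \<in> {a<..<b} - N \<Longrightarrow> (f has_vector_derivative v) (at x) \<Longrightarrow> ennreal (norm v) \<le> h x"
  shows "ennreal (norm (f b - f a)) \<le> (\<integral>\<^sup>+x\<in>{a..b}. h x \<partial>lborel)"
proof (cases "(\<integral>\<^sup>+x\<in>{a..b}. h x \<partial>lborel) = \<infinity>")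
  case False
  \<comment> \<open>The value 0 at points without derivative keeps the pointwise comparison with
    \<open>h\<close> trivial there.\<close>
  define f' where "f' x = (if f differentiable (at x) then vector_derivative f (at x) else 0)" for x
  define E where "E = {x \<in> {a<..<b}. \<not> f differentiable (at x)}"
  have "(f has_vector_derivative f' x) (at x)" if "x \<in> {a<..<b} - E" for x
    using that unfolding E_def f'_def by (auto simp: vector_derivative_works)
  then have int: "(f' has_integral (f b - f a)) {a..b}"
    using abs_continuous_on_ae_differentiable[OF f] unfolding E_def[symmetric]
    by (intro fundamental_theorem_of_calculus_abs_continuous[OF ab f])
  define k where "k x = indicat_real {a..b} x *\<^sub>R f' x" for x
  have "k \<in> borel_measurable lebesgue"
    unfolding k_def by (rule has_integral_implies_lebesgue_measurable[OF int])
  have "ennreal (norm (k x)) \<le> h x * indicator {a..b} x" if x: "x \<notin> N \<union> {a, b}" for x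
  proof (cases "x \<in> {a<..<b} \<and> f differentiable (at x)")
    case True
    then have "(f has_vector_derivative f' x) (at x)"
      unfolding f'_def by (simp add: vector_derivative_works)
    with True x bound[of x "f' x"] show ?thesis unfolding k_def by simp
  next
    case nd: False
    then have "k x = 0" using x unfolding k_def f'_def by (auto simp: indicator_def)
    then show ?thesis by simp
  qed
  moreover have "negligible (N \<union> {a, b})" using N by (simp add: negligible_Un)
  ultimately have "AE x in lebesgue. ennreal (norm (k x)) \<le> h x * indicator {a..b} x"
    unfolding negligible_iff_null_sets by (intro AE_I'[of "N \<union> {a, b}"]) auto
  then have "(\<integral>\<^sup>+x. ennreal (norm (k x)) \<partial>lebesgue) \<le> (\<integral>\<^sup>+x. h x * indicator {a..b} x \<partial>lebesgue)"
    by (rule nn_integral_mono_AE)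
  then have le: "(\<integral>\<^sup>+x. ennreal (norm (k x)) \<partial>lebesgue) \<le> (\<integral>\<^sup>+x\<in>{a..b}. h x \<partial>lborel)"
    by (simp add: nn_integral_completion)
  with False have "(\<integral>\<^sup>+x. ennreal (norm (k x)) \<partial>lebesgue) < \<infinity>"
    by (metis infinity_ennreal_def less_top order_le_less_trans)
  then have k: "integrable lebesgue k"
    using \<open>k \<in> borel_measurable lebesgue\<close> by (simp add: integrable_iff_bounded)
  then have "f' absolutely_integrable_on {a..b}" unfolding set_integrable_def k_def .
  then have "(LINT x:{a..b}|lebesgue. f' x) = integral {a..b} f'"
    by (rule set_lebesgue_integral_eq_integral)
  then have "f b - f a = integral\<^sup>L lebesgue k"
    using int unfolding set_lebesgue_integral_def k_def by (simp add: integral_unique)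
  with integral_norm_bound_ennreal[OF k] le show ?thesis by simp
qed simp

section \<open>Charts and curves\<close>

abbreviation chart_inv :: "('a, 'n::finite) corner_chart \<Rightarrow> real^'n \<Rightarrow> 'a" where
  "chart_inv c \<equiv> inv_into (cdom c) (cmap c)"

lemma cdom_subset: "is_corner_chart X c \<Longrightarrow> cdom c \<subseteq> topspace X"
  unfolding is_corner_chart_def by (simp add: openin_subset)

lemma cmap_inj_on:
  assumes "is_corner_chart X c" shows "inj_on (cmap c) (cdom c)"
  using assms cdom_subset[OF assms] unfolding is_corner_chart_def
  by (metis homeomorphic_imp_injective_map topspace_subtopology_subset)

lemma chart_inv_cmap:
  "is_corner_chart X c \<Longrightarrow> q \<in> cdom c \<Longrightarrow> chart_inv c (cmap c q) = q"
  by (simp add: cmap_inj_on inv_into_f_f)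

lemma cmap_chart_inv:
  "y \<in> cmap c ` cdom c \<Longrightarrow> cmap c (chart_inv c y) = y \<and> chart_inv c y \<in> cdom c"
  by (simp add: f_inv_into_f inv_into_into)

lemma continuous_map_cmap:
  assumes "is_corner_chart X c"
  shows "continuous_map (subtopology X (cdom c)) euclidean (cmap c)"
  using assms unfolding is_corner_chart_def
  by (meson continuous_map_in_subtopology homeomorphic_imp_continuous_map)

lemma continuous_map_chart_inv:
  assumes c: "is_corner_chart X c"
  shows "continuous_map (top_of_set (cmap c ` cdom c)) X (chart_inv c)"
proof -
  have "homeomorphic_map (subtopology X (cdom c)) (top_of_set (cmap c ` cdom c)) (cmap c)"
    using c unfolding is_corner_chart_def by blast
  then obtain g where g: "homeomorphic_maps (subtopology X (cdom c)) (top_of_set (cmap c ` cdom c)) (cmap c) g"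
    unfolding homeomorphic_map_maps by blast
  then have cont: "continuous_map (top_of_set (cmap c ` cdom c)) X g"
    unfolding homeomorphic_maps_def continuous_map_in_subtopology by blast
  have "g (cmap c q) = q" if "q \<in> cdom c" for q
    using g that cdom_subset[OF c] unfolding homeomorphic_maps_def by (auto simp: topspace_subtopology)
  then have "g y = chart_inv c y" if "y \<in> topspace (top_of_set (cmap c ` cdom c))" for y
    using that chart_inv_cmap[OF c] by auto
  then show ?thesis using cont continuous_map_eq by blast
qed

lemma chart_image_local:
  assumes c: "is_corner_chart X c" and y: "y \<in> cmap c ` cdom c"
  obtains e where "0 < e" "cball y e \<inter> corner_model (cfaces c) \<subseteq> cmap c ` cdom c"
proof -
  obtain V where V: "open V" "cmap c ` cdom c = corner_model (cfaces c) \<inter> V"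
    using c unfolding is_corner_chart_def openin_open by blast
  then obtain e where "0 < e" "cball y e \<subseteq> V" using y open_contains_cball by blast
  then show thesis using that[of e] V by blast
qed

lemma chart_image_nonneg:
  assumes "is_corner_chart X c" "q \<in> cdom c" "j \<in> cfaces c"
  shows "0 \<le> cmap c q $ j"
proof -
  have "cmap c ` cdom c \<subseteq> corner_model (cfaces c)"
    using assms(1) unfolding is_corner_chart_def by (meson openin_imp_subset)
  then show ?thesis using assms unfolding corner_model_def by blast
qed

lemma interior_coords_ball:
  fixes y :: "real^'n"
  assumes "\<And>j. j \<in> K \<Longrightarrow> 0 < y $ j"
  obtains e where "0 < e" "ball y e \<subseteq> corner_model K"
proof -
  have "open (\<Inter>j\<in>K. {x :: real^'n. 0 < x $ j})"
    by (intro open_INT finite ballI open_Collect_less continuous_intros)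
  moreover have "y \<in> (\<Inter>j\<in>K. {x. 0 < x $ j})" using assms by simp
  ultimately obtain e where e: "0 < e" "ball y e \<subseteq> (\<Inter>j\<in>K. {x. 0 < x $ j})"
    by (rule openE)
  have "(\<Inter>j\<in>K. {x :: real^'n. 0 < x $ j}) \<subseteq> corner_model K"
    unfolding corner_model_def by (auto intro: less_imp_le)
  with e(2) have "ball y e \<subseteq> corner_model K" by (rule subset_trans)
  with e(1) show thesis by (rule that)
qed

text \<open>Where no constrained coordinate vanishes, the overlap contains a full Euclidean ball in
  coordinates, so invariance of domain applies and derivatives within the overlap are ordinary
  derivatives.\<close>

lemma chart_overlap_ball:
  assumes c: "is_corner_chart X c" and U: "openin X U" and q: "q \<in> cdom c" "q \<in> U"
    and pos: "\<And>j. j \<in> cfaces c \<Longrightarrow> 0 < cmap c q $ j"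
  obtains e where "0 < e" "ball (cmap c q) e \<subseteq> cmap c ` (cdom c \<inter> U)"
proof -
  let ?I = "cmap c ` cdom c"
  obtain e1 where e1: "0 < e1" "ball (cmap c q) e1 \<subseteq> corner_model (cfaces c)"
    using interior_coords_ball[of "cfaces c" "cmap c q"] pos by blast
  obtain e2 where e2: "0 < e2" "cball (cmap c q) e2 \<inter> corner_model (cfaces c) \<subseteq> ?I"
    using chart_image_local[OF c] q by blast
  have "openin (top_of_set ?I) {y \<in> ?I. chart_inv c y \<in> U}"
    using openin_continuous_map_preimage[OF continuous_map_chart_inv[OF c] U] by simp
  moreover have "cmap c q \<in> {y \<in> ?I. chart_inv c y \<in> U}" using q chart_inv_cmap[OF c] by simp
  ultimately obtain e3 where e3: "0 < e3" "ball (cmap c q) e3 \<inter> ?I \<subseteq> {y \<in> ?I. chart_inv c y \<in> U}"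
    unfolding openin_contains_ball by blast
  define e where "e = min e1 (min e2 e3)"
  have "ball (cmap c q) e \<subseteq> cmap c ` (cdom c \<inter> U)"
  proof
    fix y assume "y \<in> ball (cmap c q) e"
    then have y: "y \<in> ball (cmap c q) e1" "y \<in> cball (cmap c q) e2" "y \<in> ball (cmap c q) e3"
      unfolding e_def by auto
    then have "y \<in> ?I" using e1 e2 by blast
    with y(3) have "chart_inv c y \<in> U" using e3(2) by fast
    moreover note cmap_chart_inv[OF \<open>y \<in> ?I\<close>]
    ultimately show "y \<in> cmap c ` (cdom c \<inter> U)" by (intro image_eqI[of y _ "chart_inv c y"]) auto
  qed
  moreover have "0 < e" unfolding e_def using e1 e2 e3 by simp
  ultimately show thesis by (intro that)
qed

section \<open>Interior points\<close>

lemma mem_minterior_iff: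
  "q \<in> minterior X A \<longleftrightarrow> q \<in> topspace X \<and>
     (\<forall>c\<in>A. q \<in> cdom c \<longrightarrow> (\<forall>j\<in>cfaces c. cmap c q $ j \<noteq> 0))"
proof -
  have "card {j \<in> cfaces c. cmap c q $ j = 0} \<in> {1..} \<longleftrightarrow> (\<exists>j\<in>cfaces c. cmap c q $ j = 0)" for c :: "('a, 'b) corner_chart"
    by (auto simp: Suc_le_eq card_gt_0_iff)
  then show ?thesis
    unfolding minterior_def mboundary_def depth_stratum_def by blast
qed

lemma minterior_coords_pos:
  assumes "smooth_atlas X A" "q \<in> minterior X A" "c \<in> A" "q \<in> cdom c" "j \<in> cfaces c"
  shows "0 < cmap c q $ j"
proof -
  have "is_corner_chart X c" using assms unfolding smooth_atlas_def by blast
  from chart_image_nonneg[OF this assms(4,5)] show ?thesis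
    using assms(2-5) unfolding mem_minterior_iff by force
qed

text \<open>Being an interior point does not depend on the chart, by invariance of domain.\<close>

lemma minteriorI:
  assumes A: "smooth_atlas X A" and c: "c \<in> A" and q: "q \<in> cdom c"
    and pos: "\<And>j. j \<in> cfaces c \<Longrightarrow> 0 < cmap c q $ j"
  shows "q \<in> minterior X A"
  unfolding mem_minterior_iff
proof (intro conjI ballI impI)
  have chart: "is_corner_chart X c" using A c unfolding smooth_atlas_def by blast
  show "q \<in> topspace X" using cdom_subset[OF chart] q by blast
  fix c' j assume c': "c' \<in> A" and q': "q \<in> cdom c'" and j: "j \<in> cfaces c'"
  have chart': "is_corner_chart X c'" using A c' unfolding smooth_atlas_def by blast
  have "openin X (cdom c')" using chart' unfolding is_corner_chart_def by blast
  then obtain e where e: "0 < e" "ball (cmap c q) e \<subseteq> cmap c ` (cdom c \<inter> cdom c')"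
    using chart_overlap_ball[OF chart _ q q' pos] by blast
  let ?B = "ball (cmap c q) e" and ?f = "cmap c' \<circ> chart_inv c"
  have B: "?B \<subseteq> cmap c ` cdom c" "chart_inv c ` ?B \<subseteq> cdom c'"
    using e(2) chart_inv_cmap[OF chart] by auto
  have "continuous_map (top_of_set ?B) X (chart_inv c)"
    using continuous_map_chart_inv[OF chart] B(1) continuous_map_from_subtopology_mono by blast
  then have "continuous_map (top_of_set ?B) (subtopology X (cdom c')) (chart_inv c)"
    using B(2) by (simp add: continuous_map_in_subtopology image_subset_iff_funcset)
  then have "continuous_map (top_of_set ?B) euclidean ?f"
    using continuous_map_cmap[OF chart'] continuous_map_compose by blast
  then have cont: "continuous_on ?B ?f" by simp
  have "inj_on ?f ?B"
    using B inj_on_inv_into[OF B(1)] cmap_inj_on[OF chart'] by (intro comp_inj_on) (auto intro: inj_on_subset)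
  with cont have "open (?f ` ?B)" by (intro invariance_of_domain) auto
  moreover have "cmap c' q \<in> ?f ` ?B"
    using e(1) chart_inv_cmap[OF chart q] by (intro image_eqI[of _ _ "cmap c q"]) auto
  ultimately obtain d where d: "0 < d" "ball (cmap c' q) d \<subseteq> ?f ` ?B"
    using open_contains_ball by blast
  show "cmap c' q $ j \<noteq> 0"
  proof
    assume 0: "cmap c' q $ j = 0"
    let ?z = "cmap c' q - (d / 2) *\<^sub>R axis j 1"
    have "?z \<in> ball (cmap c' q) d" using d(1) by (simp add: dist_norm)
    then have "?z \<in> ?f ` ?B" using d(2) by (rule subsetD[rotated])
    then obtain x where x: "x \<in> ?B" "?z = ?f x" by (rule imageE) blast
    then have "chart_inv c x \<in> cdom c'" using B(2) by blast
    from chart_image_nonneg[OF chart' this j] have "0 \<le> ?z $ j" unfolding x(2) by simp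
    then show False using 0 d(1) by (simp add: axis_def)
  qed
qed

section \<open>Local estimates for smooth maps and chart transitions\<close>

lemma smooth_on_C1:
  assumes "smooth_on S f" "y \<in> S"
  obtains V h where "open V" "y \<in> V" "\<And>x. x \<in> V \<Longrightarrow> h differentiable (at x)"
    "\<And>v. continuous_on V (\<lambda>x. frechet_derivative h (at x) v)" "\<And>x. x \<in> S \<Longrightarrow> x \<in> V \<Longrightarrow> h x = f x"
proof -
  obtain V h where V: "open V" "y \<in> V" "\<And>k. Ck_on k V h" "\<forall>x\<in>S \<inter> V. h x = f x"
    using assms unfolding smooth_on_def by blast
  from V(3)[of "Suc 0"] have "h differentiable_on V" "\<And>v. continuous_on V (\<lambda>x. frechet_derivative h (at x) v)"
    by auto
  then show thesis using V by (intro that[of V h]) (auto simp: differentiable_on_eq_differentiable_at)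
qed

lemma smooth_on_imp_continuous_on:
  assumes "smooth_on S f" shows "continuous_on S f"
  unfolding continuous_on_eq_continuous_within
proof
  fix y assume y: "y \<in> S"
  obtain V h where V: "open V" "y \<in> V" "\<And>x. x \<in> V \<Longrightarrow> h differentiable (at x)" "\<And>x. x \<in> S \<Longrightarrow> x \<in> V \<Longrightarrow> h x = f x"
    using smooth_on_C1[OF assms y] by metis
  have "(h \<longlongrightarrow> h y) (at y within S)"
    unfolding continuous_within[symmetric] using V(2,3) by (simp add: continuous_at_imp_continuous_at_within differentiable_imp_continuous_within)
  moreover have "\<forall>\<^sub>F x in at y within S. h x = f x"
    using V by (intro eventually_at_topological[THEN iffD2] exI[of _ V]) auto
  ultimately have "(f \<longlongrightarrow> h y) (at y within S)" by (rule Lim_transform_eventually)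
  then show "continuous (at y within S) f"
    unfolding continuous_within V(4)[OF y V(2)] .
qed

lemma smooth_on_has_derivative:
  assumes "smooth_on S f" "y \<in> S"
  shows "f differentiable (at y within S)"
proof -
  obtain V h where V: "open V" "y \<in> V" "\<And>x. x \<in> V \<Longrightarrow> h differentiable (at x)" "\<And>x. x \<in> S \<Longrightarrow> x \<in> V \<Longrightarrow> h x = f x"
    using smooth_on_C1[OF assms] by metis
  then obtain h' where "(h has_derivative h') (at y within S)"
    unfolding differentiable_def by (meson has_derivative_at_withinI)
  moreover obtain d where d: "0 < d" "ball y d \<subseteq> V" using V open_contains_ball by blast
  ultimately have "(f has_derivative h') (at y within S)"
    using V(4) assms(2) by (intro has_derivative_transform_within[of h h' y S d f]) (auto simp: dist_commute subset_iff)
  then show ?thesis unfolding differentiable_def by blast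
qed

text \<open>Partial derivatives are bounded on a compact ball, and the sum of these bounds controls
  the operator norm of the derivative; convexity of the ball then gives the mean value
  inequality.\<close>

lemma C1_locally_lipschitz:
  fixes h :: "'a::euclidean_space \<Rightarrow> 'b::real_normed_vector"
  assumes V: "open V" "y \<in> V" and h: "\<And>x. x \<in> V \<Longrightarrow> h differentiable (at x)"
    "\<And>v. continuous_on V (\<lambda>x. frechet_derivative h (at x) v)"
  obtains e L where "0 < e" "0 \<le> L" "\<And>x z. x \<in> cball y e \<Longrightarrow> z \<in> cball y e \<Longrightarrow> norm (h x - h z) \<le> L * norm (x - z)"
proof -
  obtain e where e: "0 < e" "cball y e \<subseteq> V" using V open_contains_cball by blast
  have "\<exists>M. \<forall>x\<in>cball y e. norm (frechet_derivative h (at x) b) \<le> M" for b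
  proof -
    have "compact ((\<lambda>x. frechet_derivative h (at x) b) ` cball y e)"
      by (intro compact_continuous_image continuous_on_subset[OF h(2) e(2)] compact_cball)
    from compact_imp_bounded[OF this] show ?thesis unfolding bounded_iff by simp
  qed
  then obtain M where M: "\<And>x b. x \<in> cball y e \<Longrightarrow> norm (frechet_derivative h (at x) b) \<le> M b" by metis
  define L where "L = (\<Sum>b\<in>Basis. M b)"
  have y: "y \<in> cball y e" using e by simp
  have "0 \<le> L" unfolding L_def by (intro sum_nonneg order_trans[OF norm_ge_zero M[OF y]])
  have "norm (h x - h z) \<le> L * norm (x - z)" if "x \<in> cball y e" "z \<in> cball y e" for x z
  proof (rule differentiable_bound[OF convex_cball _ _ that])
    fix x assume x: "x \<in> cball y e"
    then have D: "(h has_derivative frechet_derivative h (at x)) (at x)"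
      using h(1) e(2) frechet_derivative_works by blast
    then show "(h has_derivative frechet_derivative h (at x)) (at x within cball y e)"
      by (rule has_derivative_at_withinI)
    show "onorm (frechet_derivative h (at x)) \<le> L"
    proof (rule onorm_le)
      fix v
      have "linear (frechet_derivative h (at x))" using D has_derivative_linear by blast
      then have "frechet_derivative h (at x) (\<Sum>b\<in>Basis. (v \<bullet> b) *\<^sub>R b) =
          (\<Sum>b\<in>Basis. (v \<bullet> b) *\<^sub>R frechet_derivative h (at x) b)"
        by (simp add: linear_sum linear_scale)
      then have "frechet_derivative h (at x) v = (\<Sum>b\<in>Basis. (v \<bullet> b) *\<^sub>R frechet_derivative h (at x) b)"
        by (simp only: euclidean_representation)
      also have "norm \<dots> \<le> (\<Sum>b\<in>Basis. norm v * M b)"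
      proof (rule sum_norm_le)
        fix b :: 'a assume b: "b \<in> Basis"
        show "norm ((v \<bullet> b) *\<^sub>R frechet_derivative h (at x) b) \<le> norm v * M b"
          unfolding norm_scaleR real_norm_def[symmetric]
          using M[OF x] Basis_le_norm[OF b] by (intro mult_mono) auto
      qed
      finally show "norm (frechet_derivative h (at x) v) \<le> L * norm v"
        unfolding L_def by (simp add: sum_distrib_left mult.commute)
    qed
  qed
  with e(1) \<open>0 \<le> L\<close> show thesis by (rule that)
qed

text \<open>Near an interior point the smooth extension agrees with the transition map on a whole
  ball, so the derivatives of the extension are those of the transition map itself.\<close>

lemma transition_C1:
  assumes A: "smooth_atlas X A" and c: "c \<in> A" "c' \<in> A" and q: "q \<in> cdom c" "q \<in> cdom c'"
    and pos: "\<And>j. j \<in> cfaces c \<Longrightarrow> 0 < cmap c q $ j"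
  obtains e where "0 < e" "ball (cmap c q) e \<subseteq> cmap c ` (cdom c \<inter> cdom c')"
    "\<And>x. x \<in> ball (cmap c q) e \<Longrightarrow> in_chart c (cmap c') differentiable (at x)"
    "\<And>v. continuous_on (ball (cmap c q) e) (\<lambda>x. frechet_derivative (in_chart c (cmap c')) (at x) v)"
proof -
  let ?y = "cmap c q" and ?S = "cmap c ` (cdom c \<inter> cdom c')" and ?f = "in_chart c (cmap c')"
  have chart: "is_corner_chart X c" "is_corner_chart X c'" and smooth: "smooth_on ?S ?f"
    using A c unfolding smooth_atlas_def by blast+
  then have "openin X (cdom c')" unfolding is_corner_chart_def by blast
  then obtain e1 where e1: "0 < e1" "ball ?y e1 \<subseteq> ?S"
    using chart_overlap_ball[OF chart(1) _ q pos] by blast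
  have y: "?y \<in> ?S" using q by blast
  obtain V h where V: "open V" "?y \<in> V" and h: "\<And>x. x \<in> V \<Longrightarrow> h differentiable (at x)"
    "\<And>v. continuous_on V (\<lambda>x. frechet_derivative h (at x) v)" "\<And>x. x \<in> ?S \<Longrightarrow> x \<in> V \<Longrightarrow> h x = ?f x"
    by (fact smooth_on_C1[OF smooth y])
  obtain e2 where e2: "0 < e2" "ball ?y e2 \<subseteq> V" using V openE by blast
  define e where "e = min e1 e2"
  have sub: "ball ?y e \<subseteq> ?S" "ball ?y e \<subseteq> V" using e1 e2 unfolding e_def by auto
  have D: "(?f has_derivative frechet_derivative h (at x)) (at x)" if x: "x \<in> ball ?y e" for x
  proof (rule has_derivative_transform_within_open[of h])
    show "(h has_derivative frechet_derivative h (at x)) (at x)"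
      using h(1) sub(2) x frechet_derivative_works by blast
    show "h z = ?f z" if "z \<in> ball ?y e" for z using that sub h(3) by blast
  qed (use x in auto)
  then have eq: "frechet_derivative ?f (at x) = frechet_derivative h (at x)" if "x \<in> ball ?y e" for x
    using frechet_derivative_at that by metis
  show thesis
  proof
    show "0 < e" using e1 e2 unfolding e_def by simp
    show "ball ?y e \<subseteq> ?S" by fact
    show "?f differentiable (at x)" if "x \<in> ball ?y e" for x
      using D[OF that] unfolding differentiable_def by blast
    show "continuous_on (ball ?y e) (\<lambda>x. frechet_derivative ?f (at x) v)" for v
      using continuous_on_subset[OF h(2) sub(2)] by (rule continuous_on_cong[THEN iffD2, rotated -1]) (simp_all add: eq)
  qed
qed

section \<open>Speed of curves in a prescribed chart\<close>

definition tensorial :: "('a, 'n::finite) corner_chart set \<Rightarrow> ('a, 'n) two_tensor \<Rightarrow> bool" where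
  "tensorial A g \<longleftrightarrow> (\<forall>c\<in>A. \<forall>c'\<in>A. \<forall>p\<in>cdom c \<inter> cdom c'. \<forall>v w.
        g c p v w = g c' p (differential_in c (cdom c \<inter> cdom c') (cmap c') p v)
                           (differential_in c (cdom c \<inter> cdom c') (cmap c') p w))"

lemma eventually_in_openin:
  assumes "continuous_map (top_of_set T) X \<gamma>" "openin X U" "t \<in> T" "\<gamma> t \<in> U"
  shows "\<forall>\<^sub>F s in at t within T. \<gamma> s \<in> U"
proof -
  have "openin (top_of_set T) {s \<in> T. \<gamma> s \<in> U}"
    using openin_continuous_map_preimage[OF assms(1,2)] by simp
  then obtain V where "open V" "{s \<in> T. \<gamma> s \<in> U} = T \<inter> V" unfolding openin_open by blast
  with assms(3,4) show ?thesis
    unfolding eventually_at_topological by (intro exI[of _ V]) blast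
qed

text \<open>Frees the speed from the chart selected by \<open>SOME\<close>: the chain rule for the
  transition map transports the velocity, and the transformation law compensates for it. The
  condition \<open>at t within T \<noteq> bot\<close> makes the vector derivative unique.\<close>

lemma speed_in_chart:
  assumes A: "smooth_atlas X A" and g: "tensorial A g" and c: "c \<in> A" "\<gamma> t \<in> cdom c"
    and int: "\<gamma> t \<in> minterior X A" and cont: "continuous_map (top_of_set T) X \<gamma>"
    and t: "t \<in> T" "at t within T \<noteq> bot"
    and v: "((cmap c \<circ> \<gamma>) has_vector_derivative v) (at t within T)"
  shows "speed A g T \<gamma> t = sqrt (g c (\<gamma> t) v v)"
proof -
  define c' where "c' = (SOME c. c \<in> A \<and> \<gamma> t \<in> cdom c)"
  have c': "c' \<in> A" "\<gamma> t \<in> cdom c'"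
    using someI[of "\<lambda>c. c \<in> A \<and> \<gamma> t \<in> cdom c" c] c unfolding c'_def by blast+
  have chart: "is_corner_chart X c" using A c unfolding smooth_atlas_def by blast
  let ?f = "in_chart c (cmap c')" and ?y = "cmap c (\<gamma> t)" and ?S = "cmap c ` (cdom c \<inter> cdom c')"
  obtain e where e: "0 < e" "ball ?y e \<subseteq> ?S" "\<And>x. x \<in> ball ?y e \<Longrightarrow> ?f differentiable (at x)"
    "\<And>v. continuous_on (ball ?y e) (\<lambda>x. frechet_derivative ?f (at x) v)"
    using transition_C1[OF A c(1) c'(1) c(2) c'(2) minterior_coords_pos[OF A int c]] by blast
  define D where "D = frechet_derivative ?f (at ?y)"
  have D: "(?f has_derivative D) (at ?y)"
    unfolding D_def using e(1) e(3)[of ?y] frechet_derivative_works by auto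
  \<comment> \<open>\<open>differential_in\<close> uses the derivative within the overlap; at an
    interior point this is the full derivative \<open>D\<close>.\<close>
  have "?y \<in> interior ?S" using e(1,2) mem_interior by blast
  then have within: "at ?y within ?S = at ?y" by (rule at_within_interior)
  have dif: "differential_in c (cdom c \<inter> cdom c') (cmap c') (\<gamma> t) = D"
    unfolding differential_in_def D_def within ..
  have "((?f \<circ> (cmap c \<circ> \<gamma>)) has_derivative (D \<circ> (\<lambda>h. h *\<^sub>R v))) (at t within T)"
    using v D unfolding has_vector_derivative_def
    by (intro diff_chain_within) (auto intro: has_derivative_at_withinI)
  moreover have "D (h *\<^sub>R v) = h *\<^sub>R D v" for h
    using D has_derivative_linear linear_scale by blast
  ultimately have "((?f \<circ> (cmap c \<circ> \<gamma>)) has_derivative (\<lambda>h. h *\<^sub>R D v)) (at t within T)"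
    by (simp add: comp_def)
  moreover have "\<forall>\<^sub>F s in at t within T. (?f \<circ> (cmap c \<circ> \<gamma>)) s = (cmap c' \<circ> \<gamma>) s"
  proof (rule eventually_mono)
    show "\<forall>\<^sub>F s in at t within T. \<gamma> s \<in> cdom c"
      using chart unfolding is_corner_chart_def by (intro eventually_in_openin[OF cont _ t(1) c(2)]) blast
  qed (simp add: in_chart_def chart_inv_cmap[OF chart])
  moreover have "(?f \<circ> (cmap c \<circ> \<gamma>)) t = (cmap c' \<circ> \<gamma>) t"
    by (simp add: in_chart_def chart_inv_cmap[OF chart c(2)])
  ultimately have "((cmap c' \<circ> \<gamma>) has_vector_derivative D v) (at t within T)"
    unfolding has_vector_derivative_def using t(1) by (blast intro: has_derivative_transform_eventually)
  then have "vector_derivative (cmap c' \<circ> \<gamma>) (at t within T) = D v"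
    by (rule vector_derivative_within[OF t(2)])
  moreover have "g c (\<gamma> t) v v = g c' (\<gamma> t) (D v) (D v)"
    using g c c' unfolding tensorial_def dif[symmetric] by blast
  ultimately show ?thesis
    unfolding speed_def c'_def[symmetric] Let_def by simp
qed

text \<open>\<open>ac_curve\<close> demands absolute continuity in every chart, not only in the one
  where the curve is a line. In another chart the velocity is the derivative of the transition map
  applied to \<open>w\<close>, which is continuous along the line and hence bounded on compact
  subintervals, so the curve is Lipschitz there.\<close>

lemma coordinate_line:
  fixes c :: "('a, 'n::finite) corner_chart"
  assumes A: "smooth_atlas X A" and c: "c \<in> A"
    and l: "\<And>t. t \<in> T \<Longrightarrow> y + t *\<^sub>R w \<in> cmap c ` cdom c"
      "\<And>t j. t \<in> T \<Longrightarrow> j \<in> cfaces c \<Longrightarrow> 0 < (y + t *\<^sub>R w) $ j"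
    and \<gamma>: "\<gamma> = (\<lambda>t. chart_inv c (y + t *\<^sub>R w))"
  shows "ac_curve X A T \<gamma>"
    and "tensorial A g \<Longrightarrow> t \<in> T \<Longrightarrow> at t within T \<noteq> bot \<Longrightarrow> speed A g T \<gamma> t = sqrt (g c (\<gamma> t) w w)"
proof -
  have chart: "is_corner_chart X c" using A c unfolding smooth_atlas_def by blast
  have \<gamma>c: "\<gamma> t \<in> cdom c" "cmap c (\<gamma> t) = y + t *\<^sub>R w" if "t \<in> T" for t
    using cmap_chart_inv[OF l(1)[OF that]] unfolding \<gamma> by auto
  have int: "\<gamma> t \<in> minterior X A" if "t \<in> T" for t
    using l(2)[OF that] \<gamma>c[OF that] by (intro minteriorI[OF A c]) auto
  have "continuous_map (top_of_set T) (top_of_set (cmap c ` cdom c)) (\<lambda>t. y + t *\<^sub>R w)"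
    using l(1) by (auto simp: continuous_map_in_subtopology intro!: continuous_intros)
  then have cont: "continuous_map (top_of_set T) X \<gamma>"
    using continuous_map_compose[OF _ continuous_map_chart_inv[OF chart]] unfolding \<gamma> comp_def by blast
  have "abs_continuous_on {s..t} (cmap c' \<circ> \<gamma>)"
    if c': "c' \<in> A" and st: "s \<le> t" "{s..t} \<subseteq> T" "\<gamma> ` {s..t} \<subseteq> cdom c'" for c' s t
  proof -
    let ?f = "in_chart c (cmap c')" and ?l = "\<lambda>t. y + t *\<^sub>R w"
    define d where "d \<tau> = frechet_derivative ?f (at (?l \<tau>)) w" for \<tau>
    have loc: "((cmap c' \<circ> \<gamma>) has_vector_derivative d \<tau>) (at \<tau> within {s..t}) \<and>
        continuous (at \<tau> within {s..t}) d" if \<tau>: "\<tau> \<in> {s..t}" for \<tau>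
    proof -
      have \<tau>T: "\<tau> \<in> T" using \<tau> st by blast
      have q: "\<gamma> \<tau> \<in> cdom c" "\<gamma> \<tau> \<in> cdom c'" using \<gamma>c[OF \<tau>T] st \<tau> by blast+
      obtain e where e: "0 < e" "ball (?l \<tau>) e \<subseteq> cmap c ` (cdom c \<inter> cdom c')"
        "\<And>x. x \<in> ball (?l \<tau>) e \<Longrightarrow> ?f differentiable (at x)"
        "\<And>v. continuous_on (ball (?l \<tau>) e) (\<lambda>x. frechet_derivative ?f (at x) v)"
        using transition_C1[OF A c c' q minterior_coords_pos[OF A int[OF \<tau>T] c q(1)]]
        unfolding \<gamma>c(2)[OF \<tau>T] by blast
      have D: "(?f has_derivative frechet_derivative ?f (at (?l \<tau>))) (at (?l \<tau>))"
        using e(1) e(3)[of "?l \<tau>"] frechet_derivative_works by auto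
      have dl: "(?l has_derivative (\<lambda>h. h *\<^sub>R w)) (at \<tau> within {s..t})"
        by (auto intro!: derivative_eq_intros)
      have "((?f \<circ> ?l) has_derivative (frechet_derivative ?f (at (?l \<tau>)) \<circ> (\<lambda>h. h *\<^sub>R w))) (at \<tau> within {s..t})"
        using D by (intro diff_chain_within[OF dl]) (rule has_derivative_at_withinI)
      moreover have "frechet_derivative ?f (at (?l \<tau>)) (h *\<^sub>R w) = h *\<^sub>R d \<tau>" for h
        unfolding d_def using D has_derivative_linear linear_scale by blast
      ultimately have "((?f \<circ> ?l) has_vector_derivative d \<tau>) (at \<tau> within {s..t})"
        unfolding has_vector_derivative_def by (simp add: comp_def)
      then have "((cmap c' \<circ> \<gamma>) has_vector_derivative d \<tau>) (at \<tau> within {s..t})"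
        unfolding in_chart_def \<gamma> by (simp add: comp_def)
      moreover have "continuous (at \<tau> within {s..t}) d"
      proof -
        have "isCont (\<lambda>x. frechet_derivative ?f (at x) w) (?l \<tau>)"
          using e(1,4) by (simp add: continuous_on_eq_continuous_at)
        moreover have "continuous (at \<tau> within {s..t}) ?l" using dl has_derivative_continuous by blast
        ultimately show ?thesis unfolding d_def
          using continuous_within_compose3[of ?l \<tau> "\<lambda>x. frechet_derivative ?f (at x) w"] by blast
      qed
      ultimately show ?thesis by blast
    qed
    then have "continuous_on {s..t} d" by (simp add: continuous_on_eq_continuous_within)
    then have "bounded (d ` {s..t})" by (intro compact_imp_bounded compact_continuous_image) auto
    then obtain M where M: "\<And>\<tau>. \<tau> \<in> {s..t} \<Longrightarrow> norm (d \<tau>) \<le> M" unfolding bounded_iff by blast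
    show ?thesis
    proof (rule lipschitz_imp_abs_continuous_on[of _ _ M])
      fix \<tau> \<tau>' assume "\<tau> \<in> {s..t}" "\<tau>' \<in> {s..t}"
      then have "norm ((cmap c' \<circ> \<gamma>) \<tau>' - (cmap c' \<circ> \<gamma>) \<tau>) \<le> M * norm (\<tau>' - \<tau>)"
      proof (intro differentiable_bound[OF convex_real_interval(5), of s t _ "\<lambda>\<tau> h. h *\<^sub>R d \<tau>"])
        fix \<tau> assume \<tau>: "\<tau> \<in> {s..t}"
        show "((cmap c' \<circ> \<gamma>) has_derivative (\<lambda>h. h *\<^sub>R d \<tau>)) (at \<tau> within {s..t})"
          using loc[OF \<tau>] unfolding has_vector_derivative_def by blast
        show "onorm (\<lambda>h. h *\<^sub>R d \<tau>) \<le> M"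
          using M[OF \<tau>] by (intro onorm_le) (simp add: mult.commute[of M] mult_left_mono)
      qed
      then show "norm ((cmap c' \<circ> \<gamma>) \<tau>' - (cmap c' \<circ> \<gamma>) \<tau>) \<le> M * \<bar>\<tau>' - \<tau>\<bar>" by simp
    qed
  qed
  then show "ac_curve X A T \<gamma>"
    unfolding ac_curve_def using int cont by blast
  assume g: "tensorial A g" and t: "t \<in> T" "at t within T \<noteq> bot"
  have "((\<lambda>t. y + t *\<^sub>R w) has_vector_derivative w) (at t within T)"
    by (auto intro!: derivative_eq_intros)
  then have "((cmap c \<circ> \<gamma>) has_vector_derivative w) (at t within T)"
    by (rule has_vector_derivative_transform[OF t(1), rotated]) (simp add: \<gamma>c)
  then show "speed A g T \<gamma> t = sqrt (g c (\<gamma> t) w w)"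
    by (intro speed_in_chart[OF A g c _ int cont t]) (use \<gamma>c t in auto)
qed

lemma directional_derivative_limit:
  fixes f :: "'b::real_normed_vector \<Rightarrow> real"
  assumes f: "(f has_derivative D) (at y within U)" and "f y = 0" and "0 < s0"
    and U: "\<And>s. 0 \<le> s \<Longrightarrow> s \<le> s0 \<Longrightarrow> y + s *\<^sub>R e \<in> U"
  shows "((\<lambda>s. f (y + s *\<^sub>R e) / s) \<longlongrightarrow> D e) (at_right 0)"
proof -
  let ?l = "\<lambda>s. y + s *\<^sub>R e"
  have dl: "(?l has_derivative (\<lambda>h. h *\<^sub>R e)) (at 0 within {0..s0})"
    by (auto intro!: derivative_eq_intros)
  have "(f has_derivative D) (at (?l 0) within ?l ` {0..s0})"
    using f U by (auto intro: has_derivative_subset)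
  from diff_chain_within[OF dl this]
  have "((f \<circ> ?l) has_derivative (D \<circ> (\<lambda>h. h *\<^sub>R e))) (at 0 within {0..s0})" .
  moreover have "D \<circ> (\<lambda>h. h *\<^sub>R e) = (*) (D e)"
    using linear_scale[OF has_derivative_linear[OF f]] by (auto simp: comp_def fun_eq_iff)
  ultimately have "((f \<circ> ?l) has_real_derivative D e) (at 0 within {0..s0})"
    unfolding has_field_derivative_def by simp
  then show ?thesis
    unfolding has_field_derivative_iff at_within_Icc_at_right[OF \<open>0 < s0\<close>] using \<open>f y = 0\<close> by simp
qed

section \<open>The product metric near a boundary point\<close>

text \<open>The sum of the coordinate vectors transversal to all faces through \<open>p\<close>.
  Using all of them at once avoids deciding which coordinate face belongs to which
  hypersurface.\<close>

definition inward :: "('a, 'n::finite) corner_chart \<Rightarrow> 'a \<Rightarrow> real^'n" where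
  "inward c p = (\<chi> j. if j \<in> cfaces c \<and> cmap c p $ j = 0 then 1 else 0)"

text \<open>For small parameters, coordinates that are positive at \<open>y\<close> stay positive by
  continuity, those that vanish at \<open>y\<close> are kept nonnegative by \<open>w\<close>, and
  there are only finitely many constraints.\<close>

lemma chart_image_segment:
  assumes c: "is_corner_chart X c" and y: "y \<in> cmap c ` cdom c"
    and w: "\<And>j. j \<in> cfaces c \<Longrightarrow> y $ j = 0 \<Longrightarrow> 0 \<le> w $ j"
  obtains s0 where "0 < s0" "\<And>s. 0 \<le> s \<Longrightarrow> s \<le> s0 \<Longrightarrow> y + s *\<^sub>R w \<in> cmap c ` cdom c"
proof -
  obtain e where e: "0 < e" "cball y e \<inter> corner_model (cfaces c) \<subseteq> cmap c ` cdom c"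
    by (fact chart_image_local[OF c y])
  have "\<forall>\<^sub>F s in at_right 0. \<forall>j\<in>cfaces c. 0 \<le> (y + s *\<^sub>R w) $ j"
  proof (rule eventually_ball_finite[OF finite], rule ballI)
    fix j assume j: "j \<in> cfaces c"
    have "0 \<le> y $ j" using chart_image_nonneg[OF c _ j] y by auto
    show "\<forall>\<^sub>F s in at_right 0. 0 \<le> (y + s *\<^sub>R w) $ j"
    proof (cases "y $ j = 0")
      case True
      then show ?thesis using w[OF j True] by (auto intro!: eventually_at_right_less[THEN eventually_mono])
    next
      case False
      then have "0 < y $ j" using \<open>0 \<le> y $ j\<close> by simp
      moreover have "((\<lambda>s. (y + s *\<^sub>R w) $ j) \<longlongrightarrow> (y + 0 *\<^sub>R w) $ j) (at_right 0)"
        by (intro tendsto_intros)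
      ultimately have "\<forall>\<^sub>F s in at_right 0. 0 < (y + s *\<^sub>R w) $ j"
        by (intro order_tendstoD(1)) auto
      then show ?thesis by (rule eventually_mono) simp
    qed
  qed
  moreover have "\<forall>\<^sub>F s in at_right 0. dist y (y + s *\<^sub>R w) < e"
  proof -
    have "((\<lambda>s. y + s *\<^sub>R w) \<longlongrightarrow> y + 0 *\<^sub>R w) (at_right 0)" by (intro tendsto_intros)
    then show ?thesis using tendstoD[OF _ e(1)] by (simp add: dist_commute)
  qed
  ultimately have "\<forall>\<^sub>F s in at_right 0. y + s *\<^sub>R w \<in> cmap c ` cdom c"
    by eventually_elim (use e(2) in \<open>auto simp: corner_model_def subset_iff\<close>)
  then obtain b where b: "0 < b" "\<And>s. 0 < s \<Longrightarrow> s < b \<Longrightarrow> y + s *\<^sub>R w \<in> cmap c ` cdom c"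
    unfolding eventually_at_right_field by auto
  have "y + s *\<^sub>R w \<in> cmap c ` cdom c" if "0 \<le> s" "s \<le> b / 2" for s
    using b(2)[of s] b(1) that y by (cases "s = 0") auto
  then show thesis using that[of "b / 2"] b(1) by simp
qed

text \<open>The differential of a boundary-defining function is nonnegative on inward directions and
  vanishes on directions tangent to the corner, so it is positive on \<open>inward c p\<close>.\<close>

lemma boundary_defining_linear_growth:
  assumes chart: "is_corner_chart X c" and c: "c \<in> A" and bdf: "boundary_defining X A H \<rho>"
    and p: "p \<in> H" "p \<in> cdom c"
  obtains k where "0 < k" "inward c p \<noteq> 0"
    "\<forall>\<^sub>F s in at_right 0. k * s \<le> \<rho> (chart_inv c (cmap c p + s *\<^sub>R inward c p))"
proof -
  let ?U = "cmap c ` cdom c" and ?y = "cmap c p" and ?f = "in_chart c \<rho>"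
  define J where "J = {j \<in> cfaces c. ?y $ j = 0}"
  have y: "?y \<in> ?U" using p by blast
  have smooth: "smooth_on ?U ?f" using bdf c unfolding boundary_defining_def smooth_function_def by blast
  define D where "D = frechet_derivative ?f (at ?y within ?U)"
  have D: "(?f has_derivative D) (at ?y within ?U)"
    unfolding D_def using smooth_on_has_derivative[OF smooth y] frechet_derivative_works by blast
  have lin: "linear D" using D by (rule has_derivative_linear)
  have D0: "D \<noteq> (\<lambda>v. 0)"
    using bdf p c unfolding boundary_defining_def differential_in_def D_def by blast
  have f0: "?f ?y = 0"
    using bdf p unfolding boundary_defining_def in_chart_def comp_def chart_inv_cmap[OF chart p(2)] by blast
  have f_nonneg: "0 \<le> ?f x" if "x \<in> ?U" for x
    using bdf cmap_chart_inv[OF that] cdom_subset[OF chart]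
    unfolding boundary_defining_def in_chart_def comp_def by blast
  have lim: "((\<lambda>s. ?f (?y + s *\<^sub>R w) / s) \<longlongrightarrow> D w) (at_right 0) \<and> 0 \<le> D w"
    if w: "\<And>j. j \<in> J \<Longrightarrow> 0 \<le> w $ j" for w
  proof -
    obtain s0 where s0: "0 < s0" "\<And>s. 0 \<le> s \<Longrightarrow> s \<le> s0 \<Longrightarrow> ?y + s *\<^sub>R w \<in> ?U"
      using chart_image_segment[OF chart y, of w] w unfolding J_def by blast
    have l: "((\<lambda>s. ?f (?y + s *\<^sub>R w) / s) \<longlongrightarrow> D w) (at_right 0)"
      by (rule directional_derivative_limit[OF D f0 s0])
    have "\<forall>\<^sub>F s in at_right 0. 0 \<le> ?f (?y + s *\<^sub>R w) / s"
      unfolding eventually_at_right_field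
      using s0 f_nonneg by (intro exI[of _ s0]) (simp add: less_imp_le)
    with l have "0 \<le> D w" by (intro tendsto_lowerbound) auto
    with l show ?thesis by blast
  qed
  have Dneg: "D (- x) = - D x" for x using linear_neg[OF lin] .
  have tangent: "D (axis j 1) = 0" if "j \<notin> J" for j
  proof -
    have "0 \<le> D (axis j 1)" by (rule lim[THEN conjunct2]) (simp add: axis_def)
    moreover have "0 \<le> D (- axis j 1)"
      by (rule lim[THEN conjunct2]) (use that in \<open>auto simp: axis_def\<close>)
    ultimately show ?thesis unfolding Dneg by simp
  qed
  \<comment> \<open>A nonzero differential is nonzero on some coordinate vector, and by
    \<open>tangent\<close> this vector is transversal to a face through \<open>p\<close>.\<close>
  have "\<exists>l. D (axis l 1) \<noteq> 0"
  proof (rule ccontr)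
    assume "\<nexists>l. D (axis l 1) \<noteq> 0"
    then have "D b = 0" if "b \<in> Basis" for b using that unfolding Basis_vec_def by auto
    then have "D = (\<lambda>v. 0)" by (intro linear_eq_stdbasis[OF lin]) (auto simp: linear_zero)
    with D0 show False by blast
  qed
  then obtain l where l: "D (axis l 1) \<noteq> 0" by blast
  then have "l \<in> J" using tangent by blast
  have "0 \<le> D (axis l 1)" by (rule lim[THEN conjunct2]) (simp add: axis_def)
  with l have Dl: "0 < D (axis l 1)" by linarith
  \<comment> \<open>Removing one transversal vector leaves an inward direction, on which
    \<open>D\<close> is still nonnegative; so \<open>D\<close> is at least as large on
    \<open>inward c p\<close> as on \<open>axis l 1\<close>.\<close>
  let ?w = "inward c p - axis l 1"
  have "0 \<le> D ?w"
    by (rule lim[THEN conjunct2]) (use \<open>l \<in> J\<close> in \<open>auto simp: inward_def axis_def J_def\<close>)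
  then have Dv: "0 < D (inward c p)" using Dl by (simp add: linear_diff[OF lin])
  have "inward c p \<noteq> 0" using Dv linear_0[OF lin] by auto
  moreover have "\<forall>\<^sub>F s in at_right 0. D (inward c p) / 2 * s \<le> \<rho> (chart_inv c (?y + s *\<^sub>R inward c p))"
  proof -
    have "((\<lambda>s. ?f (?y + s *\<^sub>R inward c p) / s) \<longlongrightarrow> D (inward c p)) (at_right 0)"
      using lim[of "inward c p"] by (simp add: inward_def)
    then have "\<forall>\<^sub>F s in at_right 0. D (inward c p) / 2 < ?f (?y + s *\<^sub>R inward c p) / s"
      using Dv by (intro order_tendstoD(1)) auto
    moreover have "\<forall>\<^sub>F s::real in at_right 0. 0 < s" by (rule eventually_at_right_less)
    ultimately show ?thesis
      by eventually_elim (simp add: in_chart_def field_simps)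
  qed
  ultimately show thesis using that[of "D (inward c p) / 2"] Dv by simp
qed

text \<open>At a zero of \<rho> the growth lemma yields \<open>inward c q \<noteq> 0\<close>,
  whereas at an interior point no constrained coordinate vanishes and this vector is zero.\<close>

lemma boundary_defining_pos_minterior:
  assumes A: "smooth_atlas X A" and bdf: "boundary_defining X A H \<rho>" and q: "q \<in> minterior X A"
  shows "0 < \<rho> q"
proof (rule ccontr)
  have qX: "q \<in> topspace X" using q unfolding minterior_def by blast
  assume "\<not> 0 < \<rho> q"
  then have qH: "q \<in> H" using bdf qX unfolding boundary_defining_def by blast
  obtain c where c: "c \<in> A" "q \<in> cdom c" using A qX unfolding smooth_atlas_def by blast
  have "is_corner_chart X c" using A c unfolding smooth_atlas_def by blast
  then have "inward c q \<noteq> 0"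
    by (rule boundary_defining_linear_growth[OF _ c(1) bdf qH c(2)])
  moreover have "inward c q = 0"
    using q c unfolding mem_minterior_iff inward_def by (auto simp: vec_eq_iff)
  ultimately show False by blast
qed

locale face_point =
  fixes X :: "'a topology"
    and A :: "('a, 'n::finite) corner_chart set"
    and g\<^sub>0 :: "('a, 'n) two_tensor"
    and N :: nat and H :: "nat \<Rightarrow> 'a set" and \<rho> :: "nat \<Rightarrow> 'a \<Rightarrow> real" and \<alpha> :: "nat \<Rightarrow> real"
    and I :: "nat set" and p :: 'a and c :: "('a, 'n) corner_chart"
  assumes atlas: "smooth_atlas X A" and hausdorff: "Hausdorff_space X"
    and bdf: "\<And>i. i \<in> {1..N} \<Longrightarrow> boundary_defining X A (H i) (\<rho> i)"
    and metric: "riemannian_metric A g\<^sub>0"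
    and \<alpha>_nonneg: "\<And>i. i \<in> {1..N} \<Longrightarrow> 0 \<le> \<alpha> i"
    and p_face: "p \<in> open_face X N H I" and I_ne: "I \<noteq> {}"
    and p_boundary: "p \<in> mboundary A"
    and c: "c \<in> A" "p \<in> cdom c"
begin

abbreviation "g \<equiv> product_metric N \<rho> \<alpha> g\<^sub>0"
abbreviation "y\<^sub>0 \<equiv> cmap c p"
abbreviation "\<sigma> s \<equiv> chart_inv c (y\<^sub>0 + s *\<^sub>R inward c p)"
abbreviation "a\<^sub>I \<equiv> sum \<alpha> I"

lemma chart: "is_corner_chart X c"
  using atlas c unfolding smooth_atlas_def by blast

lemma y0: "y\<^sub>0 \<in> cmap c ` cdom c" using c by blast

lemma I_sub: "I \<subseteq> {1..N}" using p_face unfolding open_face_def active_set_def by blast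

lemma finite_I: "finite I" using I_sub finite_subset by blast

lemma p_in_H: "i \<in> I \<Longrightarrow> p \<in> H i"
  using p_face unfolding open_face_def active_set_def by blast

lemma \<rho>_p_zero: "i \<in> I \<Longrightarrow> \<rho> i p = 0"
  using p_in_H bdf I_sub unfolding boundary_defining_def by blast

lemma \<rho>_p_pos: "i \<in> {1..N} - I \<Longrightarrow> 0 < \<rho> i p"
  using p_face bdf unfolding open_face_def active_set_def boundary_defining_def by blast

lemma \<rho>_pos: "i \<in> {1..N} \<Longrightarrow> q \<in> minterior X A \<Longrightarrow> 0 < \<rho> i q"
  using boundary_defining_pos_minterior[OF atlas bdf] .

lemma \<rho>_smooth: "i \<in> {1..N} \<Longrightarrow> smooth_on (cmap c ` cdom c) (in_chart c (\<rho> i))"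
  using bdf c unfolding boundary_defining_def smooth_function_def by blast

lemma g0_smooth: "smooth_on (cmap c ` cdom c) (in_chart c (\<lambda>q. g\<^sub>0 c q v w))"
  using metric c unfolding riemannian_metric_def by blast

text \<open>The transformation law survives multiplication by an arbitrary function. It therefore
  holds at boundary points too, although the product metric degenerates there because
  \<open>0 powr _ = 0\<close>.\<close>

lemma tensorial_g: "tensorial A g"
proof -
  have "tensorial A g\<^sub>0" using metric unfolding riemannian_metric_def tensorial_def by (elim conjE)
  then show ?thesis
    unfolding tensorial_def product_metric_def by (intro ballI allI arg_cong[where f = "(*) _"]) blast
qed

lemma g0_bilinear: "q \<in> cdom c \<Longrightarrow> bilinear (g\<^sub>0 c q)"
  using metric c unfolding riemannian_metric_def by blast

lemma g_scale: "q \<in> cdom c \<Longrightarrow> g c q (r *\<^sub>R v) (r *\<^sub>R v) = r\<^sup>2 * g c q v v"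
  using bilinear_lmul[OF g0_bilinear] bilinear_rmul[OF g0_bilinear]
  unfolding product_metric_def by (simp add: power2_eq_square)

lemma segment:
  obtains s0 where "0 < s0" "\<And>s. 0 \<le> s \<Longrightarrow> s \<le> s0 \<Longrightarrow> y\<^sub>0 + s *\<^sub>R inward c p \<in> cmap c ` cdom c"
  using chart_image_segment[OF chart y0, of "inward c p"] by (auto simp: inward_def)

lemma segment_pos: "0 < s \<Longrightarrow> j \<in> cfaces c \<Longrightarrow> 0 < (y\<^sub>0 + s *\<^sub>R inward c p) $ j"
  using chart_image_nonneg[OF chart c(2), of j] by (auto simp: inward_def order_less_le)

lemma tendsto_along_segment:
  assumes "smooth_on (cmap c ` cdom c) (in_chart c f)"
  shows "((\<lambda>s. f (\<sigma> s)) \<longlongrightarrow> f p) (at_right 0)"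
proof -
  obtain s0 where s0: "0 < s0" "\<And>s. 0 \<le> s \<Longrightarrow> s \<le> s0 \<Longrightarrow> y\<^sub>0 + s *\<^sub>R inward c p \<in> cmap c ` cdom c"
    by (fact segment)
  have "continuous_on {0..s0} (\<lambda>s. in_chart c f (y\<^sub>0 + s *\<^sub>R inward c p))"
    using s0(2) by (intro continuous_on_compose2[OF smooth_on_imp_continuous_on[OF assms]] continuous_intros) auto
  from this[unfolded continuous_on_def, rule_format, of 0] s0(1)
  have "((\<lambda>s. in_chart c f (y\<^sub>0 + s *\<^sub>R inward c p)) \<longlongrightarrow> in_chart c f (y\<^sub>0 + 0 *\<^sub>R inward c p)) (at 0 within {0..s0})"
    by simp
  then show ?thesis
    unfolding at_within_Icc_at_right[OF s0(1)] in_chart_def by (simp add: chart_inv_cmap[OF chart c(2)])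
qed

lemma metric_growth:
  obtains C where "0 \<le> C" "\<forall>\<^sub>F s in at_right 0. g c (\<sigma> s) (inward c p) (inward c p) \<le> C * s powr (- a\<^sub>I)"
proof -
  let ?v = "inward c p"
  \<comment> \<open>Factors with inactive index stay bounded and get exponent 0, so the exponents
    over all indices add up to \<open>- a\<^sub>I\<close>.\<close>
  define \<beta> where "\<beta> i = (if i \<in> I then \<alpha> i else 0)" for i
  have pos: "\<forall>\<^sub>F s::real in at_right 0. 0 < s" by (rule eventually_at_right_less)
  have "\<exists>C\<ge>0. \<forall>\<^sub>F s in at_right 0. \<rho> i (\<sigma> s) powr (- \<alpha> i) \<le> C * s powr (- \<beta> i)"
    if i: "i \<in> {1..N}" for i
  proof (cases "i \<in> I")
    case True
    obtain k where k: "0 < k" "\<forall>\<^sub>F s in at_right 0. k * s \<le> \<rho> i (\<sigma> s)"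
      by (rule boundary_defining_linear_growth[OF chart c(1) bdf[OF i] p_in_H[OF True] c(2)])
    have "\<forall>\<^sub>F s in at_right 0. \<rho> i (\<sigma> s) powr (- \<alpha> i) \<le> k powr (- \<alpha> i) * s powr (- \<beta> i)"
      using k(2) pos
    proof eventually_elim
      case (elim s)
      then have "\<rho> i (\<sigma> s) powr (- \<alpha> i) \<le> (k * s) powr (- \<alpha> i)"
        using k(1) \<alpha>_nonneg[OF i] by (intro powr_mono2') auto
      then show ?case using elim k(1) True by (simp add: powr_mult \<beta>_def)
    qed
    then show ?thesis by (intro exI[of _ "k powr (- \<alpha> i)"]) auto
  next
    case False
    then have "0 < \<rho> i p" using \<rho>_p_pos i by blast
    then have "\<forall>\<^sub>F s in at_right 0. \<rho> i p / 2 < \<rho> i (\<sigma> s)"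
      by (intro order_tendstoD(1)[OF tendsto_along_segment[OF \<rho>_smooth[OF i]]]) auto
    with pos have "\<forall>\<^sub>F s in at_right 0. \<rho> i (\<sigma> s) powr (- \<alpha> i) \<le> (\<rho> i p / 2) powr (- \<alpha> i) * s powr (- \<beta> i)"
    proof eventually_elim
      case (elim s)
      then have "\<rho> i (\<sigma> s) powr (- \<alpha> i) \<le> (\<rho> i p / 2) powr (- \<alpha> i)"
        using \<open>0 < \<rho> i p\<close> \<alpha>_nonneg[OF i] by (intro powr_mono2') auto
      then show ?case using elim False by (simp add: \<beta>_def)
    qed
    then show ?thesis by (intro exI[of _ "(\<rho> i p / 2) powr (- \<alpha> i)"]) auto
  qed
  then have "\<forall>i\<in>{1..N}. \<exists>C. 0 \<le> C \<and> (\<forall>\<^sub>F s in at_right 0. \<rho> i (\<sigma> s) powr (- \<alpha> i) \<le> C * s powr (- \<beta> i))"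
    by blast
  from bchoice[OF this] obtain C where C: "\<And>i. i \<in> {1..N} \<Longrightarrow> 0 \<le> C i"
    "\<And>i. i \<in> {1..N} \<Longrightarrow> \<forall>\<^sub>F s in at_right 0. \<rho> i (\<sigma> s) powr (- \<alpha> i) \<le> C i * s powr (- \<beta> i)"
    by blast
  \<comment> \<open>The absolute value makes \<open>K\<close> nonnegative, as needed for multiplying
    the two bounds.\<close>
  define K where "K = \<bar>g\<^sub>0 c p ?v ?v\<bar> + 1"
  have "\<forall>\<^sub>F s in at_right 0. \<forall>i\<in>{1..N}. \<rho> i (\<sigma> s) powr (- \<alpha> i) \<le> C i * s powr (- \<beta> i)"
    using C(2) by (intro eventually_ball_finite) auto
  moreover have "\<forall>\<^sub>F s in at_right 0. g\<^sub>0 c (\<sigma> s) ?v ?v < g\<^sub>0 c p ?v ?v + 1"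
    by (intro order_tendstoD(2)[OF tendsto_along_segment[OF g0_smooth]]) auto
  ultimately have "\<forall>\<^sub>F s in at_right 0. g c (\<sigma> s) ?v ?v \<le> (\<Prod>i=1..N. C i) * K * s powr (- a\<^sub>I)"
    using pos
  proof eventually_elim
    case (elim s)
    have "(\<Prod>i=1..N. s powr (- \<beta> i)) = s powr (- (\<Sum>i=1..N. \<beta> i))"
      using elim by (simp add: powr_sum sum_negf[symmetric])
    also have "(\<Sum>i=1..N. \<beta> i) = a\<^sub>I"
      unfolding \<beta>_def using I_sub by (simp add: sum.If_cases Int_absorb1)
    finally have "(\<Prod>i=1..N. C i * s powr (- \<beta> i)) = (\<Prod>i=1..N. C i) * s powr (- a\<^sub>I)"
      by (simp add: prod.distrib)
    moreover have "(\<Prod>i=1..N. \<rho> i (\<sigma> s) powr (- \<alpha> i)) \<le> (\<Prod>i=1..N. C i * s powr (- \<beta> i))"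
      using elim by (intro prod_mono) auto
    ultimately have "(\<Prod>i=1..N. \<rho> i (\<sigma> s) powr (- \<alpha> i)) \<le> (\<Prod>i=1..N. C i) * s powr (- a\<^sub>I)" by simp
    moreover have "g\<^sub>0 c (\<sigma> s) ?v ?v \<le> K" using elim unfolding K_def by linarith
    ultimately have "g c (\<sigma> s) ?v ?v \<le> (\<Prod>i=1..N. \<rho> i (\<sigma> s) powr (- \<alpha> i)) * K"
      unfolding product_metric_def by (intro mult_left_mono prod_nonneg) auto
    also have "\<dots> \<le> (\<Prod>i=1..N. C i) * s powr (- a\<^sub>I) * K"
      using \<open>_ \<le> (\<Prod>i=1..N. C i) * s powr (- a\<^sub>I)\<close> by (intro mult_right_mono) (auto simp: K_def)
    finally show ?case by (simp add: mult_ac)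
  qed
  moreover have "0 \<le> (\<Prod>i=1..N. C i) * K" using C(1) by (intro mult_nonneg_nonneg prod_nonneg) (auto simp: K_def)
  ultimately show thesis by (intro that)
qed

end

section \<open>Finite length of inward segments below the threshold\<close>

lemma has_integral_powr_along_segment:
  fixes a b \<theta> :: real
  assumes ab: "0 \<le> a" "0 \<le> b" "a \<noteq> b" and \<theta>: "0 < \<theta>"
  shows "((\<lambda>t. \<bar>b - a\<bar> * (a + t * (b - a)) powr (\<theta> - 1)) has_integral
           sgn (b - a) * (b powr \<theta> - a powr \<theta>) / \<theta>) {0..1}"
proof -
  \<comment> \<open>A primitive that stays continuous where the parameter reaches 0, since \<theta>
    is positive, although the integrand may be unbounded there; differentiating it in the open
    interval is then enough. The sign covers both directions of travel.\<close>
  define G where "G t = sgn (b - a) / \<theta> * (a + t * (b - a)) powr \<theta>" for t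
  have nonneg: "0 \<le> a + t * (b - a)" if "t \<in> {0..1}" for t
  proof -
    have "0 \<le> (1 - t) * a + t * b" using that ab by (intro add_nonneg_nonneg mult_nonneg_nonneg) auto
    then show ?thesis by (simp add: algebra_simps)
  qed
  have pos: "0 < a + t * (b - a)" if "t \<in> {0<..<1}" for t
  proof -
    have "0 \<le> (1 - t) * a" "0 \<le> t * b" using that ab by auto
    moreover have "0 < (1 - t) * a \<or> 0 < t * b" using that ab by (cases "b = 0") auto
    ultimately have "0 < (1 - t) * a + t * b" by linarith
    then show ?thesis by (simp add: algebra_simps)
  qed
  have "((\<lambda>t. \<bar>b - a\<bar> * (a + t * (b - a)) powr (\<theta> - 1)) has_integral G 1 - G 0) {0..1}"
  proof (rule fundamental_theorem_of_calculus_interior)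
    show "continuous_on {0..1} G"
      unfolding G_def
    proof (rule continuous_on_mult_left, rule continuous_on_powr')
      show "continuous_on {0..1} (\<lambda>t. a + t * (b - a))" by (intro continuous_intros)
      show "\<forall>t\<in>{0..1}. 0 \<le> a + t * (b - a) \<and> (a + t * (b - a) = 0 \<longrightarrow> 0 < \<theta>)"
        using nonneg \<theta> by blast
    qed (rule continuous_on_const)
    fix t :: real assume t: "t \<in> {0<..<1}"
    have "((\<lambda>t. (a + t * (b - a)) powr \<theta>) has_real_derivative \<theta> * (a + t * (b - a)) powr (\<theta> - 1) * (b - a)) (at t)"
      using pos[OF t] by (auto intro!: derivative_eq_intros simp: powr_diff)
    then have "(G has_real_derivative sgn (b - a) / \<theta> * (\<theta> * (a + t * (b - a)) powr (\<theta> - 1) * (b - a))) (at t)"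
      unfolding G_def by (rule DERIV_cmult)
    moreover have "sgn (b - a) / \<theta> * (\<theta> * (a + t * (b - a)) powr (\<theta> - 1) * (b - a)) =
        \<bar>b - a\<bar> * (a + t * (b - a)) powr (\<theta> - 1)"
      using \<theta> by (simp add: abs_sgn[of "b - a"] mult_ac)
    ultimately show "(G has_vector_derivative \<bar>b - a\<bar> * (a + t * (b - a)) powr (\<theta> - 1)) (at t)"
      by (simp add: has_real_derivative_iff_has_vector_derivative)
  qed simp
  moreover have "G 1 - G 0 = sgn (b - a) * (b powr \<theta> - a powr \<theta>) / \<theta>"
    unfolding G_def by (simp add: algebra_simps diff_divide_distrib)
  ultimately show ?thesis by simp
qed

context face_point
begin

text \<open>One estimate for two uses: \<open>T = {0..<1}\<close> with \<open>b = 0\<close> gives a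
  curve ending at \<open>p\<close>, and \<open>T = {0..1}\<close> with positive \<open>a\<close>,
  \<open>b\<close> bounds the distance between two points of the segment. The sum of powers replaces
  their difference to obtain a bound symmetric in \<open>a\<close> and \<open>b\<close>.\<close>

lemma segment_length:
  assumes A2: "a\<^sub>I < 2"
  obtains s0 K \<theta> where "0 < s0" "0 \<le> K" "0 < \<theta>"
    "\<And>s. 0 \<le> s \<Longrightarrow> s \<le> s0 \<Longrightarrow> y\<^sub>0 + s *\<^sub>R inward c p \<in> cmap c ` cdom c"
    "\<And>a b T. 0 \<le> a \<Longrightarrow> 0 \<le> b \<Longrightarrow> T \<subseteq> {0..1} \<Longrightarrow>
       (\<And>t. t \<in> T \<Longrightarrow> 0 < a + t * (b - a) \<and> a + t * (b - a) \<le> s0 \<and> at t within T \<noteq> bot) \<Longrightarrow>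
       ac_curve X A T (\<lambda>t. \<sigma> (a + t * (b - a))) \<and>
       curve_length A g T (\<lambda>t. \<sigma> (a + t * (b - a))) \<le> ennreal (K * (a powr \<theta> + b powr \<theta>))"
proof -
  let ?v = "inward c p"
  obtain s1 where s1: "0 < s1" "\<And>s. 0 \<le> s \<Longrightarrow> s \<le> s1 \<Longrightarrow> y\<^sub>0 + s *\<^sub>R ?v \<in> cmap c ` cdom c"
    by (fact segment)
  obtain C where C: "0 \<le> C" "\<forall>\<^sub>F s in at_right 0. g c (\<sigma> s) ?v ?v \<le> C * s powr (- a\<^sub>I)"
    by (fact metric_growth)
  obtain s2 where s2: "0 < s2" "\<And>s. 0 < s \<Longrightarrow> s < s2 \<Longrightarrow> g c (\<sigma> s) ?v ?v \<le> C * s powr (- a\<^sub>I)"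
    using C(2) unfolding eventually_at_right_field by auto
  define s0 where "s0 = min s1 (s2 / 2)"
  \<comment> \<open>\<open>\<theta> - 1 = - a\<^sub>I / 2\<close> is the exponent of the speed after
    the square root, and \<theta> is positive exactly below the threshold.\<close>
  define \<theta> where "\<theta> = 1 - a\<^sub>I / 2"
  define K where "K = sqrt C / \<theta>"
  have \<theta>: "0 < \<theta>" using A2 unfolding \<theta>_def by simp
  have K: "0 \<le> K" unfolding K_def using C(1) \<theta> by simp
  have "ac_curve X A T (\<lambda>t. \<sigma> (a + t * (b - a))) \<and>
       curve_length A g T (\<lambda>t. \<sigma> (a + t * (b - a))) \<le> ennreal (K * (a powr \<theta> + b powr \<theta>))"
    if ab: "0 \<le> a" "0 \<le> b" and T: "T \<subseteq> {0..1}"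
      and l: "\<And>t. t \<in> T \<Longrightarrow> 0 < a + t * (b - a) \<and> a + t * (b - a) \<le> s0 \<and> at t within T \<noteq> bot" for a b T
  proof -
    let ?\<gamma> = "\<lambda>t. \<sigma> (a + t * (b - a))"
    let ?y = "y\<^sub>0 + a *\<^sub>R ?v" and ?w = "(b - a) *\<^sub>R ?v"
    have line: "?y + t *\<^sub>R ?w = y\<^sub>0 + (a + t * (b - a)) *\<^sub>R ?v" for t
      by (simp add: algebra_simps)
    have in_U: "?y + t *\<^sub>R ?w \<in> cmap c ` cdom c" if "t \<in> T" for t
      unfolding line using l[OF that] by (intro s1(2)) (auto simp: s0_def)
    have pos: "0 < (?y + t *\<^sub>R ?w) $ j" if "t \<in> T" "j \<in> cfaces c" for t j
      unfolding line using l[OF that(1)] that(2) by (intro segment_pos) auto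
    have \<gamma>: "?\<gamma> = (\<lambda>t. chart_inv c (?y + t *\<^sub>R ?w))" unfolding line ..
    have ac: "ac_curve X A T ?\<gamma>" by (rule coordinate_line(1)[OF atlas c(1) in_U pos \<gamma>])
    define F where "F t = sqrt C * (\<bar>b - a\<bar> * (a + t * (b - a)) powr (\<theta> - 1))" for t
    have "speed A g T ?\<gamma> t \<le> F t" if t: "t \<in> T" for t
    proof -
      let ?s = "a + t * (b - a)"
      have s: "0 < ?s" "?s < s2" using l[OF t] s2(1) unfolding s0_def by auto
      have "speed A g T ?\<gamma> t = sqrt (g c (?\<gamma> t) ?w ?w)"
        using l[OF t] by (intro coordinate_line(2)[OF atlas c(1) in_U pos \<gamma> tensorial_g t]) auto
      also have "g c (?\<gamma> t) ?w ?w = (b - a)\<^sup>2 * g c (?\<gamma> t) ?v ?v"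
        using cmap_chart_inv[OF in_U[OF t]] unfolding line by (intro g_scale) auto
      also have "sqrt \<dots> \<le> sqrt ((b - a)\<^sup>2 * (C * ?s powr (- a\<^sub>I)))"
        using s2(2)[OF s] by (intro real_sqrt_le_mono mult_left_mono) auto
      also have "\<dots> = \<bar>b - a\<bar> * (sqrt C * sqrt (?s powr (- a\<^sub>I)))"
        by (simp add: real_sqrt_mult)
      also have "sqrt (?s powr (- a\<^sub>I)) = ?s powr (\<theta> - 1)"
        using s(1) unfolding \<theta>_def by (simp add: powr_half_sqrt[symmetric] powr_powr)
      finally show ?thesis unfolding F_def by (simp add: mult_ac)
    qed
    then have "curve_length A g T ?\<gamma> \<le> (\<integral>\<^sup>+t. ennreal (F t) * indicator {0..1} t \<partial>lborel)"
      unfolding curve_length_def using T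
      by (intro nn_integral_mono) (auto simp: indicator_def intro!: ennreal_leI)
    also have "\<dots> \<le> ennreal (K * (a powr \<theta> + b powr \<theta>))"
    \<comment> \<open>For \<open>a = b\<close> the curve is constant and \<open>F\<close> vanishes;
      the integral formula requires distinct endpoints.\<close>
    proof (cases "a = b")
      case True
      then show ?thesis unfolding F_def by simp
    next
      case False
      have int: "(F has_integral sqrt C * (sgn (b - a) * (b powr \<theta> - a powr \<theta>) / \<theta>)) {0..1}"
        unfolding F_def by (intro has_integral_mult_right has_integral_powr_along_segment ab False \<theta>)
      have "(\<integral>\<^sup>+t. ennreal (F t) * indicator {0..1} t \<partial>lborel) =
          ennreal (sqrt C * (sgn (b - a) * (b powr \<theta> - a powr \<theta>) / \<theta>))"
        using C(1) by (intro nn_integral_has_integral_lebesgue'[OF _ int]) (simp add: F_def)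
      also have "\<dots> = ennreal (K * (sgn (b - a) * (b powr \<theta> - a powr \<theta>)))"
        unfolding K_def by simp
      also have "\<dots> \<le> ennreal (K * (a powr \<theta> + b powr \<theta>))"
        using K by (intro ennreal_leI mult_left_mono) (auto simp: sgn_if)
      finally show ?thesis .
    qed
    finally show ?thesis using ac by blast
  qed
  moreover have "0 < s0" unfolding s0_def using s1 s2 by simp
  moreover have "y\<^sub>0 + s *\<^sub>R ?v \<in> cmap c ` cdom c" if "0 \<le> s" "s \<le> s0" for s
    using s1(2)[of s] that unfolding s0_def by simp
  ultimately show thesis using that[OF _ K \<theta>, of s0] by blast
qed

lemma \<sigma>_tendsto:
  assumes "openin X U" "p \<in> U"
  shows "\<forall>\<^sub>F s in at_right 0. \<sigma> s \<in> U"
proof -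
  obtain s0 where s0: "0 < s0" "\<And>s. 0 \<le> s \<Longrightarrow> s \<le> s0 \<Longrightarrow> y\<^sub>0 + s *\<^sub>R inward c p \<in> cmap c ` cdom c"
    by (fact segment)
  have "continuous_map (top_of_set {0..s0}) (top_of_set (cmap c ` cdom c)) (\<lambda>s. y\<^sub>0 + s *\<^sub>R inward c p)"
    using s0(2) by (auto simp: continuous_map_in_subtopology intro!: continuous_intros)
  then have "continuous_map (top_of_set {0..s0}) X \<sigma>"
    using continuous_map_compose[OF _ continuous_map_chart_inv[OF chart]] unfolding comp_def by blast
  from eventually_in_openin[OF this assms(1), of 0] show ?thesis
    using s0(1) assms(2) chart_inv_cmap[OF chart c(2)] at_within_Icc_at_right[OF s0(1)] by simp
qed

lemma p_in_X: "p \<in> topspace X"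
  using cdom_subset[OF chart] c(2) by blast

lemma finite_length_approachable_if:
  assumes "a\<^sub>I < 2" shows "finite_length_approachable X A g p"
proof -
  obtain s0 K \<theta> where s0: "0 < s0" and len: "\<And>a b T. 0 \<le> a \<Longrightarrow> 0 \<le> b \<Longrightarrow> T \<subseteq> {0..1} \<Longrightarrow>
       (\<And>t. t \<in> T \<Longrightarrow> 0 < a + t * (b - a) \<and> a + t * (b - a) \<le> s0 \<and> at t within T \<noteq> bot) \<Longrightarrow>
       ac_curve X A T (\<lambda>t. \<sigma> (a + t * (b - a))) \<and>
       curve_length A g T (\<lambda>t. \<sigma> (a + t * (b - a))) \<le> ennreal (K * (a powr \<theta> + b powr \<theta>))"
    by (rule segment_length[OF assms]) blast
  \<comment> \<open>Written with \<open>0 - s0\<close> to match the shape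
    \<open>a + t * (b - a)\<close> with \<open>a = s0\<close> and \<open>b = 0\<close>.\<close>
  let ?\<gamma> = "\<lambda>t. \<sigma> (s0 + t * (0 - s0))"
  have "at t within {0..<1} \<noteq> bot" if "t \<in> {0..<1::real}" for t
    using that by (simp add: trivial_limit_within islimpt_Ico)
  moreover have "t * s0 < s0" if "t < 1" for t using that s0 by simp
  ultimately have "ac_curve X A {0..<1} ?\<gamma> \<and>
      curve_length A g {0..<1} ?\<gamma> \<le> ennreal (K * (s0 powr \<theta> + 0 powr \<theta>))"
    using s0 by (intro len) auto
  moreover have "limitin X ?\<gamma> p (at_left 1)"
    unfolding limitin_def
  proof (intro conjI allI impI p_in_X)
    fix U assume "openin X U \<and> p \<in> U"
    then have "\<forall>\<^sub>F s in at_right 0. \<sigma> s \<in> U" using \<sigma>_tendsto by blast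
    moreover have "filterlim (\<lambda>t. s0 + t * (0 - s0)) (at_right 0) (at_left 1)"
      unfolding filterlim_at
    proof
      have "((\<lambda>t. s0 + t * (0 - s0)) \<longlongrightarrow> s0 + 1 * (0 - s0)) (at_left 1)" by (intro tendsto_intros)
      then show "((\<lambda>t. s0 + t * (0 - s0)) \<longlongrightarrow> 0) (at_left 1)" by simp
      have "\<forall>\<^sub>F t::real in at_left 1. t < 1" by (simp add: eventually_at_filter)
      then show "\<forall>\<^sub>F t in at_left 1. s0 + t * (0 - s0) \<in> {0<..} \<and> s0 + t * (0 - s0) \<noteq> 0"
        by eventually_elim (use s0 in auto)
    qed
    ultimately show "\<forall>\<^sub>F t in at_left 1. ?\<gamma> t \<in> U" by (rule eventually_compose_filterlim)
  qed
  ultimately show ?thesis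
    unfolding finite_length_approachable_def using p_boundary
    by (intro conjI exI[of _ ?\<gamma>]) (auto simp: order_le_less_trans[OF _ ennreal_less_top])
qed

lemma accessible_if:
  assumes "a\<^sub>I < 2" shows "accessible X A g p"
proof -
  obtain s0 K \<theta> where s0: "0 < s0" and K: "0 \<le> K" and \<theta>: "0 < \<theta>"
    and len: "\<And>a b T. 0 \<le> a \<Longrightarrow> 0 \<le> b \<Longrightarrow> T \<subseteq> {0..1} \<Longrightarrow>
       (\<And>t. t \<in> T \<Longrightarrow> 0 < a + t * (b - a) \<and> a + t * (b - a) \<le> s0 \<and> at t within T \<noteq> bot) \<Longrightarrow>
       ac_curve X A T (\<lambda>t. \<sigma> (a + t * (b - a))) \<and>
       curve_length A g T (\<lambda>t. \<sigma> (a + t * (b - a))) \<le> ennreal (K * (a powr \<theta> + b powr \<theta>))"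
    by (rule segment_length[OF assms]) blast
  define r where "r n = s0 / real (Suc n)" for n
  have r: "0 < r n" "r n \<le> s0" for n using s0 unfolding r_def by (auto simp: field_simps)
  have r_lim: "r \<longlonglongrightarrow> 0"
    unfolding r_def using LIMSEQ_Suc[OF lim_const_over_n[of s0]] by simp
  define P where "P n = \<sigma> (r n)" for n
  have curve: "ac_curve X A {0..1} (\<lambda>t. \<sigma> (a + t * (b - a))) \<and>
      curve_length A g {0..1} (\<lambda>t. \<sigma> (a + t * (b - a))) \<le> ennreal (K * (a powr \<theta> + b powr \<theta>))"
    if ab: "0 < a" "a \<le> s0" "0 < b" "b \<le> s0" for a b
  proof (rule len)
    fix t :: real assume t: "t \<in> {0..1}"
    have "0 < (1 - t) * a + t * b"
      using t ab by (cases "t = 1") (auto intro: add_pos_nonneg)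
    moreover have "(1 - t) * a + t * b \<le> (1 - t) * s0 + t * s0"
      using t ab by (intro add_mono mult_left_mono) auto
    moreover have "at t within {0..1} \<noteq> bot" using t by (simp add: trivial_limit_within islimpt_Icc)
    ultimately show "0 < a + t * (b - a) \<and> a + t * (b - a) \<le> s0 \<and> at t within {0..1} \<noteq> bot"
      by (simp add: algebra_simps)
  qed (use ab in auto)
  have dist: "riemannian_dist X A g (P m) (P n) \<le> ennreal (K * (r m powr \<theta> + r n powr \<theta>))" for m n
  proof -
    note cv = curve[OF r(1)[of m] r(2)[of m] r(1)[of n] r(2)[of n]]
    have "riemannian_dist X A g (P m) (P n) \<le> curve_length A g {0..1} (\<lambda>t. \<sigma> (r m + t * (r n - r m)))"
      unfolding riemannian_dist_def by (intro INF_lower) (use cv in \<open>auto simp: P_def\<close>)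
    with cv show ?thesis using order_trans by blast
  qed
  have int: "P n \<in> minterior X A" for n
  proof -
    \<comment> \<open>A constant curve, from which it is read off that its single point is
      interior.\<close>
    have "(\<lambda>t. \<sigma> (r n + t * (r n - r n))) ` {0..1} \<subseteq> minterior X A"
      using curve[OF r(1)[of n] r(2)[of n] r(1)[of n] r(2)[of n]] unfolding ac_curve_def by blast
    then have "\<sigma> (r n + 0 * (r n - r n)) \<in> minterior X A" by (rule subsetD) (rule imageI, simp)
    then show ?thesis unfolding P_def by simp
  qed
  have "\<exists>M. \<forall>m\<ge>M. \<forall>n\<ge>M. riemannian_dist X A g (P m) (P n) < ennreal \<epsilon>" if \<epsilon>: "0 < \<epsilon>" for \<epsilon>
  proof -
    \<comment> \<open>Positivity of \<theta> is what makes these powers tend to 0, hence the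
      sequence Cauchy.\<close>
    have "(\<lambda>n. K * (r n powr \<theta>)) \<longlonglongrightarrow> K * 0 powr \<theta>"
      using r(1) \<theta> by (intro tendsto_intros tendsto_powr2 r_lim) (auto intro!: always_eventually less_imp_le)
    then have "\<forall>\<^sub>F n in sequentially. K * (r n powr \<theta>) < \<epsilon> / 2"
      using \<epsilon> by (intro order_tendstoD(2)) auto
    then obtain M where M: "\<And>n. n \<ge> M \<Longrightarrow> K * (r n powr \<theta>) < \<epsilon> / 2"
      unfolding eventually_sequentially by blast
    have "riemannian_dist X A g (P m) (P n) < ennreal \<epsilon>" if "m \<ge> M" "n \<ge> M" for m n
    proof -
      have "K * (r m powr \<theta> + r n powr \<theta>) < \<epsilon>" using M[OF that(1)] M[OF that(2)] by (simp add: algebra_simps)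
      then have "ennreal (K * (r m powr \<theta> + r n powr \<theta>)) < ennreal \<epsilon>" using K by (intro ennreal_lessI \<epsilon>)
      with dist[of m n] show ?thesis by (rule order_le_less_trans)
    qed
    then show ?thesis by blast
  qed
  moreover have "limitin X P p sequentially"
    unfolding limitin_def
  proof (intro conjI allI impI p_in_X)
    fix U assume "openin X U \<and> p \<in> U"
    then have "\<forall>\<^sub>F s in at_right 0. \<sigma> s \<in> U" using \<sigma>_tendsto by blast
    moreover have "filterlim r (at_right 0) sequentially"
      unfolding filterlim_at using r_lim r(1) by (auto simp: order_less_imp_not_eq2)
    ultimately show "\<forall>\<^sub>F n in sequentially. P n \<in> U"
      unfolding P_def by (rule eventually_compose_filterlim)
  qed
  ultimately show ?thesis
    unfolding accessible_def using p_boundary int by (intro conjI exI[of _ P]) auto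
qed

end

section \<open>Lower bounds for metric and length at or above the threshold\<close>

lemma smooth_on_locally_lipschitz:
  fixes f :: "'a::euclidean_space \<Rightarrow> 'b::real_normed_vector"
  assumes "smooth_on S f" "y \<in> S"
  obtains e L where "0 < e" "0 \<le> L"
    "\<And>x z. x \<in> S \<inter> cball y e \<Longrightarrow> z \<in> S \<inter> cball y e \<Longrightarrow> norm (f x - f z) \<le> L * norm (x - z)"
proof -
  obtain V h where V: "open V" "y \<in> V" and h: "\<And>x. x \<in> V \<Longrightarrow> h differentiable (at x)"
    "\<And>v. continuous_on V (\<lambda>x. frechet_derivative h (at x) v)" "\<And>x. x \<in> S \<Longrightarrow> x \<in> V \<Longrightarrow> h x = f x"
    by (fact smooth_on_C1[OF assms])
  \<comment> \<open>The Lipschitz bound is taken for the extension on a ball, because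
    \<open>S\<close> itself need not be convex.\<close>
  obtain e L where e: "0 < e" "0 \<le> L"
    "\<And>x z. x \<in> cball y e \<Longrightarrow> z \<in> cball y e \<Longrightarrow> norm (h x - h z) \<le> L * norm (x - z)"
    using C1_locally_lipschitz[OF V h(1,2)] by blast
  obtain e' where e': "0 < e'" "cball y e' \<subseteq> V" using V open_contains_cball by blast
  have "norm (f x - f z) \<le> L * norm (x - z)"
    if x: "x \<in> S \<inter> cball y (min e e')" and z: "z \<in> S \<inter> cball y (min e e')" for x z
  proof -
    have "x \<in> cball y e" "z \<in> cball y e" "x \<in> V" "z \<in> V" using x z e'(2) by auto
    then show ?thesis using e(3)[of x z] h(3)[of x] h(3)[of z] x z by simp
  qed
  with e e' show thesis using that[of "min e e'" L] by simp
qed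

lemma eventually_less_near:
  fixes f :: "'a::metric_space \<Rightarrow> real"
  assumes "continuous_on U f" "y \<in> U" "f y < a"
  shows "\<forall>\<^sub>F x in nhds y. x \<in> U \<longrightarrow> f x < a"
proof -
  have "(f \<longlongrightarrow> f y) (at y within U)" using assms unfolding continuous_on_def by blast
  then have "\<forall>\<^sub>F x in at y within U. f x < a" using assms(3) by (rule order_tendstoD(2))
  then show ?thesis
    unfolding eventually_at_filter by (rule eventually_mono) (use assms(3) in blast)
qed

text \<open>Replaces the chain rule: derivatives of \<open>f\<close> and \<open>y\<close> along the
  same parameter are compared using only a bound on increments, with no derivative of
  \<open>f\<close> as a function of \<open>y\<close>.\<close>

lemma norm_derivative_le_lipschitz:
  fixes f :: "real \<Rightarrow> 'a::real_normed_vector" and y :: "real \<Rightarrow> 'b::real_normed_vector"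
  assumes f: "(f has_vector_derivative d) (at x)" and y: "(y has_vector_derivative v) (at x)"
    and L: "0 \<le> L" "\<forall>\<^sub>F s in at x. norm (f s - f x) \<le> L * norm (y s - y x)"
  shows "norm d \<le> L * norm v"
proof (rule field_le_epsilon)
  fix \<epsilon> :: real assume \<epsilon>: "0 < \<epsilon>"
  \<comment> \<open>The linearisation error of \<open>f\<close> counts once and that of
    \<open>y\<close> is multiplied by \<open>L\<close>, so together they cost
    \<open>e * (L + 1)\<close>.\<close>
  define e where "e = \<epsilon> / (L + 1)"
  have e: "0 < e" using \<epsilon> L(1) unfolding e_def by simp
  obtain d1 where d1: "0 < d1" "\<And>s. norm (s - x) < d1 \<Longrightarrow> norm (f s - f x - (s - x) *\<^sub>R d) \<le> e * norm (s - x)"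
    using f e unfolding has_vector_derivative_def has_derivative_at_alt by blast
  obtain d2 where d2: "0 < d2" "\<And>s. norm (s - x) < d2 \<Longrightarrow> norm (y s - y x - (s - x) *\<^sub>R v) \<le> e * norm (s - x)"
    using y e unfolding has_vector_derivative_def has_derivative_at_alt by blast
  obtain d3 where d3: "0 < d3" "\<And>s. s \<noteq> x \<Longrightarrow> dist s x < d3 \<Longrightarrow> norm (f s - f x) \<le> L * norm (y s - y x)"
    using L(2) unfolding eventually_at by auto
  define h where "h = min d1 (min d2 d3) / 2"
  have h: "0 < h" "h < d1" "h < d2" "h < d3" using d1 d2 d3 unfolding h_def by auto
  have 1: "norm (f (x + h) - f x - h *\<^sub>R d) \<le> e * h" using d1(2)[of "x + h"] h by simp
  have 2: "norm (y (x + h) - y x - h *\<^sub>R v) \<le> e * h" using d2(2)[of "x + h"] h by simp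
  have 3: "norm (f (x + h) - f x) \<le> L * norm (y (x + h) - y x)"
    using d3(2)[of "x + h"] h by (simp add: dist_norm)
  have "norm (h *\<^sub>R d) \<le> norm (f (x + h) - f x) + norm (f (x + h) - f x - h *\<^sub>R d)"
    by (metis norm_triangle_sub norm_minus_commute add.commute)
  moreover have "norm (y (x + h) - y x) \<le> norm (h *\<^sub>R v) + norm (y (x + h) - y x - h *\<^sub>R v)"
    by (rule norm_triangle_sub)
  then have "norm (y (x + h) - y x) \<le> h * norm v + e * h" using 2 h(1) by simp
  then have "L * norm (y (x + h) - y x) \<le> L * (h * norm v + e * h)" using L(1) by (rule mult_left_mono)
  ultimately have "h * norm d \<le> L * (h * norm v + e * h) + e * h" using 1 3 h(1) by simp
  also have "\<dots> = h * (L * norm v + e * (L + 1))" by (simp add: algebra_simps)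
  finally have "norm d \<le> L * norm v + e * (L + 1)" using h(1) by simp
  then show "norm d \<le> L * norm v + \<epsilon>" unfolding e_def using L(1) by simp
qed

lemma bilinear_positive_definite_bound:
  fixes G :: "'a::euclidean_space \<Rightarrow> 'a \<Rightarrow> real"
  assumes G: "bilinear G" and pos: "\<And>v. v \<noteq> 0 \<Longrightarrow> 0 < G v v"
  obtains l where "0 < l" "\<And>v. l * (norm v)\<^sup>2 \<le> G v v"
proof -
  have bb: "bounded_bilinear G" using G bilinear_conv_bounded_bilinear by blast
  have "continuous_on (sphere 0 1) (\<lambda>v. G v v)"
    by (intro bounded_bilinear.continuous_on[OF bb] continuous_on_id)
  moreover have "sphere (0::'a) 1 \<noteq> {}" by simp
  ultimately obtain u where u: "u \<in> sphere 0 1" "\<And>v. v \<in> sphere 0 1 \<Longrightarrow> G u u \<le> G v v"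
    using continuous_attains_inf[OF compact_sphere] by blast
  have "u \<noteq> 0" using u(1) by auto
  then have "0 < G u u" by (rule pos)
  moreover have "G u u * (norm v)\<^sup>2 \<le> G v v" for v
  proof (cases "v = 0")
    case True
    then show ?thesis using bilinear_lzero[OF G] by simp
  next
    case False
    define w where "w = v /\<^sub>R norm v"
    have "v = norm v *\<^sub>R w" "w \<in> sphere 0 1" unfolding w_def using False by auto
    then have "G v v = (norm v)\<^sup>2 * G w w"
      using bilinear_lmul[OF G] bilinear_rmul[OF G] by (metis mult.assoc power2_eq_square real_scaleR_def)
    then show ?thesis using u(2)[OF \<open>w \<in> sphere 0 1\<close>] by (simp add: mult.commute[of "(norm v)\<^sup>2"] mult_right_mono)
  qed
  ultimately show thesis by (rule that)
qed

text \<open>Converts closeness of finitely many coefficients into a bound uniform in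
  \<open>v\<close>; the squared dimension counts the pairs of basis vectors.\<close>

lemma bilinear_perturbation:
  fixes G G' :: "'a::euclidean_space \<Rightarrow> 'a \<Rightarrow> real"
  assumes G: "bilinear G" "bilinear G'"
    and \<eta>: "\<And>b b'. b \<in> Basis \<Longrightarrow> b' \<in> Basis \<Longrightarrow> \<bar>G b b' - G' b b'\<bar> \<le> \<eta>"
  shows "\<bar>G v v - G' v v\<bar> \<le> \<eta> * (real DIM('a))\<^sup>2 * (norm v)\<^sup>2"
proof -
  have expand: "F v v = (\<Sum>(b, b')\<in>Basis \<times> Basis. (v \<bullet> b) * (v \<bullet> b') * F b b')"
    if F: "bilinear F" for F :: "'a \<Rightarrow> 'a \<Rightarrow> real"
  proof -
    have "F (\<Sum>b\<in>Basis. (v \<bullet> b) *\<^sub>R b) (\<Sum>b\<in>Basis. (v \<bullet> b) *\<^sub>R b) =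
        (\<Sum>(b, b')\<in>Basis \<times> Basis. F ((v \<bullet> b) *\<^sub>R b) ((v \<bullet> b') *\<^sub>R b'))"
      by (rule bilinear_sum[OF F])
    then show ?thesis
      unfolding euclidean_representation by (simp add: bilinear_lmul[OF F] bilinear_rmul[OF F] mult_ac)
  qed
  have "G v v - G' v v = (\<Sum>(b, b')\<in>Basis \<times> Basis. (v \<bullet> b) * (v \<bullet> b') * (G b b' - G' b b'))"
    unfolding expand[OF G(1)] expand[OF G(2)]
    by (simp add: sum_subtractf[symmetric] case_prod_unfold right_diff_distrib)
  also have "\<bar>\<dots>\<bar> \<le> (\<Sum>(b, b')\<in>(Basis :: 'a set) \<times> (Basis :: 'a set). norm v * norm v * \<eta>)"
  proof (rule order_trans[OF sum_abs], rule sum_mono, clarify)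
    fix b b' :: 'a assume b: "b \<in> Basis" "b' \<in> Basis"
    show "\<bar>(v \<bullet> b) * (v \<bullet> b') * (G b b' - G' b b')\<bar> \<le> norm v * norm v * \<eta>"
      unfolding abs_mult using b \<eta> Basis_le_norm
      by (intro mult_mono mult_nonneg_nonneg abs_ge_zero norm_ge_zero) auto
  qed
  also have "\<dots> = \<eta> * (real DIM('a))\<^sup>2 * (norm v)\<^sup>2"
    by (simp add: card_cartesian_product power2_eq_square case_prod_unfold)
  finally show ?thesis .
qed

context face_point
begin

abbreviation "U \<equiv> cmap c ` cdom c"

text \<open>The sum dominates every active defining function, so the product of their negative
  powers is bounded below by one negative power of \<open>r\<close>; it also inherits their
  Lipschitz bounds.\<close>

definition r :: "'a \<Rightarrow> real" where "r q = (\<Sum>i\<in>I. \<rho> i q)"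

lemma g0_lower_bound:
  obtains l where "0 < l" "\<forall>\<^sub>F x in nhds y\<^sub>0. x \<in> U \<longrightarrow> (\<forall>v. l * (norm v)\<^sup>2 \<le> g\<^sub>0 c (chart_inv c x) v v)"
proof -
  obtain l where l: "0 < l" "\<And>v. l * (norm v)\<^sup>2 \<le> g\<^sub>0 c p v v"
    using bilinear_positive_definite_bound[OF g0_bilinear[OF c(2)]] metric c
    unfolding riemannian_metric_def by metis
  define D where "D = (real DIM(real^'n))\<^sup>2"
  have D: "0 < D" unfolding D_def by simp
  \<comment> \<open>Chosen so that the perturbation of the metric uses up half of its lower bound
    \<open>l\<close> at \<open>p\<close>.\<close>
  define \<eta> where "\<eta> = l / (2 * D)"
  have \<eta>: "0 < \<eta>" "\<eta> * D = l / 2" unfolding \<eta>_def using l(1) D by auto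
  have "\<forall>\<^sub>F x in nhds y\<^sub>0. x \<in> U \<longrightarrow> \<bar>g\<^sub>0 c (chart_inv c x) b b' - g\<^sub>0 c p b b'\<bar> < \<eta>" for b b'
  proof (rule eventually_less_near[OF _ y0])
    have "continuous_on U (\<lambda>x. g\<^sub>0 c (chart_inv c x) b b')"
      using smooth_on_imp_continuous_on[OF g0_smooth] unfolding in_chart_def comp_def .
    then show "continuous_on U (\<lambda>x. \<bar>g\<^sub>0 c (chart_inv c x) b b' - g\<^sub>0 c p b b'\<bar>)"
      by (intro continuous_intros)
    show "\<bar>g\<^sub>0 c (chart_inv c y\<^sub>0) b b' - g\<^sub>0 c p b b'\<bar> < \<eta>"
      using \<eta>(1) by (simp add: chart_inv_cmap[OF chart c(2)])
  qed
  then have "\<forall>\<^sub>F x in nhds y\<^sub>0. \<forall>b\<in>Basis. \<forall>b'\<in>Basis. x \<in> U \<longrightarrow>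
      \<bar>g\<^sub>0 c (chart_inv c x) b b' - g\<^sub>0 c p b b'\<bar> < \<eta>"
    by (intro eventually_ball_finite ballI finite_Basis)
  then have "\<forall>\<^sub>F x in nhds y\<^sub>0. x \<in> U \<longrightarrow> (\<forall>v. l / 2 * (norm v)\<^sup>2 \<le> g\<^sub>0 c (chart_inv c x) v v)"
  proof (rule eventually_mono, intro impI allI)
    fix x v assume x: "\<forall>b\<in>Basis. \<forall>b'\<in>Basis. x \<in> U \<longrightarrow>
      \<bar>g\<^sub>0 c (chart_inv c x) b b' - g\<^sub>0 c p b b'\<bar> < \<eta>" and xU: "x \<in> U"
    have "\<bar>g\<^sub>0 c (chart_inv c x) v v - g\<^sub>0 c p v v\<bar> \<le> \<eta> * (real DIM(real^'n))\<^sup>2 * (norm v)\<^sup>2"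
      using x xU cmap_chart_inv[OF xU] c(2)
      by (intro bilinear_perturbation g0_bilinear) (auto intro: less_imp_le)
    then have "\<bar>g\<^sub>0 c (chart_inv c x) v v - g\<^sub>0 c p v v\<bar> \<le> l / 2 * (norm v)\<^sup>2"
      unfolding D_def[symmetric] \<eta>(2) .
    moreover have "l / 2 * (norm v)\<^sup>2 = l * (norm v)\<^sup>2 / 2" by simp
    ultimately show "l / 2 * (norm v)\<^sup>2 \<le> g\<^sub>0 c (chart_inv c x) v v" using l(2)[of v] by linarith
  qed
  then show thesis using that[of "l / 2"] l(1) by simp
qed

lemma r_lipschitz:
  obtains e L where "0 < e" "0 \<le> L"
    "\<And>x z. x \<in> U \<inter> cball y\<^sub>0 e \<Longrightarrow> z \<in> U \<inter> cball y\<^sub>0 e \<Longrightarrow>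
       \<bar>r (chart_inv c x) - r (chart_inv c z)\<bar> \<le> L * norm (x - z)"
proof -
  have "\<exists>e L. 0 < e \<and> 0 \<le> L \<and> (\<forall>x\<in>U \<inter> cball y\<^sub>0 e. \<forall>z\<in>U \<inter> cball y\<^sub>0 e.
      \<bar>\<rho> i (chart_inv c x) - \<rho> i (chart_inv c z)\<bar> \<le> L * norm (x - z))" if "i \<in> I" for i
  proof -
    have "i \<in> {1..N}" using that I_sub by blast
    obtain e L where "0 < e" "0 \<le> L" "\<And>x z. x \<in> U \<inter> cball y\<^sub>0 e \<Longrightarrow> z \<in> U \<inter> cball y\<^sub>0 e \<Longrightarrow>
        norm (in_chart c (\<rho> i) x - in_chart c (\<rho> i) z) \<le> L * norm (x - z)"
      by (fact smooth_on_locally_lipschitz[OF \<rho>_smooth[OF \<open>i \<in> {1..N}\<close>] y0])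
    then show ?thesis unfolding in_chart_def comp_def real_norm_def by blast
  qed
  then have "\<forall>i\<in>I. \<exists>eL. 0 < fst eL \<and> 0 \<le> snd eL \<and> (\<forall>x\<in>U \<inter> cball y\<^sub>0 (fst eL). \<forall>z\<in>U \<inter> cball y\<^sub>0 (fst eL).
      \<bar>\<rho> i (chart_inv c x) - \<rho> i (chart_inv c z)\<bar> \<le> snd eL * norm (x - z))"
    by (metis fst_conv snd_conv)
  from bchoice[OF this] obtain eL where eL: "\<forall>i\<in>I. 0 < fst (eL i) \<and> 0 \<le> snd (eL i) \<and>
      (\<forall>x\<in>U \<inter> cball y\<^sub>0 (fst (eL i)). \<forall>z\<in>U \<inter> cball y\<^sub>0 (fst (eL i)).
      \<bar>\<rho> i (chart_inv c x) - \<rho> i (chart_inv c z)\<bar> \<le> snd (eL i) * norm (x - z))"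
    by blast
  \<comment> \<open>The common radius is a minimum over \<open>I\<close>, which is finite and
    nonempty.\<close>
  define e where "e = Min ((\<lambda>i. fst (eL i)) ` I)"
  define L where "L = (\<Sum>i\<in>I. snd (eL i))"
  have e_le: "e \<le> fst (eL i)" if "i \<in> I" for i unfolding e_def using that finite_I by simp
  have "0 < e" unfolding e_def using eL finite_I I_ne by simp
  moreover have "0 \<le> L" unfolding L_def using eL by (intro sum_nonneg) blast
  moreover have "\<bar>r (chart_inv c x) - r (chart_inv c z)\<bar> \<le> L * norm (x - z)"
    if xz: "x \<in> U \<inter> cball y\<^sub>0 e" "z \<in> U \<inter> cball y\<^sub>0 e" for x z
  proof -
    have "\<bar>r (chart_inv c x) - r (chart_inv c z)\<bar> \<le> (\<Sum>i\<in>I. \<bar>\<rho> i (chart_inv c x) - \<rho> i (chart_inv c z)\<bar>)"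
      unfolding r_def sum_subtractf[symmetric] by (rule sum_abs)
    also have "\<dots> \<le> (\<Sum>i\<in>I. snd (eL i) * norm (x - z))"
    proof (rule sum_mono)
      fix i assume i: "i \<in> I"
      have "x \<in> U \<inter> cball y\<^sub>0 (fst (eL i))" "z \<in> U \<inter> cball y\<^sub>0 (fst (eL i))"
        using xz e_le[OF i] by auto
      with eL i show "\<bar>\<rho> i (chart_inv c x) - \<rho> i (chart_inv c z)\<bar> \<le> snd (eL i) * norm (x - z)" by blast
    qed
    finally show ?thesis unfolding L_def by (simp add: sum_distrib_right)
  qed
  ultimately show thesis by (rule that)
qed

lemma r_p: "r p = 0" unfolding r_def using \<rho>_p_zero by simp

lemma r_pos: "q \<in> minterior X A \<Longrightarrow> 0 < r q"
  unfolding r_def using \<rho>_pos I_sub finite_I I_ne by (intro sum_pos) blast+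

text \<open>The exponents \<open>- \<alpha> i\<close> are nonpositive, so the upper bound by twice
  the value at \<open>p\<close> bounds each factor below. Restricting to interior points keeps the
  bases positive, as \<open>powr\<close> with base 0 is 0.\<close>

lemma inactive_factor_bound:
  obtains m where "0 < m" "\<forall>\<^sub>F x in nhds y\<^sub>0. x \<in> U \<longrightarrow> chart_inv c x \<in> minterior X A \<longrightarrow>
      m \<le> (\<Prod>i\<in>{1..N} - I. \<rho> i (chart_inv c x) powr (- \<alpha> i))"
proof -
  define m where "m = (\<Prod>i\<in>{1..N} - I. (2 * \<rho> i p) powr (- \<alpha> i))"
  have pos: "0 < 2 * \<rho> i p" if "i \<in> {1..N} - I" for i using \<rho>_p_pos[OF that] by simp
  have "0 < m" unfolding m_def
  proof (rule prod_pos)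
    show "0 < (2 * \<rho> i p) powr (- \<alpha> i)" if "i \<in> {1..N} - I" for i using pos[OF that] by simp
  qed
  have "\<forall>\<^sub>F x in nhds y\<^sub>0. x \<in> U \<longrightarrow> \<rho> i (chart_inv c x) < 2 * \<rho> i p" if i: "i \<in> {1..N} - I" for i
  proof (rule eventually_less_near[OF _ y0])
    show "continuous_on U (\<lambda>x. \<rho> i (chart_inv c x))"
      using smooth_on_imp_continuous_on[OF \<rho>_smooth] i unfolding in_chart_def comp_def by blast
    show "\<rho> i (chart_inv c y\<^sub>0) < 2 * \<rho> i p"
      using \<rho>_p_pos[OF i] by (simp add: chart_inv_cmap[OF chart c(2)])
  qed
  then have "\<forall>\<^sub>F x in nhds y\<^sub>0. \<forall>i\<in>{1..N} - I. x \<in> U \<longrightarrow> \<rho> i (chart_inv c x) < 2 * \<rho> i p"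
    by (intro eventually_ball_finite ballI) auto
  then have "\<forall>\<^sub>F x in nhds y\<^sub>0. x \<in> U \<longrightarrow> chart_inv c x \<in> minterior X A \<longrightarrow>
      m \<le> (\<Prod>i\<in>{1..N} - I. \<rho> i (chart_inv c x) powr (- \<alpha> i))"
  proof (rule eventually_mono, intro impI)
    fix x assume x: "\<forall>i\<in>{1..N} - I. x \<in> U \<longrightarrow> \<rho> i (chart_inv c x) < 2 * \<rho> i p" "x \<in> U"
      and int: "chart_inv c x \<in> minterior X A"
    show "m \<le> (\<Prod>i\<in>{1..N} - I. \<rho> i (chart_inv c x) powr (- \<alpha> i))"
      unfolding m_def
    proof (rule prod_mono, intro conjI)
      fix i assume i: "i \<in> {1..N} - I"
      show "(2 * \<rho> i p) powr (- \<alpha> i) \<le> \<rho> i (chart_inv c x) powr (- \<alpha> i)"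
        using i x \<alpha>_nonneg[of i] \<rho>_pos[OF _ int, of i] by (intro powr_mono2') (auto intro: less_imp_le)
    qed simp
  qed
  with \<open>0 < m\<close> show thesis by (rule that)
qed

text \<open>Since each active function is at most \<open>r\<close>, the product is at least
  \<open>r powr (- a\<^sub>I)\<close>; and \<open>r < 1\<close> lowers the exponent to the critical
  value 2.\<close>

lemma active_factor_bound:
  assumes A2: "2 \<le> a\<^sub>I" and q: "q \<in> minterior X A" "r q < 1"
  shows "1 / (r q)\<^sup>2 \<le> (\<Prod>i\<in>I. \<rho> i q powr (- \<alpha> i))"
proof -
  have r: "0 < r q" using r_pos q by blast
  have "1 / (r q)\<^sup>2 = r q powr (- 2)"
    using r by (simp add: powr_minus powr_numeral divide_inverse)
  also have "\<dots> \<le> r q powr (- a\<^sub>I)" using A2 r q(2) by (intro powr_mono') auto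
  also have "\<dots> = (\<Prod>i\<in>I. r q powr (- \<alpha> i))" using r by (simp add: powr_sum sum_negf[symmetric])
  also have "\<dots> \<le> (\<Prod>i\<in>I. \<rho> i q powr (- \<alpha> i))"
  proof (rule prod_mono, intro conjI)
    fix i assume i: "i \<in> I"
    have pos: "0 < \<rho> j q" if "j \<in> I" for j using that I_sub \<rho>_pos q(1) by blast
    have "\<rho> i q \<le> r q" unfolding r_def using i pos finite_I by (intro member_le_sum) (auto intro: less_imp_le)
    then show "r q powr (- \<alpha> i) \<le> \<rho> i q powr (- \<alpha> i)"
      using pos[OF i] \<alpha>_nonneg[of i] i I_sub by (intro powr_mono2') auto
  qed simp
  finally show ?thesis .
qed

text \<open>One radius for the length estimates and for confinement. Because \<open>r < 1\<close>,
  the bound with \<open>norm v / r\<close> also implies one with \<open>norm v\<close>, so a single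
  inequality governs both \<open>ln r\<close> and the coordinate displacement. The inclusion of the
  closed ball makes it compact in the chart.\<close>

definition controlled :: "real \<Rightarrow> real \<Rightarrow> real \<Rightarrow> bool" where
  "controlled e \<kappa> L \<longleftrightarrow> 0 < e \<and> 0 < \<kappa> \<and> 0 \<le> L \<and> cball y\<^sub>0 e \<inter> corner_model (cfaces c) \<subseteq> U \<and>
     (\<forall>q v. q \<in> minterior X A \<longrightarrow> q \<in> cdom c \<longrightarrow> cmap c q \<in> cball y\<^sub>0 e \<longrightarrow>
        r q < 1 \<and> (\<kappa> * norm v / r q)\<^sup>2 \<le> g c q v v) \<and>
     (\<forall>q q'. q \<in> cdom c \<longrightarrow> q' \<in> cdom c \<longrightarrow> cmap c q \<in> cball y\<^sub>0 e \<longrightarrow> cmap c q' \<in> cball y\<^sub>0 e \<longrightarrow>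
        \<bar>r q - r q'\<bar> \<le> L * norm (cmap c q - cmap c q'))"

lemma controlledD:
  assumes "controlled e \<kappa> L"
  shows "0 < e" "0 < \<kappa>" "0 \<le> L" "cball y\<^sub>0 e \<inter> corner_model (cfaces c) \<subseteq> U"
    "\<And>q v. q \<in> minterior X A \<Longrightarrow> q \<in> cdom c \<Longrightarrow> cmap c q \<in> cball y\<^sub>0 e \<Longrightarrow>
       r q < 1 \<and> (\<kappa> * norm v / r q)\<^sup>2 \<le> g c q v v"
    "\<And>q q'. q \<in> cdom c \<Longrightarrow> q' \<in> cdom c \<Longrightarrow> cmap c q \<in> cball y\<^sub>0 e \<Longrightarrow> cmap c q' \<in> cball y\<^sub>0 e \<Longrightarrow>
       \<bar>r q - r q'\<bar> \<le> L * norm (cmap c q - cmap c q')"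
  using assms unfolding controlled_def by blast+

lemma controlled_exists:
  assumes A2: "2 \<le> a\<^sub>I"
  obtains e \<kappa> L where "controlled e \<kappa> L"
proof -
  obtain e1 where e1: "0 < e1" "cball y\<^sub>0 e1 \<inter> corner_model (cfaces c) \<subseteq> U"
    by (fact chart_image_local[OF chart y0])
  obtain e2 L where e2: "0 < e2" "0 \<le> L" "\<And>x z. x \<in> U \<inter> cball y\<^sub>0 e2 \<Longrightarrow> z \<in> U \<inter> cball y\<^sub>0 e2 \<Longrightarrow>
       \<bar>r (chart_inv c x) - r (chart_inv c z)\<bar> \<le> L * norm (x - z)"
    by (fact r_lipschitz)
  obtain l where l: "0 < l" "\<forall>\<^sub>F x in nhds y\<^sub>0. x \<in> U \<longrightarrow> (\<forall>v. l * (norm v)\<^sup>2 \<le> g\<^sub>0 c (chart_inv c x) v v)"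
    by (fact g0_lower_bound)
  obtain m where m: "0 < m" "\<forall>\<^sub>F x in nhds y\<^sub>0. x \<in> U \<longrightarrow> chart_inv c x \<in> minterior X A \<longrightarrow>
      m \<le> (\<Prod>i\<in>{1..N} - I. \<rho> i (chart_inv c x) powr (- \<alpha> i))"
    by (fact inactive_factor_bound)
  obtain e3 where e3: "0 < e3" "\<And>x. dist x y\<^sub>0 < e3 \<Longrightarrow>
      (x \<in> U \<longrightarrow> (\<forall>v. l * (norm v)\<^sup>2 \<le> g\<^sub>0 c (chart_inv c x) v v)) \<and>
      (x \<in> U \<longrightarrow> chart_inv c x \<in> minterior X A \<longrightarrow>
      m \<le> (\<Prod>i\<in>{1..N} - I. \<rho> i (chart_inv c x) powr (- \<alpha> i)))"
    using eventually_conj[OF l(2) m(2)] unfolding eventually_nhds_metric by blast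
  \<comment> \<open>\<open>m\<close> bounds the inactive factors and \<open>l\<close> the metric
    \<open>g\<^sub>0\<close>; the active factors contribute the inverse square of
    \<open>r\<close>.\<close>
  define \<kappa> where "\<kappa> = sqrt (m * l)"
  have \<kappa>: "0 < \<kappa>" unfolding \<kappa>_def using m(1) l(1) by simp
  \<comment> \<open>The last entry forces \<open>r < 1\<close> on the ball, as \<open>r\<close>
    vanishes at \<open>p\<close> and has Lipschitz constant \<open>L\<close>. Halving
    \<open>e3\<close> passes from an open to a closed ball.\<close>
  define e where "e = min (min e1 e2) (min (e3 / 2) (1 / (2 * (L + 1))))"
  have e: "0 < e" "e \<le> e1" "e \<le> e2" "e < e3" "e \<le> 1 / (2 * (L + 1))"
    unfolding e_def using e1(1) e2(1,2) e3(1) by auto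
  have lip: "\<bar>r q - r q'\<bar> \<le> L * norm (cmap c q - cmap c q')"
    if "q \<in> cdom c" "q' \<in> cdom c" "cmap c q \<in> cball y\<^sub>0 e" "cmap c q' \<in> cball y\<^sub>0 e" for q q'
    using e2(3)[of "cmap c q" "cmap c q'"] that e(3) by (simp add: chart_inv_cmap[OF chart])
  have "r q < 1 \<and> (\<kappa> * norm v / r q)\<^sup>2 \<le> g c q v v"
    if q: "q \<in> minterior X A" "q \<in> cdom c" "cmap c q \<in> cball y\<^sub>0 e" for q v
  proof -
    have "y\<^sub>0 \<in> cball y\<^sub>0 e" using e(1) by simp
    then have "\<bar>r q - r p\<bar> \<le> L * norm (cmap c q - y\<^sub>0)" by (intro lip q c)
    also have "\<dots> \<le> L * (1 / (2 * (L + 1)))"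
      using q(3) e(5) e2(2) by (intro mult_left_mono) (auto simp: dist_norm norm_minus_commute)
    also have "\<dots> < 1" using e2(2) by (simp add: field_simps)
    finally have r1: "r q < 1" using r_p by simp
    have "dist (cmap c q) y\<^sub>0 < e3" using q(3) e(4) by (simp add: dist_commute)
    then have lv: "l * (norm v)\<^sup>2 \<le> g\<^sub>0 c q v v" and mq: "m \<le> (\<Prod>i\<in>{1..N} - I. \<rho> i q powr (- \<alpha> i))"
      using e3(2)[of "cmap c q"] q by (auto simp: chart_inv_cmap[OF chart])
    have r: "0 < r q" using r_pos q by blast
    have "m * (1 / (r q)\<^sup>2) \<le> (\<Prod>i\<in>{1..N} - I. \<rho> i q powr (- \<alpha> i)) * (\<Prod>i\<in>I. \<rho> i q powr (- \<alpha> i))"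
      using mq active_factor_bound[OF A2 q(1) r1] m(1) by (intro mult_mono) auto
    also have "\<dots> = (\<Prod>i=1..N. \<rho> i q powr (- \<alpha> i))"
      using I_sub by (intro prod.subset_diff[symmetric]) auto
    finally have "(m * (1 / (r q)\<^sup>2)) * (l * (norm v)\<^sup>2) \<le> g c q v v"
      unfolding product_metric_def using lv l(1) m(1) by (intro mult_mono) (auto intro: prod_nonneg)
    moreover have "(\<kappa> * norm v / r q)\<^sup>2 = (m * (1 / (r q)\<^sup>2)) * (l * (norm v)\<^sup>2)"
      unfolding \<kappa>_def using m(1) l(1) by (simp add: power_mult_distrib power_divide)
    ultimately show ?thesis using r1 by simp
  qed
  moreover have "cball y\<^sub>0 e \<inter> corner_model (cfaces c) \<subseteq> U" using e(2) e1(2) by fastforce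
  ultimately have "controlled e \<kappa> L"
    unfolding controlled_def using e(1) \<kappa> e2(2) lip by (intro conjI allI impI) blast+
  then show thesis by (rule that)
qed

text \<open>A function along the curve whose derivative is almost everywhere at most
  \<open>\<kappa> * norm v / r\<close> has increment at most the length. The multiple \<kappa> of
  the coordinates qualifies because \<open>r < 1\<close>, and \<open>\<kappa> / (L + 1)\<close>
  times \<open>ln r\<close> because the derivative of \<open>r\<close> is at most
  \<open>L * norm v\<close>; \<open>L + 1\<close> avoids division by zero.\<close>

lemma curve_lower_bound:
  assumes ctrl: "controlled e \<kappa> L" and ac: "ac_curve X A T \<gamma>" and st: "s \<le> t" "{s..t} \<subseteq> T"
    and \<gamma>: "\<And>\<tau>. \<tau> \<in> {s..t} \<Longrightarrow> \<gamma> \<tau> \<in> cdom c \<and> cmap c (\<gamma> \<tau>) \<in> cball y\<^sub>0 e"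
  shows "ennreal (\<kappa> * norm (cmap c (\<gamma> t) - cmap c (\<gamma> s))) \<le> curve_length A g T \<gamma>" (is ?displacement)
    and "ennreal (\<kappa> / (L + 1) * \<bar>ln (r (\<gamma> t)) - ln (r (\<gamma> s))\<bar>) \<le> curve_length A g T \<gamma>" (is ?log)
proof -
  note \<kappa> = controlledD(2)[OF ctrl] and L = controlledD(3)[OF ctrl]
    and g_low = controlledD(5)[OF ctrl] and lip = controlledD(6)[OF ctrl]
  define y where "y = cmap c \<circ> \<gamma>"
  have int: "\<gamma> \<tau> \<in> minterior X A" if "\<tau> \<in> {s..t}" for \<tau>
    using ac st(2) that unfolding ac_curve_def by blast
  have y_ac: "abs_continuous_on {s..t} y"
    unfolding y_def using ac c(1) st \<gamma> unfolding ac_curve_def by blast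
  define E where "E = {\<tau> \<in> {s<..<t}. \<not> y differentiable (at \<tau>)}"
  have E: "negligible E" unfolding E_def by (rule abs_continuous_on_ae_differentiable[OF y_ac])
  have r_bounds: "0 < r (\<gamma> \<tau>)" "r (\<gamma> \<tau>) < 1" if "\<tau> \<in> {s..t}" for \<tau>
    using r_pos[OF int[OF that]] g_low[OF int[OF that]] \<gamma>[OF that] by blast+
  have speed: "\<kappa> * norm v / r (\<gamma> \<tau>) \<le> speed A g T \<gamma> \<tau>"
    if \<tau>: "\<tau> \<in> {s<..<t}" and v: "(y has_vector_derivative v) (at \<tau>)" for \<tau> v
  proof -
    have \<tau>': "\<tau> \<in> {s..t}" "\<tau> \<in> T" using \<tau> st by auto
    \<comment> \<open>Makes the derivative within \<open>T\<close> that occurs in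
      \<open>speed\<close> a two-sided one.\<close>
    have "{s<..<t} \<subseteq> T" using st(2) greaterThanLessThan_subseteq_atLeastAtMost_iff[of s t s t] by (meson order_refl order_trans)
    then have "\<tau> \<in> interior T" using \<tau> interior_maximal[of "{s<..<t}" T] by auto
    then have at: "at \<tau> within T = at \<tau>" by (rule at_within_interior)
    have "speed A g T \<gamma> \<tau> = sqrt (g c (\<gamma> \<tau>) v v)"
    proof (rule speed_in_chart[OF atlas tensorial_g c(1)])
      show "\<gamma> \<tau> \<in> minterior X A" "\<tau> \<in> T" using int \<tau>' by blast+
      show "\<gamma> \<tau> \<in> cdom c" using \<gamma>[OF \<tau>'(1)] by blast
      show "continuous_map (top_of_set T) X \<gamma>" using ac unfolding ac_curve_def by blast
      show "at \<tau> within T \<noteq> bot" unfolding at by simp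
      show "(cmap c \<circ> \<gamma> has_vector_derivative v) (at \<tau> within T)" using v unfolding at y_def .
    qed
    moreover have "sqrt ((\<kappa> * norm v / r (\<gamma> \<tau>))\<^sup>2) \<le> sqrt (g c (\<gamma> \<tau>) v v)"
      using g_low[OF int[OF \<tau>'(1)]] \<gamma>[OF \<tau>'(1)] by (intro real_sqrt_le_mono) blast
    ultimately show ?thesis using \<kappa> r_bounds(1)[OF \<tau>'(1)] by simp
  qed
  have length: "ennreal (norm (f t - f s)) \<le> curve_length A g T \<gamma>"
    if f: "abs_continuous_on {s..t} f"
      and bound: "\<And>\<tau> d v. \<tau> \<in> {s<..<t} \<Longrightarrow> (f has_vector_derivative d) (at \<tau>) \<Longrightarrow>
          (y has_vector_derivative v) (at \<tau>) \<Longrightarrow> norm d \<le> \<kappa> * norm v / r (\<gamma> \<tau>)"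
    for f :: "real \<Rightarrow> 'b::euclidean_space"
  proof -
    have "ennreal (norm (f t - f s)) \<le> (\<integral>\<^sup>+\<tau>\<in>{s..t}. ennreal (speed A g T \<gamma> \<tau>) \<partial>lborel)"
    proof (rule abs_continuous_on_norm_diff_le_nn_integral[OF st(1) f E])
      fix \<tau> d assume \<tau>: "\<tau> \<in> {s<..<t} - E" and d: "(f has_vector_derivative d) (at \<tau>)"
      then obtain v where v: "(y has_vector_derivative v) (at \<tau>)"
        unfolding E_def using vector_derivative_works by blast
      show "ennreal (norm d) \<le> ennreal (speed A g T \<gamma> \<tau>)"
        using bound[OF _ d v] speed[OF _ v] \<tau> by (intro ennreal_leI) force
    qed
    also have "\<dots> \<le> curve_length A g T \<gamma>"
      unfolding curve_length_def using st(2) by (intro nn_integral_mono) (auto simp: indicator_def)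
    finally show ?thesis .
  qed
  show ?displacement
  proof -
    have "abs_continuous_on {s..t} (\<lambda>\<tau>. \<kappa> *\<^sub>R y \<tau>)"
      by (rule abs_continuous_on_compose_lipschitz[OF y_ac, of _ \<kappa>])
        (use \<kappa> in \<open>simp add: scaleR_diff_right[symmetric]\<close>)
    then have "ennreal (norm (\<kappa> *\<^sub>R y t - \<kappa> *\<^sub>R y s)) \<le> curve_length A g T \<gamma>"
    proof (rule length)
      fix \<tau> d v assume \<tau>: "\<tau> \<in> {s<..<t}" and d: "((\<lambda>\<tau>. \<kappa> *\<^sub>R y \<tau>) has_vector_derivative d) (at \<tau>)"
        and v: "(y has_vector_derivative v) (at \<tau>)"
      have "((\<lambda>\<tau>. \<kappa> *\<^sub>R y \<tau>) has_vector_derivative \<kappa> *\<^sub>R v) (at \<tau>)"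
        using v by (auto intro!: derivative_eq_intros)
      then have "d = \<kappa> *\<^sub>R v" using d vector_derivative_unique_at by blast
      moreover have "\<kappa> * norm v \<le> \<kappa> * norm v / r (\<gamma> \<tau>)"
        using r_bounds[of \<tau>] \<tau> \<kappa> by (simp add: pos_le_divide_eq mult_left_le)
      ultimately show "norm d \<le> \<kappa> * norm v / r (\<gamma> \<tau>)" using \<kappa> by simp
    qed
    then show ?thesis using \<kappa> by (simp add: y_def scaleR_diff_right[symmetric])
  qed
  show ?log
  proof -
    define R where "R = r \<circ> \<gamma>"
    have R_lip: "norm (R \<tau> - R \<tau>') \<le> L * norm (y \<tau> - y \<tau>')" if "\<tau> \<in> {s..t}" "\<tau>' \<in> {s..t}" for \<tau> \<tau>'
      using lip[of "\<gamma> \<tau>" "\<gamma> \<tau>'"] \<gamma> that unfolding R_def y_def by simp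
    then have R_ac: "abs_continuous_on {s..t} R"
      by (intro abs_continuous_on_compose_lipschitz[OF y_ac])
    have R_pos: "0 < R \<tau>" if "\<tau> \<in> {s..t}" for \<tau> using r_bounds[OF that] unfolding R_def by simp
    \<comment> \<open>The positive minimum of \<open>R\<close> on the compact interval makes
      \<open>ln\<close> Lipschitz on the values of \<open>R\<close>, which yields absolute
      continuity of \<open>F\<close>; the constant does not enter the final bound.\<close>
    obtain \<tau>0 where \<tau>0: "\<tau>0 \<in> {s..t}" "\<And>\<tau>. \<tau> \<in> {s..t} \<Longrightarrow> R \<tau>0 \<le> R \<tau>"
      using continuous_attains_inf[OF compact_Icc _ abs_continuous_on_imp_continuous_on[OF R_ac]] st(1)
      by (metis atLeastAtMost_iff empty_iff order_refl)
    define k where "k = \<kappa> / (L + 1)"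
    have k: "0 < k" unfolding k_def using \<kappa> L by simp
    define F where "F \<tau> = k * ln (R \<tau>)" for \<tau>
    have "abs_continuous_on {s..t} F"
    proof (rule abs_continuous_on_compose_lipschitz[OF R_ac, of _ "k / R \<tau>0"])
      have one_sided: "ln (R a) - ln (R b) \<le> norm (R a - R b) / R \<tau>0" if ab: "a \<in> {s..t}" "b \<in> {s..t}" for a b
      proof -
        have "ln (R a) - ln (R b) \<le> (R a - R b) / R b" using R_pos ab by (intro ln_diff_le) auto
        also have "\<dots> \<le> norm (R a - R b) / R b" using R_pos[OF ab(2)] by (intro divide_right_mono) auto
        also have "\<dots> \<le> norm (R a - R b) / R \<tau>0"
          using \<tau>0(2)[OF ab(2)] R_pos[OF \<tau>0(1)] by (intro divide_left_mono mult_pos_pos R_pos ab \<tau>0(1)) auto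
        finally show ?thesis .
      qed
      fix a b assume ab: "a \<in> {s..t}" "b \<in> {s..t}"
      have "\<bar>ln (R b) - ln (R a)\<bar> \<le> norm (R b - R a) / R \<tau>0"
        using one_sided[OF ab] one_sided[OF ab(2,1)] by (simp add: abs_le_iff norm_minus_commute abs_minus_commute)
      then have "k * \<bar>ln (R b) - ln (R a)\<bar> \<le> k * (norm (R b - R a) / R \<tau>0)"
        using k by (intro mult_left_mono) auto
      then show "norm (F b - F a) \<le> k / R \<tau>0 * norm (R b - R a)"
        unfolding F_def using k by (simp add: right_diff_distrib[symmetric] abs_mult)
    qed
    then have "ennreal (norm (F t - F s)) \<le> curve_length A g T \<gamma>"
    proof (rule length)
      fix \<tau> d v assume \<tau>: "\<tau> \<in> {s<..<t}" and d: "(F has_vector_derivative d) (at \<tau>)"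
        and v: "(y has_vector_derivative v) (at \<tau>)"
      have \<tau>': "\<tau> \<in> {s..t}" using \<tau> by auto
      have near: "\<forall>\<^sub>F \<tau>' in nhds \<tau>. \<tau>' \<in> {s..t}"
        using eventually_nhds_in_open[OF open_greaterThanLessThan \<tau>] by (rule eventually_mono) auto
      \<comment> \<open>Differentiability is given for \<open>F\<close> and not for
        \<open>R\<close>, so \<open>R\<close> is recovered by exponentiating, and its derivative is
        then compared with that of \<open>y\<close>.\<close>
      have "((\<lambda>\<tau>. F \<tau> / k) has_real_derivative d / k) (at \<tau>)"
        using d unfolding has_real_derivative_iff_has_vector_derivative[symmetric] by (rule DERIV_cdivide)
      then have "((\<lambda>\<tau>. exp (F \<tau> / k)) has_real_derivative exp (F \<tau> / k) * (d / k)) (at \<tau>)"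
        by (rule DERIV_fun_exp)
      moreover have "exp (F \<tau> / k) = R \<tau>" if "\<tau> \<in> {s..t}" for \<tau>
        using R_pos[OF that] k unfolding F_def by simp
      ultimately have "(R has_real_derivative R \<tau> * (d / k)) (at \<tau>)"
        using DERIV_cong_ev[OF refl eventually_mono[OF near] refl, of "\<lambda>\<tau>. exp (F \<tau> / k)" R] \<tau>' by simp
      then have "norm (R \<tau> * (d / k)) \<le> L * norm v"
        using v L near \<tau>' R_lip unfolding has_real_derivative_iff_has_vector_derivative
        by (intro norm_derivative_le_lipschitz[of R _ \<tau> y v])
          (auto simp: eventually_at_filter elim!: eventually_mono)
      then have "R \<tau> * \<bar>d\<bar> \<le> k * (L * norm v)"
        using k R_pos[OF \<tau>'] by (simp add: abs_mult field_simps)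
      also have "k * (L * norm v) \<le> \<kappa> * norm v"
      proof -
        have "k * L \<le> \<kappa>" unfolding k_def using \<kappa> L by (simp add: field_simps)
        then show ?thesis using mult_right_mono[of "k * L" \<kappa> "norm v"] by (simp add: mult.assoc)
      qed
      finally show "norm d \<le> \<kappa> * norm v / r (\<gamma> \<tau>)"
        using R_pos[OF \<tau>'] unfolding R_def by (simp add: pos_le_divide_eq mult.commute)
    qed
    moreover have "norm (F t - F s) = k * \<bar>ln (r (\<gamma> t)) - ln (r (\<gamma> s))\<bar>"
      unfolding F_def R_def using k by (simp add: right_diff_distrib[symmetric] abs_mult)
    ultimately show ?thesis unfolding k_def by simp
  qed
qed

section \<open>Confinement of short curves and divergence of the logarithm\<close>

lemma openin_coordinate_ball:
  "openin X {q \<in> cdom c. cmap c q \<in> ball y\<^sub>0 e}"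
proof -
  have "openin (subtopology X (cdom c)) {q \<in> topspace (subtopology X (cdom c)). cmap c q \<in> ball y\<^sub>0 e}"
    by (intro openin_continuous_map_preimage[OF continuous_map_cmap[OF chart]]) simp
  moreover have "{q \<in> topspace (subtopology X (cdom c)). cmap c q \<in> ball y\<^sub>0 e} =
      {q \<in> cdom c. cmap c q \<in> ball y\<^sub>0 e}"
    using cdom_subset[OF chart] by auto
  moreover have "openin X (cdom c)" using chart unfolding is_corner_chart_def by blast
  ultimately show ?thesis by (metis openin_open_subtopology)
qed

text \<open>The set is the image of a compact piece of the model space in a Hausdorff space.
  Closedness in all of \<open>X\<close>, not just in the chart domain, is what prevents a curve from
  escaping through the edge of the chart.\<close>

lemma closedin_coordinate_ball:
  assumes "cball y\<^sub>0 e \<inter> corner_model (cfaces c) \<subseteq> U"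
  shows "closedin X {q \<in> cdom c. cmap c q \<in> cball y\<^sub>0 e}"
proof -
  have "closed (corner_model (cfaces c))"
    unfolding corner_model_def Ball_def
    by (intro closed_Collect_all closed_Collect_imp closed_Collect_le open_Collect_const continuous_intros)
  then have "compact (cball y\<^sub>0 e \<inter> corner_model (cfaces c))" by (intro compact_Int_closed compact_cball)
  then have "compactin (top_of_set U) (cball y\<^sub>0 e \<inter> corner_model (cfaces c))"
    using assms by (simp add: compactin_subtopology)
  then have "compactin X (chart_inv c ` (cball y\<^sub>0 e \<inter> corner_model (cfaces c)))"
    using continuous_map_chart_inv[OF chart] by (rule image_compactin)
  moreover have "chart_inv c ` (cball y\<^sub>0 e \<inter> corner_model (cfaces c)) = {q \<in> cdom c. cmap c q \<in> cball y\<^sub>0 e}"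
  proof (intro equalityI subsetI)
    fix q assume "q \<in> chart_inv c ` (cball y\<^sub>0 e \<inter> corner_model (cfaces c))"
    then obtain x where x: "x \<in> cball y\<^sub>0 e" "x \<in> U" "q = chart_inv c x" using assms by blast
    then show "q \<in> {q \<in> cdom c. cmap c q \<in> cball y\<^sub>0 e}" using cmap_chart_inv[OF x(2)] by simp
  next
    fix q assume "q \<in> {q \<in> cdom c. cmap c q \<in> cball y\<^sub>0 e}"
    then show "q \<in> chart_inv c ` (cball y\<^sub>0 e \<inter> corner_model (cfaces c))"
      using chart_image_nonneg[OF chart] chart_inv_cmap[OF chart]
      by (intro image_eqI[of _ _ "cmap c q"]) (auto simp: corner_model_def)
  qed
  ultimately show ?thesis using hausdorff compactin_imp_closedin by metis
qed

text \<open>Stated for an arbitrary filter so as to serve both a curve near its end and a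
  sequence.\<close>

lemma r_tendsto_zero:
  assumes P: "limitin X P p F" and int: "\<forall>\<^sub>F x in F. P x \<in> minterior X A"
  shows "filterlim (\<lambda>x. ln (r (P x))) at_bot F"
proof -
  have "((\<lambda>x. r (P x)) \<longlongrightarrow> 0) F"
  proof (rule tendstoI)
    fix \<epsilon> :: real assume \<epsilon>: "0 < \<epsilon>"
    obtain e L where e: "0 < e" "0 \<le> L" "\<And>x z. x \<in> U \<inter> cball y\<^sub>0 e \<Longrightarrow> z \<in> U \<inter> cball y\<^sub>0 e \<Longrightarrow>
       \<bar>r (chart_inv c x) - r (chart_inv c z)\<bar> \<le> L * norm (x - z)"
      by (fact r_lipschitz)
    define d where "d = min e (\<epsilon> / (L + 1))"
    have d: "0 < d" "d \<le> e" "d \<le> \<epsilon> / (L + 1)" unfolding d_def using e(1,2) \<epsilon> by auto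
    have "p \<in> {q \<in> cdom c. cmap c q \<in> ball y\<^sub>0 d}" using c d by simp
    then have "\<forall>\<^sub>F x in F. P x \<in> {q \<in> cdom c. cmap c q \<in> ball y\<^sub>0 d}"
      using P openin_coordinate_ball unfolding limitin_def by blast
    then show "\<forall>\<^sub>F x in F. dist (r (P x)) 0 < \<epsilon>"
    proof eventually_elim
      case (elim x)
      then have x: "P x \<in> cdom c" "norm (cmap c (P x) - y\<^sub>0) < d" by (auto simp: dist_norm norm_minus_commute)
      have "\<bar>r (chart_inv c (cmap c (P x))) - r (chart_inv c y\<^sub>0)\<bar> \<le> L * norm (cmap c (P x) - y\<^sub>0)"
        using x d(2) e(1) c by (intro e(3)) (auto simp: dist_norm norm_minus_commute)
      then have "\<bar>r (P x)\<bar> \<le> L * norm (cmap c (P x) - y\<^sub>0)"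
        using x(1) c(2) r_p by (simp add: chart_inv_cmap[OF chart])
      also have "\<dots> \<le> L * (\<epsilon> / (L + 1))" using x(2) d(3) e(2) by (intro mult_left_mono) auto
      also have "\<dots> < \<epsilon>" using e(2) \<epsilon> by (simp add: field_simps)
      finally show ?case by simp
    qed
  qed
  moreover have "\<forall>\<^sub>F x in F. r (P x) \<in> {0<..} \<and> r (P x) \<noteq> 0"
    using int by eventually_elim (use r_pos in force)
  ultimately have "filterlim (\<lambda>x. r (P x)) (at_right 0) F" unfolding filterlim_at by blast
  then show ?thesis by (rule filterlim_compose[OF ln_at_0])
qed

lemma not_bounded_log:
  assumes "F \<noteq> bot" and lim: "filterlim (\<lambda>x. ln (r (P x))) at_bot F"
    and k: "0 < k" and bound: "\<forall>\<^sub>F x in F. ennreal (k * \<bar>ln (r (P x)) - l\<bar>) \<le> B" and B: "B < \<infinity>"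
  shows False
proof -
  obtain b where b: "B = ennreal b" "0 \<le> b" using B by (cases B) auto
  have "\<forall>\<^sub>F x in F. ln (r (P x)) < l - b / k - 1"
    using lim unfolding filterlim_at_bot_dense by blast
  with bound have "\<forall>\<^sub>F x in F. False"
  proof eventually_elim
    case (elim x)
    have "k * \<bar>ln (r (P x)) - l\<bar> \<le> b" using elim(1) b by (simp add: ennreal_le_iff)
    then have "\<bar>ln (r (P x)) - l\<bar> \<le> b / k" using k by (simp add: pos_le_divide_eq mult.commute)
    with elim(2) show False by linarith
  qed
  with assms(1) show False by simp
qed

lemma not_finite_length_approachable:
  assumes A2: "2 \<le> a\<^sub>I" shows "\<not> finite_length_approachable X A g p"
proof
  assume "finite_length_approachable X A g p"
  then obtain \<gamma> where ac: "ac_curve X A {0..<1} \<gamma>" and lim: "limitin X \<gamma> p (at_left 1)"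
    and fin: "curve_length A g {0..<1} \<gamma> < \<infinity>"
    unfolding finite_length_approachable_def by blast
  obtain e \<kappa> L where ctrl: "controlled e \<kappa> L" by (rule controlled_exists[OF A2])
  note e = controlledD(1)[OF ctrl] and \<kappa> = controlledD(2)[OF ctrl] and L = controlledD(3)[OF ctrl]
  have "p \<in> {q \<in> cdom c. cmap c q \<in> ball y\<^sub>0 e}" using c e by simp
  then have "\<forall>\<^sub>F t in at_left 1. \<gamma> t \<in> {q \<in> cdom c. cmap c q \<in> ball y\<^sub>0 e}"
    using lim openin_coordinate_ball unfolding limitin_def by blast
  then obtain b where b: "b < 1" "\<And>t. b < t \<Longrightarrow> t < 1 \<Longrightarrow> \<gamma> t \<in> cdom c \<and> cmap c (\<gamma> t) \<in> cball y\<^sub>0 e"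
    unfolding eventually_at_left_field by force
  \<comment> \<open>The midpoint between 1 and the later of \<open>b\<close> and 0: from
    \<open>s\<close> on, the curve lies in the chart ball.\<close>
  define s where "s = (1 + max b 0) / 2"
  have s: "0 \<le> s" "b < s" "s < 1" unfolding s_def using b(1) by auto
  have "\<forall>\<^sub>F t in at_left 1. s < t \<and> t < 1"
    unfolding eventually_at_left_field using s by blast
  then have bound: "\<forall>\<^sub>F t in at_left 1. ennreal (\<kappa> / (L + 1) * \<bar>ln (r (\<gamma> t)) - ln (r (\<gamma> s))\<bar>) \<le> curve_length A g {0..<1} \<gamma>"
  proof (rule eventually_mono)
    fix t assume t: "s < t \<and> t < 1"
    show "ennreal (\<kappa> / (L + 1) * \<bar>ln (r (\<gamma> t)) - ln (r (\<gamma> s))\<bar>) \<le> curve_length A g {0..<1} \<gamma>"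
    proof (rule curve_lower_bound(2)[OF ctrl ac])
      show "s \<le> t" "{s..t} \<subseteq> {0..<1}" using s t by auto
      show "\<gamma> \<tau> \<in> cdom c \<and> cmap c (\<gamma> \<tau>) \<in> cball y\<^sub>0 e" if "\<tau> \<in> {s..t}" for \<tau>
        using that s t by (intro b(2)) auto
    qed
  qed
  have "\<forall>\<^sub>F t in at_left 1. \<gamma> t \<in> minterior X A"
    using ac unfolding eventually_at_left_field ac_curve_def by (intro exI[of _ 0]) auto
  then have "filterlim (\<lambda>t. ln (r (\<gamma> t))) at_bot (at_left 1)" by (rule r_tendsto_zero[OF lim])
  then show False
    using \<kappa> L by (intro not_bounded_log[OF _ _ _ bound fin]) auto
qed

text \<open>Consider the first parameter outside the open ball of radius \<open>e\<close>. Before it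
  the displacement estimate applies and is below \<open>e / 4\<close>, so the curve stays within
  \<open>e / 2 + e / 4 = 3 * e / 4\<close> of the centre. That smaller closed ball is closed in
  \<open>X\<close>, hence contains the exit point as well, a contradiction.\<close>

lemma short_curve_confined:
  assumes ctrl: "controlled e \<kappa> L" and ac: "ac_curve X A {0..1} \<gamma>"
    and start: "\<gamma> 0 \<in> cdom c" "cmap c (\<gamma> 0) \<in> ball y\<^sub>0 (e / 2)"
    and short: "curve_length A g {0..1} \<gamma> < ennreal (\<kappa> * (e / 4))"
    and t: "t \<in> {0..1}"
  shows "\<gamma> t \<in> cdom c \<and> cmap c (\<gamma> t) \<in> ball y\<^sub>0 e"
proof (rule ccontr)
  note e = controlledD(1)[OF ctrl] and \<kappa> = controlledD(2)[OF ctrl] and sub = controlledD(4)[OF ctrl]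
  define V where "V = {q \<in> cdom c. cmap c q \<in> ball y\<^sub>0 e}"
  define C where "C = {q \<in> cdom c. cmap c q \<in> cball y\<^sub>0 (3 * e / 4)}"
  have cont: "continuous_map (top_of_set {0..1}) X \<gamma>" using ac unfolding ac_curve_def by blast
  have \<gamma>X: "\<gamma> \<tau> \<in> topspace X" if "\<tau> \<in> {0..1}" for \<tau>
    using cont that unfolding continuous_map_def by auto
  assume "\<not> (\<gamma> t \<in> cdom c \<and> cmap c (\<gamma> t) \<in> ball y\<^sub>0 e)"
  then have "\<gamma> t \<notin> V" unfolding V_def by blast
  define B where "B = {\<tau> \<in> {0..1}. \<gamma> \<tau> \<notin> V}"
  have "closedin (top_of_set {0..1}) {\<tau> \<in> topspace (top_of_set {0..1}). \<gamma> \<tau> \<in> topspace X - V}"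
    using openin_coordinate_ball unfolding V_def by (intro closedin_continuous_map_preimage[OF cont]) blast
  also have "{\<tau> \<in> topspace (top_of_set {0..1}). \<gamma> \<tau> \<in> topspace X - V} = B"
    unfolding B_def using \<gamma>X by auto
  finally have "closed B" using closedin_closed_trans closed_atLeastAtMost by blast
  \<comment> \<open>Nonemptiness of \<open>B\<close>; together with closedness and the lower bound
    it makes the infimum an attained first exit parameter.\<close>
  moreover have "t \<in> B" unfolding B_def using t \<open>\<gamma> t \<notin> V\<close> by blast
  moreover have bdd: "bdd_below B" unfolding B_def by (intro bdd_belowI[of _ 0]) auto
  moreover define \<tau> where "\<tau> = Inf B"
  ultimately have \<tau>B: "\<tau> \<in> B" using closed_contains_Inf by blast
  have before: "\<gamma> s \<in> V" if "0 \<le> s" "s < \<tau>" for s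
    using that \<tau>B cInf_lower[OF _ bdd, of s] unfolding \<tau>_def[symmetric] unfolding B_def by force
  have "\<gamma> 0 \<in> V" unfolding V_def using start e by simp
  then have \<tau>0: "0 < \<tau>" "\<tau> \<le> 1" "\<gamma> \<tau> \<notin> V" using \<tau>B unfolding B_def by (auto simp: order_le_less)
  have in_C: "\<gamma> s \<in> C" if s: "0 \<le> s" "s < \<tau>" for s
  proof -
    have "ennreal (\<kappa> * norm (cmap c (\<gamma> s) - cmap c (\<gamma> 0))) \<le> curve_length A g {0..1} \<gamma>"
    proof (rule curve_lower_bound(1)[OF ctrl ac])
      show "\<gamma> u \<in> cdom c \<and> cmap c (\<gamma> u) \<in> cball y\<^sub>0 e" if "u \<in> {0..s}" for u
        using before[of u] that s unfolding V_def by auto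
    qed (use s \<tau>0 in auto)
    also note short
    finally have "norm (cmap c (\<gamma> s) - cmap c (\<gamma> 0)) < e / 4"
      using \<kappa> e by (simp add: ennreal_less_iff)
    moreover have "dist y\<^sub>0 (cmap c (\<gamma> s)) \<le> dist y\<^sub>0 (cmap c (\<gamma> 0)) + dist (cmap c (\<gamma> 0)) (cmap c (\<gamma> s))"
      by (rule dist_triangle)
    ultimately have "dist y\<^sub>0 (cmap c (\<gamma> s)) \<le> 3 * e / 4"
      using start(2) by (simp add: dist_norm norm_minus_commute)
    then show ?thesis using before[OF s] unfolding C_def V_def by simp
  qed
  have "cball y\<^sub>0 (3 * e / 4) \<subseteq> cball y\<^sub>0 e" using e by (intro subset_cball) simp
  then have "closedin X C" unfolding C_def using sub by (intro closedin_coordinate_ball) blast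
  then have open_C: "openin X (topspace X - C)" by blast
  have "\<gamma> \<tau> \<in> C"
  proof (rule ccontr)
    assume "\<gamma> \<tau> \<notin> C"
    then have "\<forall>\<^sub>F s in at \<tau> within {0..1}. \<gamma> s \<in> topspace X - C"
      using \<tau>0 \<gamma>X by (intro eventually_in_openin[OF cont open_C]) auto
    then obtain d where d: "0 < d" "\<And>s. s \<in> {0..1} \<Longrightarrow> s \<noteq> \<tau> \<Longrightarrow> dist s \<tau> < d \<Longrightarrow> \<gamma> s \<notin> C"
      unfolding eventually_at by blast
    define s where "s = max 0 (\<tau> - d / 2)"
    have "0 \<le> s" "s < \<tau>" "dist s \<tau> < d" unfolding s_def using d(1) \<tau>0 by (auto simp: dist_real_def)
    then show False using d(2)[of s] in_C[of s] \<tau>0 by auto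
  qed
  moreover have "C \<subseteq> V" unfolding C_def V_def using e by auto
  ultimately show False using \<tau>0(3) by blast
qed

text \<open>The Cauchy condition is applied at the confinement threshold: every later point is
  joined to the fixed point \<open>P m\<close> by a curve that stays in the chart, so
  \<open>ln r\<close> stays bounded along the sequence, against its divergence at
  \<open>p\<close>.\<close>

lemma not_accessible:
  assumes A2: "2 \<le> a\<^sub>I" shows "\<not> accessible X A g p"
proof
  assume "accessible X A g p"
  then obtain P :: "nat \<Rightarrow> 'a" where P: "range P \<subseteq> minterior X A"
    and cauchy: "\<forall>\<epsilon>>0. \<exists>M. \<forall>m\<ge>M. \<forall>n\<ge>M. riemannian_dist X A g (P m) (P n) < ennreal \<epsilon>"
    and lim: "limitin X P p sequentially"
    unfolding accessible_def by (elim conjE exE)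
  have int: "P n \<in> minterior X A" for n using P by blast
  obtain e \<kappa> L where ctrl: "controlled e \<kappa> L" by (rule controlled_exists[OF A2])
  note e = controlledD(1)[OF ctrl] and \<kappa> = controlledD(2)[OF ctrl] and L = controlledD(3)[OF ctrl]
  define \<eta> where "\<eta> = \<kappa> * (e / 4)"
  have "0 < \<eta>" unfolding \<eta>_def using \<kappa> e by simp
  note cauchy[rule_format, OF this]
  then obtain M1 where M1: "\<forall>m\<ge>M1. \<forall>n\<ge>M1. riemannian_dist X A g (P m) (P n) < ennreal \<eta>" ..
  have "p \<in> {q \<in> cdom c. cmap c q \<in> ball y\<^sub>0 (e / 2)}" using c e by simp
  then have "\<forall>\<^sub>F n in sequentially. P n \<in> {q \<in> cdom c. cmap c q \<in> ball y\<^sub>0 (e / 2)}"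
    using lim openin_coordinate_ball unfolding limitin_def by blast
  then obtain M2 where M2: "\<And>n. n \<ge> M2 \<Longrightarrow> P n \<in> cdom c \<and> cmap c (P n) \<in> ball y\<^sub>0 (e / 2)"
    unfolding eventually_sequentially by blast
  define m where "m = max M1 M2"
  have "ennreal (\<kappa> / (L + 1) * \<bar>ln (r (P n)) - ln (r (P m))\<bar>) \<le> ennreal \<eta>" if n: "n \<ge> m" for n
  proof -
    have "riemannian_dist X A g (P m) (P n) < ennreal \<eta>" using M1 n unfolding m_def by simp
    \<comment> \<open>No minimising curve is needed: strict inequality for the infimum gives a
      competitor of length below \<eta>.\<close>
    then obtain \<gamma> where ac: "ac_curve X A {0..1} \<gamma>" and ends: "\<gamma> 0 = P m" "\<gamma> 1 = P n"
      and len: "curve_length A g {0..1} \<gamma> < ennreal \<eta>"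
      unfolding riemannian_dist_def INF_less_iff by blast
    have start: "\<gamma> 0 \<in> cdom c" "cmap c (\<gamma> 0) \<in> ball y\<^sub>0 (e / 2)"
      using M2[of m] unfolding ends m_def by auto
    have "\<gamma> t \<in> cdom c \<and> cmap c (\<gamma> t) \<in> cball y\<^sub>0 e" if "t \<in> {0..1}" for t
      using short_curve_confined[OF ctrl ac start len[unfolded \<eta>_def] that] by auto
    then have "ennreal (\<kappa> / (L + 1) * \<bar>ln (r (\<gamma> 1)) - ln (r (\<gamma> 0))\<bar>) \<le> curve_length A g {0..1} \<gamma>"
      by (intro curve_lower_bound(2)[OF ctrl ac]) auto
    then show ?thesis unfolding ends using len by (meson less_imp_le order_trans)
  qed
  then have bound: "\<forall>\<^sub>F n in sequentially. ennreal (\<kappa> / (L + 1) * \<bar>ln (r (P n)) - ln (r (P m))\<bar>) \<le> ennreal \<eta>"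
    unfolding eventually_sequentially by blast
  have "filterlim (\<lambda>n. ln (r (P n))) at_bot sequentially"
    using int by (intro r_tendsto_zero[OF lim]) simp
  then show False
    using \<kappa> L by (intro not_bounded_log[OF _ _ _ bound]) auto
qed

end

theorem theorem3p2:
  fixes X :: "'a topology"
    and A :: "('a, 'n::finite) corner_chart set"
    and g\<^sub>0 :: "('a, 'n) two_tensor"
    and N :: nat and H :: "nat \<Rightarrow> 'a set" and \<rho> :: "nat \<Rightarrow> 'a \<Rightarrow> real" and \<alpha> :: "nat \<Rightarrow> real"
    and I :: "nat set" and p :: 'a
  assumes "compact_manifold_with_corners X A"
    and "embedded_boundary_hypersurfaces X A N H"
    and "\<And>i. i \<in> {1..N} \<Longrightarrow> boundary_defining X A (H i) (\<rho> i)"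
    and "riemannian_metric A g\<^sub>0"
    and "\<And>i. i \<in> {1..N} \<Longrightarrow> 0 \<le> \<alpha> i"
    and "p \<in> mboundary A" and "I \<subseteq> {1..N}" and "p \<in> open_face X N H I" and "I \<noteq> {}"
  shows "(accessible X A (product_metric N \<rho> \<alpha> g\<^sub>0) p \<longleftrightarrow>
            finite_length_approachable X A (product_metric N \<rho> \<alpha> g\<^sub>0) p) \<and>
         (finite_length_approachable X A (product_metric N \<rho> \<alpha> g\<^sub>0) p \<longleftrightarrow>
            (\<Sum>i\<in>I. \<alpha> i) < 2)"
proof -
  have "smooth_atlas X A" "Hausdorff_space X"
    using assms(1) unfolding compact_manifold_with_corners_def by blast+
  moreover obtain c where "c \<in> A" "p \<in> cdom c"
    using assms(6) unfolding mboundary_def depth_stratum_def by blast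
  ultimately interpret face_point X A g\<^sub>0 N H \<rho> \<alpha> I p c
    using assms by unfold_locales
  show ?thesis
    using accessible_if finite_length_approachable_if not_accessible not_finite_length_approachable
    by (meson not_less)
qed

end
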